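(* Consider the cube with eight vertices $$C^b,\quad C^b/\mathcal P,\quad C^b/[1],\quad \amalg\operatorname{mod}\mathbb Z,\quad C^b/(\mathcal P,[1]),\quad \amalg\mathcal Ab_{\mathrm{fin}},\quad \operatorname{mod}\mathbb Z,\quad \mathcal Ab_{\mathrm{fin}}$$ and edges the functors $S,S_{\mathcal P},S_H,S_{H,\mathcal P}$ (push-down), $P,P_1,P_H,P_{H,1}$ (canonical functors modulo projectives), $H^\bullet,H^\bullet_1,H^\bullet_{\mathcal P},H^\bullet_{\mathcal P,1}$ (homology) defined in the context. All six faces of the cube are commutative squares (up to natural isomorphism), that is: $$S_{\mathcal P}\circ P\cong P_1\circ S,\qquad S_{H,\mathcal P}\circ P_H\cong P_{H,1}\circ S_H,$$ $$H^\bullet_{\mathcal P}\circ P\cong P_H\circ H^\bullet,\qquad H^\bullet_{\mathcal P,1}\circ P_1\cong P_{H,1}\circ H^\bullet_1,$$ $$H^\bullet_1\circ S\cong S_H\circ H^\bullet,\qquad H^\bullet_{\mathcal P,1}\circ S_{\mathcal P}\cong S_{H,\mathcal P}\circ H^\bullet_{\mathcal P}.$$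
   Context: $C^b=C^b(\operatorname{proj}(\mathbb Z))$ is the category of bounded complexes of finitely generated free abelian groups with shift $[1]$. For a category $\mathcal T$ with shift, the orbit category $\mathcal T/[1]$ has the same objects and $\operatorname{Hom}_{\mathcal T/[1]}(X,Y)=\bigoplus_{i\in\mathbb Z}\operatorname{Hom}_{\mathcal T}(X,Y[i])$, with composition of $f:X\to Y[i]$ and $g:Y\to Z[k]$ given by $g[i]\circ f$. The projective objects of $C^b$ are the finite direct sums of shifts of $\cdots\to0\to\mathbb Z\xrightarrow{=}\mathbb Z\to0\to\cdots$; $\mathcal P$ is the ideal of maps in $C^b$ factoring through a projective object, so $C^b/\mathcal P$ is the homotopy category $K^b(\operatorname{proj}(\mathbb Z))$. $C^b/(\mathcal P,[1])$ is the orbit category of $C^b/\mathcal P$ under $[1]$, equivalently the quotient of $C^b/[1]$ by the ideal of maps factoring through (the image of) a projective object of $C^b$. $\operatorname{mod}\mathbb Z$ is the category of finitely generated abelian groups, $\mathcal Ab_{\mathrm{fin}}$ that of finite abelian groups, identified with the quotient of $\operatorname{mod}\mathbb Z$ by the ideal of maps factoring through a projective object. For an additive category $\mathcal A$, $\amalg\mathcal A$ is the category of $\mathbb Z$-indexed families of objects of $\mathcal A$ with finite support, with degreewise morphisms. Functors. $S:C^b\to C^b/[1]$ and $S_{\mathcal P}:C^b/\mathcal P\to C^b/(\mathcal P,[1])$ are the canonical functors onto the orbit categories. $S_H:\amalg\operatorname{mod}\mathbb Z\to\operatorname{mod}\mathbb Z$ and $S_{H,\mathcal P}:\amalg\mathcal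 Ab_{\mathrm{fin}}\to\mathcal Ab_{\mathrm{fin}}$ take the direct sum of the objects and of the morphisms. $P:C^b\to C^b/\mathcal P$, $P_1:C^b/[1]\to C^b/(\mathcal P,[1])$, $P_H:\amalg\operatorname{mod}\mathbb Z\to\amalg\mathcal Ab_{\mathrm{fin}}$ and $P_{H,1}:\operatorname{mod}\mathbb Z\to\mathcal Ab_{\mathrm{fin}}$ are the canonical functors modulo the ideals of maps factoring through projective objects. $H^\bullet:C^b\to\amalg\operatorname{mod}\mathbb Z$ sends a complex $X$ to the family $(H^i(X))_{i\in\mathbb Z}$. $H^\bullet_1:C^b/[1]\to\operatorname{mod}\mathbb Z$ sends $X$ to $\bigoplus_jH^j(X)$ (so $\cdots\to0\to U\hookrightarrow F\to0\to\cdots$ goes to $F/U$), and a morphism with components $f_i:X\to Y[i]$ to the sum of the induced maps $H^j(X)\to H^{j}(Y[i])=H^{j+i}(Y)$. Both $H^\bullet$ and $H^\bullet_1$ vanish on projective objects of $C^b$, so factor as $H^\bullet=\underline H^\bullet\circ P$ and $H^\bullet_1=\underline H^\bullet_1\circ P_1$; set $H^\bullet_{\mathcal P}=P_H\circ\underline H^\bullet:C^b/\mathcal P\to\amalg\mathcal Ab_{\mathrm{fin}}$ and $H^\bullet_{\mathcal P,1}=P_{H,1}\circ\underline H^\bullet_1:C^b/(\mathcal P,[1])\to\mathcal Ab_{\mathrm{fin}}$. *)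

theory Defs
  imports "HOL-Algebra.Free_Abelian_Groups" "HOL-Algebra.Generated_Groups"
begin

section \<open>Preadditive categories, functors, natural isomorphisms\<close>

text \<open>
  Each hom-set carries its abelian group structure, written multiplicatively as in HOL-Algebra:
  the multiplication of \<open>Hom C X Y\<close> is the addition of morphisms and its unit is the zero map.
  Hom-sets need not be disjoint, so composition receives the objects involved;
  \<open>Comp C X Y Z g f\<close> is \<open>g \<circ> f\<close> for \<open>f : X \<rightarrow> Y\<close> and \<open>g : Y \<rightarrow> Z\<close>.
\<close>

record ('o, 'm) category =
  Obj :: "'o set"
  Hom :: "'o \<Rightarrow> 'o \<Rightarrow> 'm monoid"
  Idt :: "'o \<Rightarrow> 'm"
  Comp :: "'o \<Rightarrow> 'o \<Rightarrow> 'o \<Rightarrow> 'm \<Rightarrow> 'm \<Rightarrow> 'm"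

locale preadditive_category =
  fixes C :: "('o, 'm) category"
  assumes hom_group: "\<lbrakk>X \<in> Obj C; Y \<in> Obj C\<rbrakk> \<Longrightarrow> comm_group (Hom C X Y)"
    and id_closed: "X \<in> Obj C \<Longrightarrow> Idt C X \<in> carrier (Hom C X X)"
    and comp_closed: "\<lbrakk>X \<in> Obj C; Y \<in> Obj C; Z \<in> Obj C;
        f \<in> carrier (Hom C X Y); g \<in> carrier (Hom C Y Z)\<rbrakk>
        \<Longrightarrow> Comp C X Y Z g f \<in> carrier (Hom C X Z)"
    and comp_id_right: "\<lbrakk>X \<in> Obj C; Y \<in> Obj C; f \<in> carrier (Hom C X Y)\<rbrakk>
        \<Longrightarrow> Comp C X X Y f (Idt C X) = f"
    and comp_id_left: "\<lbrakk>X \<in> Obj C; Y \<in> Obj C; f \<in> carrier (Hom C X Y)\<rbrakk>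
        \<Longrightarrow> Comp C X Y Y (Idt C Y) f = f"
    and comp_assoc: "\<lbrakk>W \<in> Obj C; X \<in> Obj C; Y \<in> Obj C; Z \<in> Obj C;
        f \<in> carrier (Hom C W X); g \<in> carrier (Hom C X Y); h \<in> carrier (Hom C Y Z)\<rbrakk>
        \<Longrightarrow> Comp C W X Z (Comp C X Y Z h g) f = Comp C W Y Z h (Comp C W X Y g f)"
    and comp_add_left: "\<lbrakk>X \<in> Obj C; Y \<in> Obj C; Z \<in> Obj C; f \<in> carrier (Hom C X Y);
        g \<in> carrier (Hom C Y Z); g' \<in> carrier (Hom C Y Z)\<rbrakk>
        \<Longrightarrow> Comp C X Y Z (g \<otimes>\<^bsub>Hom C Y Z\<^esub> g') f
            = Comp C X Y Z g f \<otimes>\<^bsub>Hom C X Z\<^esub> Comp C X Y Z g' f"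
    and comp_add_right: "\<lbrakk>X \<in> Obj C; Y \<in> Obj C; Z \<in> Obj C; f \<in> carrier (Hom C X Y);
        f' \<in> carrier (Hom C X Y); g \<in> carrier (Hom C Y Z)\<rbrakk>
        \<Longrightarrow> Comp C X Y Z g (f \<otimes>\<^bsub>Hom C X Y\<^esub> f')
            = Comp C X Y Z g f \<otimes>\<^bsub>Hom C X Z\<^esub> Comp C X Y Z g f'"

record ('o, 'm, 'p, 'n) functor_data =
  FObj :: "'o \<Rightarrow> 'p"
  FMor :: "'o \<Rightarrow> 'o \<Rightarrow> 'm \<Rightarrow> 'n"

definition is_functor ::
  "('o, 'm) category \<Rightarrow> ('p, 'n) category \<Rightarrow> ('o, 'm, 'p, 'n) functor_data \<Rightarrow> bool"
where
  "is_functor C D F \<longleftrightarrow>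
     preadditive_category C \<and> preadditive_category D \<and>
     (\<forall>X\<in>Obj C. FObj F X \<in> Obj D) \<and>
     (\<forall>X\<in>Obj C. \<forall>Y\<in>Obj C. \<forall>f\<in>carrier (Hom C X Y).
        FMor F X Y f \<in> carrier (Hom D (FObj F X) (FObj F Y))) \<and>
     (\<forall>X\<in>Obj C. FMor F X X (Idt C X) = Idt D (FObj F X)) \<and>
     (\<forall>X\<in>Obj C. \<forall>Y\<in>Obj C. \<forall>Z\<in>Obj C. \<forall>f\<in>carrier (Hom C X Y). \<forall>g\<in>carrier (Hom C Y Z).
        FMor F X Z (Comp C X Y Z g f)
        = Comp D (FObj F X) (FObj F Y) (FObj F Z) (FMor F Y Z g) (FMor F X Y f))"

definition functor_comp ::
  "('p, 'n, 'q, 'k) functor_data \<Rightarrow> ('o, 'm, 'p, 'n) functor_data \<Rightarrow> ('o, 'm, 'q, 'k) functor_data"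
  (infixl \<open>\<circ>\<^sub>F\<close> 55)
where
  "G \<circ>\<^sub>F F = \<lparr>FObj = (\<lambda>X. FObj G (FObj F X)),
             FMor = (\<lambda>X Y f. FMor G (FObj F X) (FObj F Y) (FMor F X Y f))\<rparr>"

definition isomorphism :: "('o, 'm) category \<Rightarrow> 'o \<Rightarrow> 'o \<Rightarrow> 'm \<Rightarrow> bool" where
  "isomorphism C X Y f \<longleftrightarrow> f \<in> carrier (Hom C X Y) \<and>
     (\<exists>g\<in>carrier (Hom C Y X). Comp C X Y X g f = Idt C X \<and> Comp C Y X Y f g = Idt C Y)"

definition naturally_isomorphic ::
  "('o, 'm) category \<Rightarrow> ('p, 'n) category \<Rightarrow>
   ('o, 'm, 'p, 'n) functor_data \<Rightarrow> ('o, 'm, 'p, 'n) functor_data \<Rightarrow> bool"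
where
  "naturally_isomorphic C D F G \<longleftrightarrow>
     is_functor C D F \<and> is_functor C D G \<and>
     (\<exists>\<eta>. (\<forall>X\<in>Obj C. isomorphism D (FObj F X) (FObj G X) (\<eta> X)) \<and>
          (\<forall>X\<in>Obj C. \<forall>Y\<in>Obj C. \<forall>f\<in>carrier (Hom C X Y).
             Comp D (FObj F X) (FObj F Y) (FObj G Y) (\<eta> Y) (FMor F X Y f)
             = Comp D (FObj F X) (FObj G X) (FObj G Y) (FMor G X Y f) (\<eta> X)))"

definition full_subcategory :: "('o, 'm) category \<Rightarrow> ('o \<Rightarrow> bool) \<Rightarrow> ('o, 'm) category" where
  "full_subcategory C Q = C\<lparr>Obj := {X \<in> Obj C. Q X}\<rparr>"

definition zero_object :: "('o, 'm) category \<Rightarrow> 'o \<Rightarrow> bool" where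
  "zero_object C X \<longleftrightarrow> X \<in> Obj C \<and>
     (\<forall>Y\<in>Obj C. (\<exists>!f. f \<in> carrier (Hom C X Y)) \<and> (\<exists>!f. f \<in> carrier (Hom C Y X)))"

definition epimorphism :: "('o, 'm) category \<Rightarrow> 'o \<Rightarrow> 'o \<Rightarrow> 'm \<Rightarrow> bool" where
  "epimorphism C X Y e \<longleftrightarrow> e \<in> carrier (Hom C X Y) \<and>
     (\<forall>Z\<in>Obj C. \<forall>g\<in>carrier (Hom C Y Z). \<forall>h\<in>carrier (Hom C Y Z).
        Comp C X Y Z g e = Comp C X Y Z h e \<longrightarrow> g = h)"

definition projective_object :: "('o, 'm) category \<Rightarrow> 'o \<Rightarrow> bool" where
  "projective_object C P \<longleftrightarrow> P \<in> Obj C \<and>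
     (\<forall>X\<in>Obj C. \<forall>Y\<in>Obj C. \<forall>e. epimorphism C X Y e \<longrightarrow>
        (\<forall>f\<in>carrier (Hom C P Y). \<exists>g\<in>carrier (Hom C P X). Comp C P X Y e g = f))"


section \<open>Quotients by ideals, orbit categories, families of finite support\<close>

definition factoring_maps :: "('o, 'm) category \<Rightarrow> ('o \<Rightarrow> bool) \<Rightarrow> 'o \<Rightarrow> 'o \<Rightarrow> 'm set" where
  "factoring_maps C Q X Y =
     {Comp C X P Y b a | P a b. P \<in> Obj C \<and> Q P \<and>
        a \<in> carrier (Hom C X P) \<and> b \<in> carrier (Hom C P Y)}"

definition quotient_category :: "('o, 'm) category \<Rightarrow> ('o \<Rightarrow> bool) \<Rightarrow> ('o, 'm set) category" where
  "quotient_category C Q = \<lparr>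
     Obj = Obj C,
     Hom = (\<lambda>X Y. Hom C X Y Mod factoring_maps C Q X Y),
     Idt = (\<lambda>X. factoring_maps C Q X X #>\<^bsub>Hom C X X\<^esub> Idt C X),
     Comp = (\<lambda>X Y Z d c. factoring_maps C Q X Z #>\<^bsub>Hom C X Z\<^esub>
               Comp C X Y Z (SOME g. g \<in> d) (SOME f. f \<in> c))\<rparr>"

definition quotient_functor ::
  "('o, 'm) category \<Rightarrow> ('o \<Rightarrow> bool) \<Rightarrow> ('o, 'm, 'o, 'm set) functor_data"
where
  "quotient_functor C Q = \<lparr>
     FObj = (\<lambda>X. X),
     FMor = (\<lambda>X Y f. factoring_maps C Q X Y #>\<^bsub>Hom C X Y\<^esub> f)\<rparr>"

text \<open>
  Let \<open>Q\<close> be a full functor on \<open>C\<close> that is the identity on objects. If \<open>F\<close> is constant on the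
  fibres of \<open>Q\<close>, the following is the unique functor whose composite with \<open>Q\<close> is \<open>F\<close>.
\<close>

definition descend ::
  "('o, 'm) category \<Rightarrow> ('o, 'm, 'o, 'n) functor_data \<Rightarrow> ('o, 'm, 'p, 'k) functor_data
   \<Rightarrow> ('o, 'n, 'p, 'k) functor_data"
where
  "descend C Q F = \<lparr>
     FObj = FObj F,
     FMor = (\<lambda>X Y c. FMor F X Y (SOME f. f \<in> carrier (Hom C X Y) \<and> FMor Q X Y f = c))\<rparr>"

text \<open>
  In the orbit category, \<open>Sh k\<close> is the \<open>k\<close>-th power \<open>[k]\<close> of the shift. A morphism from \<open>X\<close> to
  \<open>Y\<close> is a finitely supported family of maps \<open>f i : X \<rightarrow> Y[i]\<close>. The composite \<open>h\<close> of the families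
  \<open>f\<close> and \<open>g\<close> has components \<open>h n\<close> equal to the sum over all \<open>i\<close> of \<open>g (n - i)[i] \<circ> f i\<close>,
  using \<open>Z[n - i][i] = Z[n]\<close>.
\<close>

definition orbit_category ::
  "('o, 'm) category \<Rightarrow> (int \<Rightarrow> ('o, 'm, 'o, 'm) functor_data) \<Rightarrow> ('o, int \<Rightarrow> 'm) category"
where
  "orbit_category C Sh = \<lparr>
     Obj = Obj C,
     Hom = (\<lambda>X Y. sum_group UNIV (\<lambda>i. Hom C X (FObj (Sh i) Y))),
     Idt = (\<lambda>X i. if i = 0 then Idt C X else \<one>\<^bsub>Hom C X (FObj (Sh i) X)\<^esub>),
     Comp = (\<lambda>X Y Z g f n. gfinprod (Hom C X (FObj (Sh n) Z))
               (\<lambda>i. Comp C X (FObj (Sh i) Y) (FObj (Sh n) Z)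
                      (FMor (Sh i) Y (FObj (Sh (n - i)) Z) (g (n - i))) (f i)) UNIV)\<rparr>"

definition orbit_projection ::
  "('o, 'm) category \<Rightarrow> (int \<Rightarrow> ('o, 'm, 'o, 'm) functor_data) \<Rightarrow>
   ('o, 'm, 'o, int \<Rightarrow> 'm) functor_data"
where
  "orbit_projection C Sh = \<lparr>
     FObj = (\<lambda>X. X),
     FMor = (\<lambda>X Y f i. if i = 0 then f else \<one>\<^bsub>Hom C X (FObj (Sh i) Y)\<^esub>)\<rparr>"

text \<open>The functor between orbit categories induced by an additive functor that strictly commutes
  with the shifts; the first argument is the shift of the source.\<close>

definition orbit_functor ::
  "(int \<Rightarrow> ('o, 'm, 'o, 'm) functor_data) \<Rightarrow> ('o, 'm, 'p, 'n) functor_data \<Rightarrow>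
   ('o, int \<Rightarrow> 'm, 'p, int \<Rightarrow> 'n) functor_data"
where
  "orbit_functor Sh F = \<lparr>
     FObj = FObj F,
     FMor = (\<lambda>X Y f i. FMor F X (FObj (Sh i) Y) (f i))\<rparr>"

definition family_category :: "('o, 'm) category \<Rightarrow> (int \<Rightarrow> 'o, int \<Rightarrow> 'm) category" where
  "family_category C = \<lparr>
     Obj = {X. (\<forall>i. X i \<in> Obj C) \<and> finite {i. \<not> zero_object C (X i)}},
     Hom = (\<lambda>X Y. product_group UNIV (\<lambda>i. Hom C (X i) (Y i))),
     Idt = (\<lambda>X i. Idt C (X i)),
     Comp = (\<lambda>X Y Z g f i. Comp C (X i) (Y i) (Z i) (g i) (f i))\<rparr>"

definition family_functor ::
  "('o, 'm, 'p, 'n) functor_data \<Rightarrow> (int \<Rightarrow> 'o, int \<Rightarrow> 'm, int \<Rightarrow> 'p, int \<Rightarrow> 'n) functor_data"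
where
  "family_functor F = \<lparr>
     FObj = (\<lambda>X i. FObj F (X i)),
     FMor = (\<lambda>X Y f i. FMor F (X i) (Y i) (f i))\<rparr>"


section \<open>Finitely generated abelian groups and finite abelian groups\<close>

text \<open>
  Carriers are subsets of a fixed type \<open>'b\<close>. If \<open>'b\<close> is infinite, every finitely generated abelian
  group is isomorphic to one with carrier in \<open>'b\<close>, so all infinite types give equivalent versions
  of the category. Homomorphisms are extensional, so that equality of functions is equality of maps.
\<close>

definition hom_group :: "'b monoid \<Rightarrow> 'c monoid \<Rightarrow> ('b \<Rightarrow> 'c) monoid" where
  "hom_group G H = \<lparr>
     carrier = hom G H \<inter> extensional (carrier G),
     monoid.mult = (\<lambda>f g. \<lambda>x\<in>carrier G. f x \<otimes>\<^bsub>H\<^esub> g x),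
     one = (\<lambda>x\<in>carrier G. \<one>\<^bsub>H\<^esub>)\<rparr>"

definition finitely_generated :: "'b monoid \<Rightarrow> bool" where
  "finitely_generated G \<longleftrightarrow> (\<exists>S. finite S \<and> S \<subseteq> carrier G \<and> generate G S = carrier G)"

definition modZ :: "('b monoid, 'b \<Rightarrow> 'b) category" where
  "modZ = \<lparr>
     Obj = {G. comm_group G \<and> finitely_generated G},
     Hom = hom_group,
     Idt = (\<lambda>G. \<lambda>x\<in>carrier G. x),
     Comp = (\<lambda>G H K g f. compose (carrier G) g f)\<rparr>"

definition Ab_fin :: "('b monoid, 'b \<Rightarrow> 'b) category" where
  "Ab_fin = full_subcategory modZ (\<lambda>G. finite (carrier G))"

definition modZ_fam :: "(int \<Rightarrow> 'b monoid, int \<Rightarrow> 'b \<Rightarrow> 'b) category" where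
  "modZ_fam = family_category modZ"

definition Ab_fin_fam :: "(int \<Rightarrow> 'b monoid, int \<Rightarrow> 'b \<Rightarrow> 'b) category" where
  "Ab_fin_fam = family_category Ab_fin"

definition direct_sum_functor ::
  "(int \<Rightarrow> 'b monoid, int \<Rightarrow> 'b \<Rightarrow> 'b, (int \<Rightarrow> 'b) monoid, (int \<Rightarrow> 'b) \<Rightarrow> (int \<Rightarrow> 'b)) functor_data"
where
  "direct_sum_functor = \<lparr>
     FObj = (\<lambda>G. sum_group UNIV G),
     FMor = (\<lambda>G H f. \<lambda>x\<in>carrier (sum_group UNIV G). (\<lambda>i. f i (x i)))\<rparr>"

definition S_H where "S_H = direct_sum_functor"

definition S_HP where "S_HP = direct_sum_functor"

text \<open>
  The canonical functor \<open>P_H1\<close> is the projection of \<open>modZ\<close> onto its quotient by the maps that factor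
  through a projective object, followed by the identification of this quotient with the category of
  finite abelian groups. A finitely generated abelian group is the direct sum of its torsion
  subgroup and a free group, and a map that factors through a projective group vanishes on torsion;
  hence the functor induced on the quotient by the torsion functor is an equivalence, quasi-inverse
  to the functor induced by the inclusion of the finite groups. The functor \<open>P_H\<close> is obtained
  in the same way from the category of families.
\<close>

definition torsion :: "'b monoid \<Rightarrow> 'b monoid" where
  "torsion G = G\<lparr>carrier := {x \<in> carrier G. \<exists>n::nat. 0 < n \<and> x [^]\<^bsub>G\<^esub> n = \<one>\<^bsub>G\<^esub>}\<rparr>"

definition torsion_functor :: "('b monoid, 'b \<Rightarrow> 'b, 'b monoid, 'b \<Rightarrow> 'b) functor_data" where
  "torsion_functor = \<lparr>FObj = torsion, FMor = (\<lambda>G H f. restrict f (carrier (torsion G)))\<rparr>"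

definition P_H1 :: "('b monoid, 'b \<Rightarrow> 'b, 'b monoid, 'b \<Rightarrow> 'b) functor_data" where
  "P_H1 = (let Q = quotient_functor modZ (projective_object modZ)
           in descend modZ Q torsion_functor \<circ>\<^sub>F Q)"

definition P_H ::
  "(int \<Rightarrow> 'b monoid, int \<Rightarrow> 'b \<Rightarrow> 'b, int \<Rightarrow> 'b monoid, int \<Rightarrow> 'b \<Rightarrow> 'b) functor_data"
where
  "P_H = (let Q = quotient_functor modZ_fam (projective_object modZ_fam)
          in descend modZ_fam Q (family_functor torsion_functor) \<circ>\<^sub>F Q)"


section \<open>Bounded complexes of finitely generated free abelian groups\<close>

record 'a complex =
  Grp :: "int \<Rightarrow> 'a monoid"
  diff :: "int \<Rightarrow> 'a \<Rightarrow> 'a"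

definition fg_free :: "'a monoid \<Rightarrow> bool" where
  "fg_free G \<longleftrightarrow> comm_group G \<and> (\<exists>n::nat. G \<cong> free_Abelian_group {..<n})"

definition bounded_free_complex :: "'a complex \<Rightarrow> bool" where
  "bounded_free_complex X \<longleftrightarrow>
     (\<forall>i. fg_free (Grp X i)) \<and>
     (\<forall>i. diff X i \<in> carrier (hom_group (Grp X i) (Grp X (i + 1)))) \<and>
     (\<forall>i. \<forall>x\<in>carrier (Grp X i). diff X (i + 1) (diff X i x) = \<one>\<^bsub>Grp X (i + 2)\<^esub>) \<and>
     finite {i. \<not> trivial_group (Grp X i)}"

definition chain_maps :: "'a complex \<Rightarrow> 'a complex \<Rightarrow> (int \<Rightarrow> 'a \<Rightarrow> 'a) set" where
  "chain_maps X Y =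
     {f. (\<forall>i. f i \<in> carrier (hom_group (Grp X i) (Grp Y i))) \<and>
         (\<forall>i. \<forall>x\<in>carrier (Grp X i). f (i + 1) (diff X i x) = diff Y i (f i x))}"

definition Cb :: "('a complex, int \<Rightarrow> 'a \<Rightarrow> 'a) category" where
  "Cb = \<lparr>
     Obj = {X. bounded_free_complex X},
     Hom = (\<lambda>X Y. \<lparr>carrier = chain_maps X Y,
               monoid.mult = (\<lambda>f g i. f i \<otimes>\<^bsub>hom_group (Grp X i) (Grp Y i)\<^esub> g i),
               one = (\<lambda>i. \<one>\<^bsub>hom_group (Grp X i) (Grp Y i)\<^esub>)\<rparr>),
     Idt = (\<lambda>X i. \<lambda>x\<in>carrier (Grp X i). x),
     Comp = (\<lambda>X Y Z g f i. compose (carrier (Grp X i)) (g i) (f i))\<rparr>"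

text \<open>The differential of \<open>X[k]\<close> is that of \<open>X\<close> up to the sign \<open>(-1)\<^sup>k\<close>.\<close>

definition shift_complex :: "int \<Rightarrow> 'a complex \<Rightarrow> 'a complex" where
  "shift_complex k X = \<lparr>
     Grp = (\<lambda>i. Grp X (i + k)),
     diff = (\<lambda>i. \<lambda>x\<in>carrier (Grp X (i + k)).
        if even k then diff X (i + k) x else inv\<^bsub>Grp X (i + k + 1)\<^esub> diff X (i + k) x)\<rparr>"

definition shift :: "int \<Rightarrow>
  ('a complex, int \<Rightarrow> 'a \<Rightarrow> 'a, 'a complex, int \<Rightarrow> 'a \<Rightarrow> 'a) functor_data"
where
  "shift k = \<lparr>FObj = shift_complex k, FMor = (\<lambda>X Y f i. f (i + k))\<rparr>"

definition disc :: "int complex" where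
  "disc = \<lparr>
     Grp = (\<lambda>i. if i = 0 \<or> i = 1 then integer_group else singleton_group 0),
     diff = (\<lambda>i x. if i = 0 then x else 0)\<rparr>"

definition direct_sum_complex :: "'i set \<Rightarrow> ('i \<Rightarrow> 'a complex) \<Rightarrow> ('i \<Rightarrow> 'a) complex" where
  "direct_sum_complex I X = \<lparr>
     Grp = (\<lambda>i. sum_group I (\<lambda>k. Grp (X k) i)),
     diff = (\<lambda>i x. \<lambda>k\<in>I. diff (X k) i (x k))\<rparr>"

definition isomorphic_complexes :: "'a complex \<Rightarrow> 'b complex \<Rightarrow> bool" where
  "isomorphic_complexes X Y \<longleftrightarrow>
     (\<exists>f. (\<forall>i. f i \<in> iso (Grp X i) (Grp Y i)) \<and>
          (\<forall>i. \<forall>x\<in>carrier (Grp X i). f (i + 1) (diff X i x) = diff Y i (f i x)))"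

definition projective_complex :: "'a complex \<Rightarrow> bool" where
  "projective_complex X \<longleftrightarrow> bounded_free_complex X \<and>
     (\<exists>ks :: int list. isomorphic_complexes X
        (direct_sum_complex {..<length ks} (\<lambda>j. shift_complex (ks ! j) disc)))"

definition P_C :: "('a complex, int \<Rightarrow> 'a \<Rightarrow> 'a, 'a complex, (int \<Rightarrow> 'a \<Rightarrow> 'a) set) functor_data" where
  "P_C = quotient_functor Cb projective_complex"

definition Cb_P :: "('a complex, (int \<Rightarrow> 'a \<Rightarrow> 'a) set) category" where
  "Cb_P = quotient_category Cb projective_complex"

definition shift_P :: "int \<Rightarrow>
  ('a complex, (int \<Rightarrow> 'a \<Rightarrow> 'a) set, 'a complex, (int \<Rightarrow> 'a \<Rightarrow> 'a) set) functor_data"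
where
  "shift_P k = descend Cb P_C (P_C \<circ>\<^sub>F shift k)"

definition Cb_1 :: "('a complex, int \<Rightarrow> int \<Rightarrow> 'a \<Rightarrow> 'a) category" where
  "Cb_1 = orbit_category Cb shift"

definition Cb_P1 :: "('a complex, int \<Rightarrow> (int \<Rightarrow> 'a \<Rightarrow> 'a) set) category" where
  "Cb_P1 = orbit_category Cb_P shift_P"

definition S_C :: "('a complex, int \<Rightarrow> 'a \<Rightarrow> 'a, 'a complex, int \<Rightarrow> int \<Rightarrow> 'a \<Rightarrow> 'a) functor_data" where
  "S_C = orbit_projection Cb shift"

definition S_P :: "('a complex, (int \<Rightarrow> 'a \<Rightarrow> 'a) set,
    'a complex, int \<Rightarrow> (int \<Rightarrow> 'a \<Rightarrow> 'a) set) functor_data" where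
  "S_P = orbit_projection Cb_P shift_P"

definition P_1 :: "('a complex, int \<Rightarrow> int \<Rightarrow> 'a \<Rightarrow> 'a,
    'a complex, int \<Rightarrow> (int \<Rightarrow> 'a \<Rightarrow> 'a) set) functor_data" where
  "P_1 = orbit_functor shift P_C"


section \<open>Homology\<close>

definition boundaries :: "'a complex \<Rightarrow> int \<Rightarrow> 'a set" where
  "boundaries X i = diff X (i - 1) ` carrier (Grp X (i - 1))"

definition homology :: "'a complex \<Rightarrow> int \<Rightarrow> 'a set monoid" where
  "homology X i =
     (Grp X i)\<lparr>carrier := kernel (Grp X i) (Grp X (i + 1)) (diff X i)\<rparr> Mod boundaries X i"

text \<open>The class of a cocycle \<open>z\<close> is the coset of \<open>z\<close>; it is sent to the coset of \<open>f i z\<close>.\<close>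

definition homology_map ::
  "'a complex \<Rightarrow> 'a complex \<Rightarrow> (int \<Rightarrow> 'a \<Rightarrow> 'a) \<Rightarrow> int \<Rightarrow> 'a set \<Rightarrow> 'a set"
where
  "homology_map X Y f i =
     (\<lambda>c\<in>carrier (homology X i). boundaries Y i <#>\<^bsub>Grp Y i\<^esub> (f i ` c))"

definition H_C :: "('a complex, int \<Rightarrow> 'a \<Rightarrow> 'a,
    int \<Rightarrow> 'a set monoid, int \<Rightarrow> 'a set \<Rightarrow> 'a set) functor_data" where
  "H_C = \<lparr>FObj = homology, FMor = homology_map\<rparr>"

text \<open>The component \<open>f (n - j) : X \<rightarrow> Y[n - j]\<close> induces a map from the \<open>j\<close>-th homology of \<open>X\<close> to
  that of \<open>Y[n - j]\<close>, which is the \<open>n\<close>-th homology of \<open>Y\<close>.\<close>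

definition H_1 :: "('a complex, int \<Rightarrow> int \<Rightarrow> 'a \<Rightarrow> 'a,
    (int \<Rightarrow> 'a set) monoid, (int \<Rightarrow> 'a set) \<Rightarrow> (int \<Rightarrow> 'a set)) functor_data" where
  "H_1 = \<lparr>
     FObj = (\<lambda>X. sum_group UNIV (homology X)),
     FMor = (\<lambda>X Y f. \<lambda>x\<in>carrier (sum_group UNIV (homology X)).
        (\<lambda>n. gfinprod (homology Y n)
               (\<lambda>j. homology_map X (shift_complex (n - j) Y) (f (n - j)) j (x j)) UNIV))\<rparr>"

definition H_P :: "('a complex, (int \<Rightarrow> 'a \<Rightarrow> 'a) set,
    int \<Rightarrow> 'a set monoid, int \<Rightarrow> 'a set \<Rightarrow> 'a set) functor_data" where
  "H_P = P_H \<circ>\<^sub>F descend Cb P_C H_C"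

definition H_P1 :: "('a complex, int \<Rightarrow> (int \<Rightarrow> 'a \<Rightarrow> 'a) set,
    (int \<Rightarrow> 'a set) monoid, (int \<Rightarrow> 'a set) \<Rightarrow> (int \<Rightarrow> 'a set)) functor_data" where
  "H_P1 = P_H1 \<circ>\<^sub>F descend Cb_1 P_1 H_1"

end

(* All six squares commute strictly, so the identities are the natural isomorphisms; the work lies in
   showing that the twelve functors are well defined.

   Composition in an orbit category and the action of H_1 on total homology are multilinear, and every
   finitely supported family is a sum of homogeneous ones. Associativity and functoriality thus
   reduce to homogeneous arguments.

   Every finitely generated abelian group is an epimorphic image of a torsion-free one, so projective
   objects are torsion-free and maps that factor through them vanish on torsion. Hence P_H and P_H1 act
   as the torsion functor.

   The maps of complexes that factor through a projective one are those that factor through a finite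
   sum of shifts of the disc complex, up to isomorphism, and concatenating two such sums shows that they
   form an ideal. Homology vanishes on these sums, so it descends to the quotient categories. *)
theory Submission
  imports Defs "HOL-Algebra.Weak_Morphisms"
begin

section \<open>Functors and natural isomorphisms\<close>

text \<open>Strict commutativity is possible because several identifications that usually hold only
  up to isomorphism are equalities here. A shifted complex has literally the same homology groups,
  since a sign in the differential changes neither kernel nor image. The torsion subgroup of a
  direct sum is literally the direct sum of the torsion subgroups. Iterated shifts agree with the
  shift by the sum, since signs cancel and differentials are extensional functions. Two obstacles
  shape the proof. Composites of cosets and descended functors are evaluated on representatives
  selected by \<open>SOME\<close>, so independence of the choice has to be shown throughout.
  Moreover, the elements of an object lie in a fixed type, whereas free covers and sums of discs
  arise over other types. They are countable, so an infinite type has room for copies of them; this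
  is the source of the hypothesis on \<open>'a\<close>. Whenever representatives or covers are
  selected degree by degree, finiteness of the support has to be secured by a suitable
  choice.\<close>

lemma is_functorI:
  assumes "preadditive_category C" "preadditive_category D"
    and "\<And>X. X \<in> Obj C \<Longrightarrow> FObj F X \<in> Obj D"
    and "\<And>X Y f. \<lbrakk>X \<in> Obj C; Y \<in> Obj C; f \<in> carrier (Hom C X Y)\<rbrakk>
      \<Longrightarrow> FMor F X Y f \<in> carrier (Hom D (FObj F X) (FObj F Y))"
    and "\<And>X. X \<in> Obj C \<Longrightarrow> FMor F X X (Idt C X) = Idt D (FObj F X)"
    and "\<And>X Y Z f g. \<lbrakk>X \<in> Obj C; Y \<in> Obj C; Z \<in> Obj C;
        f \<in> carrier (Hom C X Y); g \<in> carrier (Hom C Y Z)\<rbrakk>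
      \<Longrightarrow> FMor F X Z (Comp C X Y Z g f)
          = Comp D (FObj F X) (FObj F Y) (FObj F Z) (FMor F Y Z g) (FMor F X Y f)"
  shows "is_functor C D F"
  using assms unfolding is_functor_def by blast

lemma is_functorD:
  assumes "is_functor C D F"
  shows "preadditive_category C" "preadditive_category D"
    and "\<And>X. X \<in> Obj C \<Longrightarrow> FObj F X \<in> Obj D"
    and "\<And>X Y f. \<lbrakk>X \<in> Obj C; Y \<in> Obj C; f \<in> carrier (Hom C X Y)\<rbrakk>
      \<Longrightarrow> FMor F X Y f \<in> carrier (Hom D (FObj F X) (FObj F Y))"
    and "\<And>X. X \<in> Obj C \<Longrightarrow> FMor F X X (Idt C X) = Idt D (FObj F X)"
    and "\<And>X Y Z f g. \<lbrakk>X \<in> Obj C; Y \<in> Obj C; Z \<in> Obj C;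
        f \<in> carrier (Hom C X Y); g \<in> carrier (Hom C Y Z)\<rbrakk>
      \<Longrightarrow> FMor F X Z (Comp C X Y Z g f)
          = Comp D (FObj F X) (FObj F Y) (FObj F Z) (FMor F Y Z g) (FMor F X Y f)"
  using assms unfolding is_functor_def by blast+

lemma FObj_comp [simp]: "FObj (G \<circ>\<^sub>F F) X = FObj G (FObj F X)"
  and FMor_comp [simp]: "FMor (G \<circ>\<^sub>F F) X Y f = FMor G (FObj F X) (FObj F Y) (FMor F X Y f)"
  by (simp_all add: functor_comp_def)

lemma is_functor_comp:
  assumes F: "is_functor C D F" and G: "is_functor D E G"
  shows "is_functor C E (G \<circ>\<^sub>F F)"
  by (rule is_functorI) (simp_all add: is_functorD[OF F] is_functorD[OF G])

text \<open>On morphisms, \<open>P_H1\<close> and \<open>P_H\<close> are known to coincide with the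
  torsion functors only inside the hom-sets of genuine objects, so functoriality has to be
  transferred along agreement there.\<close>

lemma is_functor_cong:
  assumes F: "is_functor C D F"
    and "\<And>X. X \<in> Obj C \<Longrightarrow> FObj G X = FObj F X"
    and "\<And>X Y f. \<lbrakk>X \<in> Obj C; Y \<in> Obj C; f \<in> carrier (Hom C X Y)\<rbrakk>
      \<Longrightarrow> FMor G X Y f = FMor F X Y f"
  shows "is_functor C D G"
proof (rule is_functorI)
  interpret preadditive_category C by (rule is_functorD(1)[OF F])
  show "FMor G X X (Idt C X) = Idt D (FObj G X)" if "X \<in> Obj C" for X
    using that assms(2,3) id_closed is_functorD(5)[OF F] by simp
  show "FMor G X Z (Comp C X Y Z g f)
      = Comp D (FObj G X) (FObj G Y) (FObj G Z) (FMor G Y Z g) (FMor G X Y f)"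
    if "X \<in> Obj C" "Y \<in> Obj C" "Z \<in> Obj C"
      "f \<in> carrier (Hom C X Y)" "g \<in> carrier (Hom C Y Z)" for X Y Z f g
    using that assms(2,3) comp_closed is_functorD(6)[OF F] by simp
qed (use assms is_functorD[OF F] in simp_all)

text \<open>The components are identity morphisms, read as maps from \<open>FObj F X\<close> to
  \<open>FObj G X\<close> because the two objects are equal; naturality then reduces to the unit
  laws of \<open>D\<close>.\<close>

lemma naturally_isomorphic_if_eq:
  assumes F: "is_functor C D F" and G: "is_functor C D G"
    and obj: "\<And>X. X \<in> Obj C \<Longrightarrow> FObj F X = FObj G X"
    and mor: "\<And>X Y f. \<lbrakk>X \<in> Obj C; Y \<in> Obj C; f \<in> carrier (Hom C X Y)\<rbrakk>
      \<Longrightarrow> FMor F X Y f = FMor G X Y f"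
  shows "naturally_isomorphic C D F G"
proof -
  interpret D: preadditive_category D by (rule is_functorD(2)[OF F])
  have "isomorphism D (FObj F X) (FObj G X) (Idt D (FObj F X))" if "X \<in> Obj C" for X
    using that is_functorD(3)[OF F that] D.id_closed[of "FObj F X"] D.comp_id_left[of "FObj F X"]
    by (auto simp: isomorphism_def simp flip: obj)
  moreover have "Comp D (FObj F X) (FObj F Y) (FObj G Y) (Idt D (FObj F Y)) (FMor F X Y f)
             = Comp D (FObj F X) (FObj G X) (FObj G Y) (FMor G X Y f) (Idt D (FObj F X))"
    if "X \<in> Obj C" "Y \<in> Obj C" "f \<in> carrier (Hom C X Y)" for X Y f
    using that is_functorD(3,4)[OF F] D.comp_id_left D.comp_id_right
    by (simp flip: obj mor)
  ultimately show ?thesis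
    unfolding naturally_isomorphic_def using F G
    by (intro conjI exI[of _ "\<lambda>X. Idt D (FObj F X)"]) auto
qed

text \<open>\<open>is_functor\<close> does not include additivity. It is demanded separately for
  orbit categories: zero maps must go to zero maps to keep supports finite, and sums to sums for the
  reduction to homogeneous maps.\<close>

definition additive_functor ::
  "('o, 'm) category \<Rightarrow> ('p, 'n) category \<Rightarrow> ('o, 'm, 'p, 'n) functor_data \<Rightarrow> bool"
where
  "additive_functor C D F \<longleftrightarrow> is_functor C D F \<and>
     (\<forall>X\<in>Obj C. \<forall>Y\<in>Obj C. FMor F X Y \<in> hom (Hom C X Y) (Hom D (FObj F X) (FObj F Y)))"

lemma additive_functorD:
  assumes "additive_functor C D F"
  shows "is_functor C D F"
    and "\<And>X Y. \<lbrakk>X \<in> Obj C; Y \<in> Obj C\<rbrakk>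
      \<Longrightarrow> FMor F X Y \<in> hom (Hom C X Y) (Hom D (FObj F X) (FObj F Y))"
  using assms by (auto simp: additive_functor_def)

context preadditive_category
begin

lemma hom_is_group: "\<lbrakk>X \<in> Obj C; Y \<in> Obj C\<rbrakk> \<Longrightarrow> group (Hom C X Y)"
  using hom_group comm_group.axioms(2) by blast

lemma one_closed: "\<lbrakk>X \<in> Obj C; Y \<in> Obj C\<rbrakk> \<Longrightarrow> \<one>\<^bsub>Hom C X Y\<^esub> \<in> carrier (Hom C X Y)"
  using hom_is_group group.is_monoid monoid.one_closed by blast

lemma comp_hom_left:
  assumes "X \<in> Obj C" "Y \<in> Obj C" "Z \<in> Obj C" "f \<in> carrier (Hom C X Y)"
  shows "(\<lambda>g. Comp C X Y Z g f) \<in> hom (Hom C Y Z) (Hom C X Z)"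
  using assms by (auto simp: hom_def comp_closed comp_add_left)

lemma comp_hom_right:
  assumes "X \<in> Obj C" "Y \<in> Obj C" "Z \<in> Obj C" "g \<in> carrier (Hom C Y Z)"
  shows "Comp C X Y Z g \<in> hom (Hom C X Y) (Hom C X Z)"
  using assms by (auto simp: hom_def comp_closed comp_add_right)

lemma comp_one_left [simp]:
  assumes "X \<in> Obj C" "Y \<in> Obj C" "Z \<in> Obj C" "f \<in> carrier (Hom C X Y)"
  shows "Comp C X Y Z \<one>\<^bsub>Hom C Y Z\<^esub> f = \<one>\<^bsub>Hom C X Z\<^esub>"
  using hom_one[OF comp_hom_left] assms hom_is_group by blast

lemma comp_one_right [simp]:
  assumes "X \<in> Obj C" "Y \<in> Obj C" "Z \<in> Obj C" "g \<in> carrier (Hom C Y Z)"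
  shows "Comp C X Y Z g \<one>\<^bsub>Hom C X Y\<^esub> = \<one>\<^bsub>Hom C X Z\<^esub>"
  using hom_one[OF comp_hom_right] assms hom_is_group by blast

end

lemma additive_functor_one:
  assumes F: "additive_functor C D F" and X: "X \<in> Obj C" "Y \<in> Obj C"
  shows "FMor F X Y \<one>\<^bsub>Hom C X Y\<^esub> = \<one>\<^bsub>Hom D (FObj F X) (FObj F Y)\<^esub>"
proof (rule hom_one[OF additive_functorD(2)[OF F X]])
  note F' = is_functorD[OF additive_functorD(1)[OF F]]
  show "group (Hom C X Y)" "group (Hom D (FObj F X) (FObj F Y))"
    using F' X by (auto intro: preadditive_category.hom_is_group)
qed


section \<open>Quotient categories and descent\<close>

lemma quotient_category_simps [simp]:
  "Obj (quotient_category C Q) = Obj C"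
  "Hom (quotient_category C Q) X Y = Hom C X Y Mod factoring_maps C Q X Y"
  "Idt (quotient_category C Q) X = factoring_maps C Q X X #>\<^bsub>Hom C X X\<^esub> Idt C X"
  by (simp_all add: quotient_category_def)

lemma quotient_functor_simps [simp]:
  "FObj (quotient_functor C Q) X = X"
  "FMor (quotient_functor C Q) X Y f = factoring_maps C Q X Y #>\<^bsub>Hom C X Y\<^esub> f"
  by (simp_all add: quotient_functor_def)

text \<open>Closure of the factoring maps under composition on either side is automatic, as
  \<open>comp_factoring\<close> and \<open>factoring_comp\<close> show. Closure under addition
  depends on \<open>Q\<close>, and therefore the subgroup property is an axiom of the
  locale.\<close>

locale ideal_quotient = preadditive_category C for C :: "('o, 'm) category" +
  fixes Q :: "'o \<Rightarrow> bool"
  assumes subgroup_factoring: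
    "\<lbrakk>X \<in> Obj C; Y \<in> Obj C\<rbrakk> \<Longrightarrow> subgroup (factoring_maps C Q X Y) (Hom C X Y)"
begin

lemma comp_factoring:
  assumes "X \<in> Obj C" "Y \<in> Obj C" "Z \<in> Obj C"
    and "a \<in> factoring_maps C Q X Y" "g \<in> carrier (Hom C Y Z)"
  shows "Comp C X Y Z g a \<in> factoring_maps C Q X Z"
proof -
  from assms obtain P u v where "P \<in> Obj C" "Q P" "u \<in> carrier (Hom C X P)"
    "v \<in> carrier (Hom C P Y)" "a = Comp C X P Y v u"
    by (auto simp: factoring_maps_def)
  moreover from this assms have "Comp C X Y Z g a = Comp C X P Z (Comp C P Y Z g v) u"
    by (simp add: comp_assoc)
  moreover from calculation assms have "Comp C P Y Z g v \<in> carrier (Hom C P Z)"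
    by (simp add: comp_closed)
  ultimately show ?thesis
    unfolding factoring_maps_def by blast
qed

lemma factoring_comp:
  assumes "X \<in> Obj C" "Y \<in> Obj C" "Z \<in> Obj C"
    and "a \<in> factoring_maps C Q Y Z" "f \<in> carrier (Hom C X Y)"
  shows "Comp C X Y Z a f \<in> factoring_maps C Q X Z"
proof -
  from assms obtain P u v where "P \<in> Obj C" "Q P" "u \<in> carrier (Hom C Y P)"
    "v \<in> carrier (Hom C P Z)" "a = Comp C Y P Z v u"
    by (auto simp: factoring_maps_def)
  moreover from this assms have "Comp C X Y Z a f = Comp C X P Z v (Comp C X Y P u f)"
    by (simp add: comp_assoc)
  moreover from calculation assms have "Comp C X Y P u f \<in> carrier (Hom C X P)"
    by (simp add: comp_closed)
  ultimately show ?thesis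
    unfolding factoring_maps_def by blast
qed

lemma normal_factoring:
  "\<lbrakk>X \<in> Obj C; Y \<in> Obj C\<rbrakk> \<Longrightarrow> normal (factoring_maps C Q X Y) (Hom C X Y)"
  by (simp add: comm_group.subgroup_imp_normal hom_group subgroup_factoring)

abbreviation coset :: "'o \<Rightarrow> 'o \<Rightarrow> 'm \<Rightarrow> 'm set" where
  "coset X Y f \<equiv> factoring_maps C Q X Y #>\<^bsub>Hom C X Y\<^esub> f"

lemma mem_coset_iff: "g \<in> coset X Y f \<longleftrightarrow> (\<exists>a\<in>factoring_maps C Q X Y. g = a \<otimes>\<^bsub>Hom C X Y\<^esub> f)"
  by (auto simp: r_coset_def)

lemma mem_coset_self:
  "\<lbrakk>X \<in> Obj C; Y \<in> Obj C; f \<in> carrier (Hom C X Y)\<rbrakk> \<Longrightarrow> f \<in> coset X Y f"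
  by (simp add: group.rcos_self hom_is_group subgroup_factoring)

lemma coset_eq_iff:
  assumes "X \<in> Obj C" "Y \<in> Obj C" "f \<in> carrier (Hom C X Y)" "g \<in> carrier (Hom C X Y)"
  shows "coset X Y f = coset X Y g \<longleftrightarrow> (\<exists>a\<in>factoring_maps C Q X Y. g = a \<otimes>\<^bsub>Hom C X Y\<^esub> f)"
  using assms mem_coset_self[of X Y g] group.repr_independence[of "Hom C X Y" g _ f]
  by (metis hom_is_group mem_coset_iff subgroup_factoring)

lemma factoring_closed:
  "\<lbrakk>X \<in> Obj C; Y \<in> Obj C; a \<in> factoring_maps C Q X Y\<rbrakk> \<Longrightarrow> a \<in> carrier (Hom C X Y)"
  using subgroup_factoring subgroup.subset by blast

lemma comp_coset:
  assumes XYZ: "X \<in> Obj C" "Y \<in> Obj C" "Z \<in> Obj C"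
    and f: "f \<in> carrier (Hom C X Y)" and g: "g \<in> carrier (Hom C Y Z)"
  shows "Comp (quotient_category C Q) X Y Z (coset Y Z g) (coset X Y f)
    = coset X Z (Comp C X Y Z g f)"
proof -
  define f' where "f' = (SOME x. x \<in> coset X Y f)"
  define g' where "g' = (SOME x. x \<in> coset Y Z g)"
  have "f' \<in> coset X Y f"
    unfolding f'_def using mem_coset_self[OF XYZ(1,2) f] by (rule someI)
  then obtain a where a: "a \<in> factoring_maps C Q X Y" "f' = a \<otimes>\<^bsub>Hom C X Y\<^esub> f"
    by (auto simp: mem_coset_iff)
  have "g' \<in> coset Y Z g"
    unfolding g'_def using mem_coset_self[OF XYZ(2,3) g] by (rule someI)
  then obtain b where b: "b \<in> factoring_maps C Q Y Z" "g' = b \<otimes>\<^bsub>Hom C Y Z\<^esub> g"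
    by (auto simp: mem_coset_iff)
  interpret XY: comm_group "Hom C X Y" using XYZ by (simp add: hom_group)
  interpret YZ: comm_group "Hom C Y Z" using XYZ by (simp add: hom_group)
  interpret XZ: comm_group "Hom C X Z" using XYZ by (simp add: hom_group)
  note ac = factoring_closed[OF XYZ(1,2) a(1)] and bc = factoring_closed[OF XYZ(2,3) b(1)]
  note cc = comp_closed[OF XYZ]
  have f': "f' \<in> carrier (Hom C X Y)" and g': "g' \<in> carrier (Hom C Y Z)"
    using a b ac bc f g by auto
  \<comment> \<open>With \<open>f' = a + f\<close> and \<open>g' = b + g\<close>, bilinearity gives
    \<open>b \<circ> f' + g \<circ> a + g \<circ> f\<close>. The first two terms lie in the ideal,
    so the selection made by \<open>SOME\<close> does not affect the coset.\<close>
  have "Comp C X Y Z g' f' = (Comp C X Y Z b f' \<otimes>\<^bsub>Hom C X Z\<^esub> Comp C X Y Z g a) \<otimes>\<^bsub>Hom C X Z\<^esub> Comp C X Y Z g f"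
    using XYZ f g ac bc f' a(2)
    by (simp add: b(2) comp_add_left comp_add_right cc XZ.m_assoc XZ.m_lcomm)
  moreover have "Comp C X Y Z b f' \<otimes>\<^bsub>Hom C X Z\<^esub> Comp C X Y Z g a \<in> factoring_maps C Q X Z"
    using XYZ a b f' g
    by (intro subgroup.m_closed[OF subgroup_factoring] factoring_comp comp_factoring) auto
  ultimately have "coset X Z (Comp C X Y Z g f) = coset X Z (Comp C X Y Z g' f')"
    by (subst coset_eq_iff[OF XYZ(1,3) cc[OF f g] cc[OF f' g']]) auto
  then show ?thesis
    by (simp add: quotient_category_def f'_def g'_def)
qed

lemma coset_carrierE:
  assumes "c \<in> carrier (Hom C X Y Mod factoring_maps C Q X Y)"
  obtains f where "f \<in> carrier (Hom C X Y)" "c = coset X Y f"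
  using assms by (auto simp: carrier_FactGroup)

lemma coset_carrier:
  "f \<in> carrier (Hom C X Y) \<Longrightarrow> coset X Y f \<in> carrier (Hom C X Y Mod factoring_maps C Q X Y)"
  by (auto simp: carrier_FactGroup)

lemma coset_mult:
  assumes "X \<in> Obj C" "Y \<in> Obj C" "f \<in> carrier (Hom C X Y)" "g \<in> carrier (Hom C X Y)"
  shows "coset X Y f \<otimes>\<^bsub>Hom C X Y Mod factoring_maps C Q X Y\<^esub> coset X Y g
    = coset X Y (f \<otimes>\<^bsub>Hom C X Y\<^esub> g)"
  using assms by (simp add: normal.rcos_sum[OF normal_factoring])

lemma coset_mult_closed:
  assumes "X \<in> Obj C" "Y \<in> Obj C" "f \<in> carrier (Hom C X Y)" "g \<in> carrier (Hom C X Y)"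
  shows "f \<otimes>\<^bsub>Hom C X Y\<^esub> g \<in> carrier (Hom C X Y)"
  using assms by (intro monoid.m_closed group.is_monoid hom_is_group)

lemma preadditive_quotient: "preadditive_category (quotient_category C Q)"
proof (rule preadditive_category.intro)
  show "comm_group (Hom (quotient_category C Q) X Y)"
    if "X \<in> Obj (quotient_category C Q)" "Y \<in> Obj (quotient_category C Q)" for X Y
    using that by (simp add: comm_group.abelian_FactGroup hom_group subgroup_factoring)
next
  show "Idt (quotient_category C Q) X \<in> carrier (Hom (quotient_category C Q) X X)"
    if "X \<in> Obj (quotient_category C Q)" for X
    using that by (simp add: coset_carrier id_closed)
next
  fix X Y f assume "X \<in> Obj (quotient_category C Q)" "Y \<in> Obj (quotient_category C Q)"
    and "f \<in> carrier (Hom (quotient_category C Q) X Y)"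
  then obtain f' where XY: "X \<in> Obj C" "Y \<in> Obj C" and f': "f' \<in> carrier (Hom C X Y)" "f = coset X Y f'"
    by (auto elim: coset_carrierE)
  show "Comp (quotient_category C Q) X X Y f (Idt (quotient_category C Q) X) = f"
    using f' XY by (simp add: comp_coset id_closed comp_id_right)
  show "Comp (quotient_category C Q) X Y Y (Idt (quotient_category C Q) Y) f = f"
    using f' XY by (simp add: comp_coset id_closed comp_id_left)
next
  fix X Y Z f g
  assume "X \<in> Obj (quotient_category C Q)" "Y \<in> Obj (quotient_category C Q)"
      "Z \<in> Obj (quotient_category C Q)"
    and fg: "f \<in> carrier (Hom (quotient_category C Q) X Y)" "g \<in> carrier (Hom (quotient_category C Q) Y Z)"
  then have XYZ: "X \<in> Obj C" "Y \<in> Obj C" "Z \<in> Obj C"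
    by simp_all
  from fg obtain f' where f': "f' \<in> carrier (Hom C X Y)" "f = coset X Y f'"
    by (auto elim: coset_carrierE)
  from fg obtain g' where g': "g' \<in> carrier (Hom C Y Z)" "g = coset Y Z g'"
    by (auto elim: coset_carrierE)
  show "Comp (quotient_category C Q) X Y Z g f \<in> carrier (Hom (quotient_category C Q) X Z)"
    using f' g' XYZ by (simp add: comp_coset coset_carrier comp_closed)
  show "Comp (quotient_category C Q) X Y Z (g \<otimes>\<^bsub>Hom (quotient_category C Q) Y Z\<^esub> h) f
      = Comp (quotient_category C Q) X Y Z g f \<otimes>\<^bsub>Hom (quotient_category C Q) X Z\<^esub>
        Comp (quotient_category C Q) X Y Z h f"
    if h: "h \<in> carrier (Hom (quotient_category C Q) Y Z)" for h
  proof -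
    from h obtain h' where h': "h' \<in> carrier (Hom C Y Z)" "h = coset Y Z h'"
      by (auto elim: coset_carrierE)
    then show ?thesis
      using f' g' XYZ
      by (simp add: comp_coset coset_mult coset_mult_closed comp_closed comp_add_left
          del: mult_FactGroup)
  qed
  show "Comp (quotient_category C Q) X Y Z g (f \<otimes>\<^bsub>Hom (quotient_category C Q) X Y\<^esub> h)
      = Comp (quotient_category C Q) X Y Z g f \<otimes>\<^bsub>Hom (quotient_category C Q) X Z\<^esub>
        Comp (quotient_category C Q) X Y Z g h"
    if h: "h \<in> carrier (Hom (quotient_category C Q) X Y)" for h
  proof -
    from h obtain h' where h': "h' \<in> carrier (Hom C X Y)" "h = coset X Y h'"
      by (auto elim: coset_carrierE)
    then show ?thesis
      using f' g' XYZ
      by (simp add: comp_coset coset_mult coset_mult_closed comp_closed comp_add_right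
          del: mult_FactGroup)
  qed
  show "Comp (quotient_category C Q) X Y W (Comp (quotient_category C Q) Y Z W h g) f
      = Comp (quotient_category C Q) X Z W h (Comp (quotient_category C Q) X Y Z g f)"
    if W: "W \<in> Obj (quotient_category C Q)" and h: "h \<in> carrier (Hom (quotient_category C Q) Z W)" for W h
  proof -
    from h obtain h' where h': "h' \<in> carrier (Hom C Z W)" "h = coset Z W h'"
      by (auto elim: coset_carrierE)
    then show ?thesis
      using f' g' XYZ W by (simp add: comp_coset comp_closed comp_assoc)
  qed
qed

lemma additive_quotient_functor:
  "additive_functor C (quotient_category C Q) (quotient_functor C Q)"
proof -
  have "is_functor C (quotient_category C Q) (quotient_functor C Q)"
  proof (rule is_functorI)
    show "preadditive_category C"
      by (rule preadditive_category_axioms)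
    show "preadditive_category (quotient_category C Q)"
      by (rule preadditive_quotient)
  qed (simp_all add: coset_carrier comp_coset)
  moreover have "FMor (quotient_functor C Q) X Y \<in> hom (Hom C X Y) (Hom (quotient_category C Q) X Y)"
    if "X \<in> Obj C" "Y \<in> Obj C" for X Y
    using that by (intro homI) (simp_all add: coset_carrier coset_mult del: mult_FactGroup)
  ultimately show ?thesis
    by (simp add: additive_functor_def)
qed

end

section \<open>Functors induced on the target of a full functor\<close>

lemma FObj_descend [simp]: "FObj (descend C Q F) = FObj F"
  by (simp add: descend_def)

lemma FMor_descend:
  assumes "f \<in> carrier (Hom C X Y)"
    and "\<And>f'. \<lbrakk>f' \<in> carrier (Hom C X Y); FMor Q X Y f' = FMor Q X Y f\<rbrakk>
      \<Longrightarrow> FMor F X Y f' = FMor F X Y f"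
  shows "FMor (descend C Q F) X Y (FMor Q X Y f) = FMor F X Y f"
proof -
  let ?P = "\<lambda>f'. f' \<in> carrier (Hom C X Y) \<and> FMor Q X Y f' = FMor Q X Y f"
  have "?P (SOME f'. ?P f')"
    by (rule someI[of ?P f]) (simp add: assms(1))
  then show ?thesis
    by (simp add: descend_def assms(2))
qed

text \<open>Fullness of \<open>Q\<close> lifts every morphism of \<open>E\<close> to one of
  \<open>C\<close>, and by \<open>const\<close> all lifts have the same value under
  \<open>F\<close>. Identities and composites are then computed with lifts, where \<open>F\<close>
  is already functorial.\<close>

lemma is_functor_descend:
  assumes F: "is_functor C D F" and Q: "is_functor C E Q"
    and obj: "Obj E = Obj C" "\<And>X. X \<in> Obj C \<Longrightarrow> FObj Q X = X"
    and full: "\<And>X Y g. \<lbrakk>X \<in> Obj C; Y \<in> Obj C; g \<in> carrier (Hom E X Y)\<rbrakk>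
      \<Longrightarrow> \<exists>f\<in>carrier (Hom C X Y). FMor Q X Y f = g"
    and const: "\<And>X Y f f'. \<lbrakk>X \<in> Obj C; Y \<in> Obj C; f \<in> carrier (Hom C X Y);
        f' \<in> carrier (Hom C X Y); FMor Q X Y f' = FMor Q X Y f\<rbrakk> \<Longrightarrow> FMor F X Y f' = FMor F X Y f"
  shows "is_functor E D (descend C Q F)"
proof (rule is_functorI)
  interpret C: preadditive_category C by (rule is_functorD(1)[OF F])
  have desc: "FMor (descend C Q F) X Y (FMor Q X Y f) = FMor F X Y f"
    if "X \<in> Obj C" "Y \<in> Obj C" "f \<in> carrier (Hom C X Y)" for X Y f
    using that by (auto intro: FMor_descend const)
  show "preadditive_category E" "preadditive_category D"
    using F Q by (auto dest: is_functorD)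
  show "FObj (descend C Q F) X \<in> Obj D" if "X \<in> Obj E" for X
    using that F by (simp add: obj is_functorD)
  show "FMor (descend C Q F) X Y g \<in> carrier (Hom D (FObj (descend C Q F) X) (FObj (descend C Q F) Y))"
    if "X \<in> Obj E" "Y \<in> Obj E" "g \<in> carrier (Hom E X Y)" for X Y g
    using that full[of X Y g] is_functorD(4)[OF F] desc by (auto simp: obj)
  show "FMor (descend C Q F) X X (Idt E X) = Idt D (FObj (descend C Q F) X)"
    if "X \<in> Obj E" for X
    using that desc[of X X "Idt C X"] is_functorD(5)[OF F] is_functorD(5)[OF Q] C.id_closed
    by (simp add: obj)
  show "FMor (descend C Q F) X Z (Comp E X Y Z g f) =
        Comp D (FObj (descend C Q F) X) (FObj (descend C Q F) Y) (FObj (descend C Q F) Z)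
         (FMor (descend C Q F) Y Z g) (FMor (descend C Q F) X Y f)"
    if "X \<in> Obj E" "Y \<in> Obj E" "Z \<in> Obj E" "f \<in> carrier (Hom E X Y)" "g \<in> carrier (Hom E Y Z)"
    for X Y Z f g
  proof -
    note XYZ = that(1-3)[unfolded obj] and fg = that(4,5)
    obtain f' where f': "f' \<in> carrier (Hom C X Y)" "f = FMor Q X Y f'"
      using full[of X Y f] fg XYZ by auto
    obtain g' where g': "g' \<in> carrier (Hom C Y Z)" "g = FMor Q Y Z g'"
      using full[of Y Z g] fg XYZ by auto
    have "Comp E X Y Z g f = FMor Q X Z (Comp C X Y Z g' f')"
      using is_functorD(6)[OF Q XYZ f'(1) g'(1)] f' g' XYZ by (simp add: obj)
    then show ?thesis
      using XYZ f' g' desc is_functorD(6)[OF F XYZ f'(1) g'(1)] by (simp add: C.comp_closed)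
  qed
qed


section \<open>Orbit categories\<close>

lemma comm_group_product_group:
  assumes "\<And>i. i \<in> I \<Longrightarrow> comm_group (G i)"
  shows "comm_group (product_group I G)"
proof (rule group.group_comm_groupI)
  show "group (product_group I G)"
    using assms by (simp add: comm_group.axioms(2))
  show "x \<otimes>\<^bsub>product_group I G\<^esub> y = y \<otimes>\<^bsub>product_group I G\<^esub> x"
    if "x \<in> carrier (product_group I G)" "y \<in> carrier (product_group I G)" for x y
    using that assms by (auto simp: PiE_iff comm_group_def comm_monoid.m_comm intro!: restrict_ext)
qed

lemma comm_group_sum_group:
  assumes "\<And>i. i \<in> I \<Longrightarrow> comm_group (G i)"
  shows "comm_group (sum_group I G)"
proof (rule group.group_comm_groupI)
  have grp: "\<And>i. i \<in> I \<Longrightarrow> group (G i)"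
    using assms by (simp add: comm_group.axioms(2))
  then show "group (sum_group I G)"
    by simp
  show "x \<otimes>\<^bsub>sum_group I G\<^esub> y = y \<otimes>\<^bsub>sum_group I G\<^esub> x"
    if "x \<in> carrier (sum_group I G)" "y \<in> carrier (sum_group I G)" for x y
    using that assms
    by (auto simp: carrier_sum_group grp PiE_iff comm_group_def comm_monoid.m_comm intro!: restrict_ext)
qed

lemma carrier_sum_group_UNIV:
  assumes "\<And>i. group (G i)"
  shows "x \<in> carrier (sum_group UNIV G) \<longleftrightarrow> (\<forall>i. x i \<in> carrier (G i)) \<and> finite {i. x i \<noteq> \<one>\<^bsub>G i\<^esub>}"
  by (simp add: carrier_sum_group assms PiE_iff)

lemma ident_hom: "(\<lambda>x. x) \<in> hom G G"
  by (simp add: hom_def)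

text \<open>The inclusion of the \<open>i\<close>-th summand into the direct sum. The identities of
  an orbit category and the values of the orbit projection are of this form, with
  \<open>i = 0\<close>.\<close>

definition homogeneous :: "('i \<Rightarrow> ('b, 'c) monoid_scheme) \<Rightarrow> 'i \<Rightarrow> 'b \<Rightarrow> 'i \<Rightarrow> 'b" where
  "homogeneous G i a = (\<lambda>j. if j = i then a else \<one>\<^bsub>G j\<^esub>)"

lemma homogeneous_closed:
  assumes "\<And>i. group (G i)" "a \<in> carrier (G i)"
  shows "homogeneous G i a \<in> carrier (sum_group UNIV G)"
proof -
  have "finite {j. homogeneous G i a j \<noteq> \<one>\<^bsub>G j\<^esub>}"
    by (rule finite_subset[of _ "{i}"]) (auto simp: homogeneous_def)
  with assms show ?thesis
    by (auto simp: carrier_sum_group_UNIV homogeneous_def group.is_monoid)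
qed

lemma sum_group_induct [consumes 2, case_names homogeneous mult]:
  assumes grp: "\<And>i. group (G i)" and "x \<in> carrier (sum_group UNIV G)"
    and hg: "\<And>i a. a \<in> carrier (G i) \<Longrightarrow> P (homogeneous G i a)"
    and mult: "\<And>x y. \<lbrakk>x \<in> carrier (sum_group UNIV G); y \<in> carrier (sum_group UNIV G); P x; P y\<rbrakk>
      \<Longrightarrow> P (x \<otimes>\<^bsub>sum_group UNIV G\<^esub> y)"
  shows "P x"
proof -
  have "finite {i. x i \<noteq> \<one>\<^bsub>G i\<^esub>}"
    using assms by (simp add: carrier_sum_group_UNIV)
  then show ?thesis
    using assms(2)
  proof (induction "{i. x i \<noteq> \<one>\<^bsub>G i\<^esub>}" arbitrary: x rule: finite_induct)
    case empty
    \<comment> \<open>The unit of the sum is homogeneous in every degree, so the empty support is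
      covered by the homogeneous case; \<open>undefined\<close> serves as an arbitrary
      degree.\<close>
    then have "x = homogeneous G undefined \<one>\<^bsub>G undefined\<^esub>"
      by (auto simp: homogeneous_def)
    then show ?case
      using hg grp by (simp add: group.is_monoid)
  next
    case (insert i S)
    have xc: "x j \<in> carrier (G j)" for j
      using insert.prems grp by (simp add: carrier_sum_group_UNIV)
    define y where "y = x(i := \<one>\<^bsub>G i\<^esub>)"
    have S: "S = {i. y i \<noteq> \<one>\<^bsub>G i\<^esub>}"
      using insert.hyps by (auto simp: y_def)
    have y: "y \<in> carrier (sum_group UNIV G)"
      using insert.hyps(1) S xc grp by (auto simp: carrier_sum_group_UNIV y_def group.is_monoid)
    have "x = homogeneous G i (x i) \<otimes>\<^bsub>sum_group UNIV G\<^esub> y"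
      using xc grp by (auto simp: homogeneous_def y_def group.is_monoid)
    then show ?case
      using insert.hyps(3)[OF S y] mult hg homogeneous_closed grp xc y by metis
  qed
qed

text \<open>The tool for multilinear identities: one argument is freed at a time while the others
  stay fixed, so each application asks for additivity in a single variable.\<close>

lemma hom_eq_if_homogeneous_eq:
  assumes "\<And>i. group (G i)" "x \<in> carrier (sum_group UNIV G)"
    and "\<phi> \<in> hom (sum_group UNIV G) H" "\<psi> \<in> hom (sum_group UNIV G) H"
    and "\<And>i a. a \<in> carrier (G i) \<Longrightarrow> \<phi> (homogeneous G i a) = \<psi> (homogeneous G i a)"
  shows "\<phi> x = \<psi> x"
  using assms(1,2)
proof (induction rule: sum_group_induct)
  case (mult x y)
  then show ?case
    using assms(3,4) by (simp add: hom_mult del: mult_sum_group)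
qed (simp add: assms)

lemma (in comm_group) gfinprod_one: "(\<And>i. i \<in> A \<Longrightarrow> f i = \<one>) \<Longrightarrow> gfinprod G f A = \<one>"
  by (simp add: gfinprod_def cong: conj_cong)

text \<open>\<open>gfinprod\<close> multiplies over the support, which here is \<open>{i}\<close>
  or, if \<open>f i\<close> is the unit, empty; hence the case distinction.\<close>

lemma (in comm_group) gfinprod_eq_single:
  assumes "f i \<in> carrier G" "\<And>j. j \<noteq> i \<Longrightarrow> f j = \<one>"
  shows "gfinprod G f UNIV = f i"
proof (cases "f i = \<one>")
  case True
  with assms(2) have "f j = \<one>" for j
    by metis
  then have "gfinprod G f UNIV = \<one>"
    by (rule gfinprod_one)
  then show ?thesis
    using True by simp
next
  case False
  then have "{j \<in> UNIV. f j \<noteq> \<one>} = {i}"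
    using assms by auto
  then show ?thesis
    using assms by (simp add: gfinprod_def del: Collect_const)
qed

text \<open>All compatibilities are equalities rather than isomorphisms. In particular
  \<open>Z[n - i][i] = Z[n]\<close>, so the summands of a composite in the orbit category lie in one
  hom-group without any comparison maps.\<close>

locale strict_shift = preadditive_category C for C :: "('o, 'm) category" +
  fixes Sh :: "int \<Rightarrow> ('o, 'm, 'o, 'm) functor_data"
  assumes shift_additive: "additive_functor C C (Sh k)"
    and shift_shift_obj: "X \<in> Obj C \<Longrightarrow> FObj (Sh i) (FObj (Sh j) X) = FObj (Sh (i + j)) X"
    and shift_shift_mor: "\<lbrakk>X \<in> Obj C; Y \<in> Obj C; f \<in> carrier (Hom C X Y)\<rbrakk> \<Longrightarrow>
        FMor (Sh i) (FObj (Sh j) X) (FObj (Sh j) Y) (FMor (Sh j) X Y f) = FMor (Sh (i + j)) X Y f"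
    and shift_0_obj [simp]: "X \<in> Obj C \<Longrightarrow> FObj (Sh 0) X = X"
    and shift_0_mor [simp]: "\<lbrakk>X \<in> Obj C; Y \<in> Obj C; f \<in> carrier (Hom C X Y)\<rbrakk>
      \<Longrightarrow> FMor (Sh 0) X Y f = f"
begin

lemmas shift_functor = is_functorD[OF additive_functorD(1)[OF shift_additive]]
lemmas shift_hom = additive_functorD(2)[OF shift_additive]

lemma shift_obj [simp]: "X \<in> Obj C \<Longrightarrow> FObj (Sh i) X \<in> Obj C"
  by (rule shift_functor(3))

abbreviation G :: "'o \<Rightarrow> 'o \<Rightarrow> int \<Rightarrow> 'm monoid" where
  "G X Y \<equiv> \<lambda>i. Hom C X (FObj (Sh i) Y)"

abbreviation orbit_hom :: "'o \<Rightarrow> 'o \<Rightarrow> (int \<Rightarrow> 'm) monoid" where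
  "orbit_hom X Y \<equiv> sum_group UNIV (G X Y)"

lemma G_group [simp]: "\<lbrakk>X \<in> Obj C; Y \<in> Obj C\<rbrakk> \<Longrightarrow> group (G X Y i)"
  and G_comm_group: "\<lbrakk>X \<in> Obj C; Y \<in> Obj C\<rbrakk> \<Longrightarrow> comm_group (G X Y i)"
  by (simp_all add: hom_is_group hom_group)

lemma orbit_hom_iff:
  "\<lbrakk>X \<in> Obj C; Y \<in> Obj C\<rbrakk> \<Longrightarrow> f \<in> carrier (orbit_hom X Y) \<longleftrightarrow>
     (\<forall>i. f i \<in> carrier (G X Y i)) \<and> finite {i. f i \<noteq> \<one>\<^bsub>G X Y i\<^esub>}"
  by (simp add: carrier_sum_group_UNIV)

lemma shift_mor_closed:
  assumes "Y \<in> Obj C" "Z \<in> Obj C" "g \<in> carrier (G Y Z m)"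
  shows "FMor (Sh i) Y (FObj (Sh m) Z) g \<in> carrier (Hom C (FObj (Sh i) Y) (FObj (Sh (i + m)) Z))"
  using shift_functor(4)[of Y "FObj (Sh m) Z" g i] assms by (simp add: shift_shift_obj)

lemma shift_mor_one:
  assumes "Y \<in> Obj C" "Z \<in> Obj C"
  shows "FMor (Sh i) Y (FObj (Sh m) Z) \<one>\<^bsub>G Y Z m\<^esub> = \<one>\<^bsub>Hom C (FObj (Sh i) Y) (FObj (Sh (i + m)) Z)\<^esub>"
  using additive_functor_one[OF shift_additive, of Y "FObj (Sh m) Z"] assms
  by (simp add: shift_shift_obj)

text \<open>This is \<open>b[i] \<circ> a\<close>, the composite of a map of degree \<open>i\<close>
  with a map of degree \<open>m\<close>. Naming both degrees, instead of one degree and the total,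
  leaves only \<open>add.assoc\<close> as index arithmetic in the proof of associativity.\<close>

definition summand :: "'o \<Rightarrow> 'o \<Rightarrow> 'o \<Rightarrow> int \<Rightarrow> int \<Rightarrow> 'm \<Rightarrow> 'm \<Rightarrow> 'm" where
  "summand X Y Z i m b a = Comp C X (FObj (Sh i) Y) (FObj (Sh (i + m)) Z) (FMor (Sh i) Y (FObj (Sh m) Z) b) a"

lemma summand_closed:
  assumes "X \<in> Obj C" "Y \<in> Obj C" "Z \<in> Obj C" "a \<in> carrier (G X Y i)" "b \<in> carrier (G Y Z m)"
  shows "summand X Y Z i m b a \<in> carrier (G X Z (i + m))"
  using assms by (auto simp: summand_def intro!: comp_closed shift_mor_closed)

lemma summand_hom_right:
  assumes "X \<in> Obj C" "Y \<in> Obj C" "Z \<in> Obj C" "b \<in> carrier (G Y Z m)"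
  shows "summand X Y Z i m b \<in> hom (G X Y i) (G X Z (i + m))"
  unfolding summand_def using assms by (intro comp_hom_right) (auto intro: shift_mor_closed)

lemma summand_hom_left:
  assumes "X \<in> Obj C" "Y \<in> Obj C" "Z \<in> Obj C" "a \<in> carrier (G X Y i)"
  shows "(\<lambda>b. summand X Y Z i m b a) \<in> hom (G Y Z m) (G X Z (i + m))"
proof -
  have "(\<lambda>g. Comp C X (FObj (Sh i) Y) (FObj (Sh (i + m)) Z) g a) \<circ> FMor (Sh i) Y (FObj (Sh m) Z)
     \<in> hom (G Y Z m) (G X Z (i + m))"
  proof (rule hom_compose)
    show "FMor (Sh i) Y (FObj (Sh m) Z) \<in> hom (G Y Z m) (Hom C (FObj (Sh i) Y) (FObj (Sh (i + m)) Z))"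
      using shift_hom[of Y "FObj (Sh m) Z" i] assms by (simp add: shift_shift_obj)
  qed (use assms in \<open>auto intro!: comp_hom_left\<close>)
  then show ?thesis
    by (simp add: summand_def comp_def)
qed

lemma summand_one:
  assumes "X \<in> Obj C" "Y \<in> Obj C" "Z \<in> Obj C"
  shows "a \<in> carrier (G X Y i) \<Longrightarrow> summand X Y Z i m \<one>\<^bsub>G Y Z m\<^esub> a = \<one>\<^bsub>G X Z (i + m)\<^esub>"
    and "b \<in> carrier (G Y Z m) \<Longrightarrow> summand X Y Z i m b \<one>\<^bsub>G X Y i\<^esub> = \<one>\<^bsub>G X Z (i + m)\<^esub>"
  using assms by (simp_all add: summand_def shift_mor_one shift_mor_closed)

definition comp_orbit :: "'o \<Rightarrow> 'o \<Rightarrow> 'o \<Rightarrow> (int \<Rightarrow> 'm) \<Rightarrow> (int \<Rightarrow> 'm) \<Rightarrow> int \<Rightarrow> 'm" where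
  "comp_orbit X Y Z g f n = gfinprod (G X Z n) (\<lambda>i. summand X Y Z i (n - i) (g (n - i)) (f i)) UNIV"

lemma orbit_category_simps [simp]:
  "Obj (orbit_category C Sh) = Obj C"
  "Hom (orbit_category C Sh) X Y = orbit_hom X Y"
  "Idt (orbit_category C Sh) X = homogeneous (\<lambda>i. G X X i) 0 (Idt C X)"
  "Comp (orbit_category C Sh) X Y Z = comp_orbit X Y Z"
  by (simp_all add: orbit_category_def homogeneous_def comp_orbit_def summand_def fun_eq_iff)

lemma summand_closed':
  assumes "X \<in> Obj C" "Y \<in> Obj C" "Z \<in> Obj C"
    and "f \<in> carrier (orbit_hom X Y)" "g \<in> carrier (orbit_hom Y Z)"
  shows "summand X Y Z i (n - i) (g (n - i)) (f i) \<in> carrier (G X Z n)"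
  using summand_closed[OF assms(1-3), of "f i" i "g (n - i)" "n - i"] assms
  by (simp add: orbit_hom_iff)

lemma finite_summands:
  assumes "X \<in> Obj C" "Y \<in> Obj C" "Z \<in> Obj C"
    and "f \<in> carrier (orbit_hom X Y)" "g \<in> carrier (orbit_hom Y Z)"
  shows "finite {i. summand X Y Z i (n - i) (g (n - i)) (f i) \<noteq> \<one>\<^bsub>G X Z n\<^esub>}"
proof (rule finite_subset[of _ "{i. f i \<noteq> \<one>\<^bsub>G X Y i\<^esub>}"])
  have "summand X Y Z i (n - i) (g (n - i)) \<one>\<^bsub>G X Y i\<^esub> = \<one>\<^bsub>G X Z n\<^esub>" for i
    using summand_one(2)[OF assms(1-3), of "g (n - i)" "n - i" i] assms
    by (simp add: orbit_hom_iff)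
  then show "{i. summand X Y Z i (n - i) (g (n - i)) (f i) \<noteq> \<one>\<^bsub>G X Z n\<^esub>} \<subseteq> {i. f i \<noteq> \<one>\<^bsub>G X Y i\<^esub>}"
    by auto
qed (use assms in \<open>simp add: orbit_hom_iff\<close>)

lemma comp_orbit_closed:
  assumes XYZ: "X \<in> Obj C" "Y \<in> Obj C" "Z \<in> Obj C"
    and f: "f \<in> carrier (orbit_hom X Y)" and g: "g \<in> carrier (orbit_hom Y Z)"
  shows "comp_orbit X Y Z g f \<in> carrier (orbit_hom X Z)"
proof -
  let ?F = "{i. f i \<noteq> \<one>\<^bsub>G X Y i\<^esub>}" and ?G = "{i. g i \<noteq> \<one>\<^bsub>G Y Z i\<^esub>}"
  have "finite {n. comp_orbit X Y Z g f n \<noteq> \<one>\<^bsub>G X Z n\<^esub>}"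
  proof (rule finite_subset)
    \<comment> \<open>A nonzero component in degree \<open>n\<close> requires a nonzero
      \<open>f i\<close> and a nonzero \<open>g m\<close> with \<open>i + m = n\<close>, so the
      support lies in the sum set of the two supports.\<close>
    show "{n. comp_orbit X Y Z g f n \<noteq> \<one>\<^bsub>G X Z n\<^esub>} \<subseteq> (\<lambda>(i, m). i + m) ` (?F \<times> ?G)"
    proof (rule ccontr)
      assume "\<not> ?thesis"
      then obtain n where n: "comp_orbit X Y Z g f n \<noteq> \<one>\<^bsub>G X Z n\<^esub>"
        "n \<notin> (\<lambda>(i, m). i + m) ` (?F \<times> ?G)"
        by blast
      have "summand X Y Z i (n - i) (g (n - i)) (f i) = \<one>\<^bsub>G X Z n\<^esub>" for i
      proof -
        have "f i = \<one>\<^bsub>G X Y i\<^esub> \<or> g (n - i) = \<one>\<^bsub>G Y Z (n - i)\<^esub>"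
          using n(2) by (force simp: image_iff)
        then show ?thesis
          using summand_one(1)[OF XYZ, of "f i" i "n - i"] summand_one(2)[OF XYZ, of "g (n - i)" "n - i" i]
            f g XYZ by (auto simp: orbit_hom_iff)
      qed
      then have "comp_orbit X Y Z g f n = \<one>\<^bsub>G X Z n\<^esub>"
        unfolding comp_orbit_def using XYZ by (intro comm_group.gfinprod_one[OF G_comm_group]) auto
      with n(1) show False by simp
    qed
    show "finite ((\<lambda>(i, m). i + m) ` (?F \<times> ?G))"
      using f g XYZ by (simp add: orbit_hom_iff)
  qed
  moreover have "comp_orbit X Y Z g f n \<in> carrier (G X Z n)" for n
    unfolding comp_orbit_def
    by (intro comm_monoid.gfinprod_closed comm_group.axioms(1) G_comm_group funcsetI
        summand_closed'[OF XYZ f g] XYZ)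
  ultimately show ?thesis
    using XYZ by (simp add: orbit_hom_iff)
qed

lemma comp_orbit_hom_right:
  assumes XYZ: "X \<in> Obj C" "Y \<in> Obj C" "Z \<in> Obj C" and g: "g \<in> carrier (orbit_hom Y Z)"
  shows "comp_orbit X Y Z g \<in> hom (orbit_hom X Y) (orbit_hom X Z)"
proof (rule homI)
  fix f f' assume f: "f \<in> carrier (orbit_hom X Y)" and f': "f' \<in> carrier (orbit_hom X Y)"
  have "comp_orbit X Y Z g (f \<otimes>\<^bsub>orbit_hom X Y\<^esub> f') n
      = comp_orbit X Y Z g f n \<otimes>\<^bsub>G X Z n\<^esub> comp_orbit X Y Z g f' n" for n
  proof -
    interpret XZ: comm_group "G X Z n" using XYZ by (simp add: G_comm_group)
    have "summand X Y Z i (n - i) (g (n - i)) (f i \<otimes>\<^bsub>G X Y i\<^esub> f' i)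
       = summand X Y Z i (n - i) (g (n - i)) (f i) \<otimes>\<^bsub>G X Z n\<^esub> summand X Y Z i (n - i) (g (n - i)) (f' i)"
      for i
      using hom_mult[OF summand_hom_right[OF XYZ, of "g (n - i)" "n - i" i], of "f i" "f' i"] f f' g XYZ
      by (simp add: orbit_hom_iff)
    then show ?thesis
      using XZ.gfinprod_distrib[of UNIV "\<lambda>i. summand X Y Z i (n - i) (g (n - i)) (f i)"
          "\<lambda>i. summand X Y Z i (n - i) (g (n - i)) (f' i)"]
        finite_summands[OF XYZ f g] finite_summands[OF XYZ f' g]
        summand_closed'[OF XYZ f g] summand_closed'[OF XYZ f' g]
      by (simp add: comp_orbit_def)
  qed
  then show "comp_orbit X Y Z g (f \<otimes>\<^bsub>orbit_hom X Y\<^esub> f')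
      = comp_orbit X Y Z g f \<otimes>\<^bsub>orbit_hom X Z\<^esub> comp_orbit X Y Z g f'"
    by (simp add: fun_eq_iff)
qed (use assms in \<open>simp add: comp_orbit_closed\<close>)

lemma comp_orbit_hom_left:
  assumes XYZ: "X \<in> Obj C" "Y \<in> Obj C" "Z \<in> Obj C" and f: "f \<in> carrier (orbit_hom X Y)"
  shows "(\<lambda>g. comp_orbit X Y Z g f) \<in> hom (orbit_hom Y Z) (orbit_hom X Z)"
proof (rule homI)
  fix g g' assume g: "g \<in> carrier (orbit_hom Y Z)" and g': "g' \<in> carrier (orbit_hom Y Z)"
  have "comp_orbit X Y Z (g \<otimes>\<^bsub>orbit_hom Y Z\<^esub> g') f n
      = comp_orbit X Y Z g f n \<otimes>\<^bsub>G X Z n\<^esub> comp_orbit X Y Z g' f n" for n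
  proof -
    interpret XZ: comm_group "G X Z n" using XYZ by (simp add: G_comm_group)
    have "summand X Y Z i (n - i) (g (n - i) \<otimes>\<^bsub>G Y Z (n - i)\<^esub> g' (n - i)) (f i)
       = summand X Y Z i (n - i) (g (n - i)) (f i) \<otimes>\<^bsub>G X Z n\<^esub> summand X Y Z i (n - i) (g' (n - i)) (f i)"
      for i
      using hom_mult[OF summand_hom_left[OF XYZ, of "f i" i "n - i"], of "g (n - i)" "g' (n - i)"] f g g' XYZ
      by (simp add: orbit_hom_iff)
    then show ?thesis
      using XZ.gfinprod_distrib[of UNIV "\<lambda>i. summand X Y Z i (n - i) (g (n - i)) (f i)"
          "\<lambda>i. summand X Y Z i (n - i) (g' (n - i)) (f i)"]
        finite_summands[OF XYZ f g] finite_summands[OF XYZ f g']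
        summand_closed'[OF XYZ f g] summand_closed'[OF XYZ f g']
      by (simp add: comp_orbit_def)
  qed
  then show "comp_orbit X Y Z (g \<otimes>\<^bsub>orbit_hom Y Z\<^esub> g') f
      = comp_orbit X Y Z g f \<otimes>\<^bsub>orbit_hom X Z\<^esub> comp_orbit X Y Z g' f"
    by (simp add: fun_eq_iff)
qed (use assms in \<open>simp add: comp_orbit_closed\<close>)

text \<open>In the sum over \<open>j\<close>, only \<open>j = i\<close> can have a nonzero right
  factor. There the left factor is the component in degree \<open>n - i\<close>, which can be
  nonzero only for \<open>n = i + m\<close>.\<close>

lemma comp_orbit_homogeneous:
  assumes XYZ: "X \<in> Obj C" "Y \<in> Obj C" "Z \<in> Obj C"
    and a: "a \<in> carrier (G X Y i)" and b: "b \<in> carrier (G Y Z m)"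
  shows "comp_orbit X Y Z (homogeneous (G Y Z) m b) (homogeneous (G X Y) i a)
    = homogeneous (G X Z) (i + m) (summand X Y Z i m b a)"
proof
  fix n
  interpret XZ: comm_group "G X Z n" using XYZ by (simp add: G_comm_group)
  let ?s = "\<lambda>j. summand X Y Z j (n - j) (homogeneous (G Y Z) m b (n - j)) (homogeneous (G X Y) i a j)"
  have hb: "homogeneous (G Y Z) m b j \<in> carrier (G Y Z j)" for j
    using b XYZ by (simp add: homogeneous_def one_closed)
  have 1: "?s j = \<one>\<^bsub>G X Z n\<^esub>" if "j \<noteq> i" for j
    using that summand_one(2)[OF XYZ hb[of "n - j"], of j] by (simp add: homogeneous_def)
  have 2: "?s i \<in> carrier (G X Z n)"
    using summand_closed[OF XYZ a hb[of "n - i"]] by (simp add: homogeneous_def)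
  have "comp_orbit X Y Z (homogeneous (G Y Z) m b) (homogeneous (G X Y) i a) n = ?s i"
    unfolding comp_orbit_def using 1 2 by (intro XZ.gfinprod_eq_single) auto
  also have "\<dots> = homogeneous (G X Z) (i + m) (summand X Y Z i m b a) n"
    using summand_one(1)[OF XYZ a, of "n - i"] by (auto simp: homogeneous_def)
  finally show "comp_orbit X Y Z (homogeneous (G Y Z) m b) (homogeneous (G X Y) i a) n
      = homogeneous (G X Z) (i + m) (summand X Y Z i m b a) n" .
qed

text \<open>Functoriality of \<open>[i]\<close> and the rule \<open>[j][i] = [i + j]\<close> turn
  \<open>(c[j] \<circ> b)[i]\<close> into \<open>c[i + j] \<circ> b[i]\<close>; associativity in
  \<open>C\<close> does the rest.\<close>

lemma summand_assoc:
  assumes WXYZ: "W \<in> Obj C" "X \<in> Obj C" "Y \<in> Obj C" "Z \<in> Obj C"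
    and a: "a \<in> carrier (G W X i)" and b: "b \<in> carrier (G X Y j)" and c: "c \<in> carrier (G Y Z k)"
  shows "summand W X Z i (j + k) (summand X Y Z j k c b) a
       = summand W Y Z (i + j) k c (summand W X Y i j b a)"
proof -
  have "FMor (Sh i) X (FObj (Sh (j + k)) Z) (summand X Y Z j k c b)
     = Comp C (FObj (Sh i) X) (FObj (Sh (i + j)) Y) (FObj (Sh (i + j + k)) Z)
         (FMor (Sh (i + j)) Y (FObj (Sh k) Z) c) (FMor (Sh i) X (FObj (Sh j) Y) b)"
    using WXYZ b c shift_functor(6)[of X "FObj (Sh j) Y" "FObj (Sh (j + k)) Z" b
        "FMor (Sh j) Y (FObj (Sh k) Z) c" i] shift_mor_closed[of Y Z c k j]
      shift_shift_mor[of Y "FObj (Sh k) Z" c i j]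
    by (simp add: summand_def shift_shift_obj add.assoc)
  then show ?thesis
    using WXYZ a shift_mor_closed[of X Y b j i] shift_mor_closed[of Y Z c k "i + j"] b c
    by (simp add: summand_def comp_assoc add.assoc)
qed

text \<open>Both sides are additive in each of the three maps. \<open>hhh\<close> treats three
  homogeneous maps by \<open>summand_assoc\<close>; \<open>hh\<close>, \<open>h1\<close> and the
  final step then free \<open>h\<close>, \<open>g\<close> and \<open>f\<close> in this
  order.\<close>

lemma comp_orbit_assoc:
  assumes WXYZ: "W \<in> Obj C" "X \<in> Obj C" "Y \<in> Obj C" "Z \<in> Obj C"
    and f: "f \<in> carrier (orbit_hom W X)" and g: "g \<in> carrier (orbit_hom X Y)"
    and h: "h \<in> carrier (orbit_hom Y Z)"
  shows "comp_orbit W X Z (comp_orbit X Y Z h g) f = comp_orbit W Y Z h (comp_orbit W X Y g f)"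
proof -
  note cl = homogeneous_closed comp_orbit_closed
  have hhh: "comp_orbit W X Z (comp_orbit X Y Z (homogeneous (G Y Z) k c) (homogeneous (G X Y) j b)) (homogeneous (G W X) i a)
       = comp_orbit W Y Z (homogeneous (G Y Z) k c) (comp_orbit W X Y (homogeneous (G X Y) j b) (homogeneous (G W X) i a))"
    if "a \<in> carrier (G W X i)" "b \<in> carrier (G X Y j)" "c \<in> carrier (G Y Z k)" for a b c i j k
    using that WXYZ by (simp add: comp_orbit_homogeneous summand_closed summand_assoc add.assoc)
  have hh: "comp_orbit W X Z (comp_orbit X Y Z h (homogeneous (G X Y) j b)) (homogeneous (G W X) i a)
       = comp_orbit W Y Z h (comp_orbit W X Y (homogeneous (G X Y) j b) (homogeneous (G W X) i a))"
    if a: "a \<in> carrier (G W X i)" and b: "b \<in> carrier (G X Y j)" for a b i j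
  proof (rule hom_eq_if_homogeneous_eq[OF _ h, where H = "orbit_hom W Z"])
    have "(\<lambda>h. comp_orbit W X Z h (homogeneous (G W X) i a)) \<circ> (\<lambda>h. comp_orbit X Y Z h (homogeneous (G X Y) j b))
        \<in> hom (orbit_hom Y Z) (orbit_hom W Z)"
      using a b WXYZ
      by (intro hom_compose[where H = "orbit_hom X Z"] comp_orbit_hom_left cl) auto
    then show "(\<lambda>h. comp_orbit W X Z (comp_orbit X Y Z h (homogeneous (G X Y) j b)) (homogeneous (G W X) i a))
        \<in> hom (orbit_hom Y Z) (orbit_hom W Z)"
      by (simp add: comp_def)
  qed (use a b WXYZ hhh in \<open>auto intro!: comp_orbit_hom_left cl\<close>)
  have h1: "comp_orbit W X Z (comp_orbit X Y Z h g) (homogeneous (G W X) i a)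
       = comp_orbit W Y Z h (comp_orbit W X Y g (homogeneous (G W X) i a))"
    if a: "a \<in> carrier (G W X i)" for a i
  proof (rule hom_eq_if_homogeneous_eq[OF _ g, where H = "orbit_hom W Z"])
    have "(\<lambda>h. comp_orbit W X Z h (homogeneous (G W X) i a)) \<circ> (\<lambda>g. comp_orbit X Y Z h g)
        \<in> hom (orbit_hom X Y) (orbit_hom W Z)"
      using a h WXYZ
      by (intro hom_compose[where H = "orbit_hom X Z"] comp_orbit_hom_left comp_orbit_hom_right cl) auto
    then show "(\<lambda>g. comp_orbit W X Z (comp_orbit X Y Z h g) (homogeneous (G W X) i a))
        \<in> hom (orbit_hom X Y) (orbit_hom W Z)"
      by (simp add: comp_def)
    have "comp_orbit W Y Z h \<circ> (\<lambda>g. comp_orbit W X Y g (homogeneous (G W X) i a))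
        \<in> hom (orbit_hom X Y) (orbit_hom W Z)"
      using a h WXYZ
      by (intro hom_compose[where H = "orbit_hom W Y"] comp_orbit_hom_left comp_orbit_hom_right cl) auto
    then show "(\<lambda>g. comp_orbit W Y Z h (comp_orbit W X Y g (homogeneous (G W X) i a)))
        \<in> hom (orbit_hom X Y) (orbit_hom W Z)"
      by (simp add: comp_def)
  qed (use a WXYZ hh in auto)
  show ?thesis
  proof (rule hom_eq_if_homogeneous_eq[OF _ f, where H = "orbit_hom W Z"])
    have "comp_orbit W Y Z h \<circ> comp_orbit W X Y g \<in> hom (orbit_hom W X) (orbit_hom W Z)"
      using g h WXYZ by (intro hom_compose[where H = "orbit_hom W Y"] comp_orbit_hom_right) auto
    then show "(\<lambda>f. comp_orbit W Y Z h (comp_orbit W X Y g f)) \<in> hom (orbit_hom W X) (orbit_hom W Z)"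
      by (simp add: comp_def)
  qed (use g h WXYZ h1 in \<open>auto intro!: comp_orbit_hom_right cl\<close>)
qed

lemma orbit_id_closed:
  "X \<in> Obj C \<Longrightarrow> homogeneous (G X X) 0 (Idt C X) \<in> carrier (orbit_hom X X)"
  by (intro homogeneous_closed) (auto simp: id_closed)

text \<open>Here the general map is shifted by zero, so the law rests on \<open>Sh 0\<close> acting
  as the identity. In the left unit law below it is the identity that is shifted, and that law rests
  on shifts preserving identities.\<close>

lemma comp_orbit_id_right:
  assumes XY: "X \<in> Obj C" "Y \<in> Obj C" and f: "f \<in> carrier (orbit_hom X Y)"
  shows "comp_orbit X X Y f (homogeneous (G X X) 0 (Idt C X)) = f"
proof (rule hom_eq_if_homogeneous_eq[OF _ f, where \<psi> = "\<lambda>x. x" and H = "orbit_hom X Y"])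
  show "comp_orbit X X Y (homogeneous (G X Y) i a) (homogeneous (G X X) 0 (Idt C X)) = homogeneous (G X Y) i a"
    if "a \<in> carrier (G X Y i)" for i a
    using that XY comp_orbit_homogeneous[of X X Y "Idt C X" 0 a i]
    by (simp add: id_closed summand_def comp_id_right)
qed (use XY in \<open>simp_all add: comp_orbit_hom_left orbit_id_closed ident_hom\<close>)

lemma comp_orbit_id_left:
  assumes XY: "X \<in> Obj C" "Y \<in> Obj C" and f: "f \<in> carrier (orbit_hom X Y)"
  shows "comp_orbit X Y Y (homogeneous (G Y Y) 0 (Idt C Y)) f = f"
proof (rule hom_eq_if_homogeneous_eq[OF _ f, where \<psi> = "\<lambda>x. x" and H = "orbit_hom X Y"])
  show "comp_orbit X Y Y (homogeneous (G Y Y) 0 (Idt C Y)) (homogeneous (G X Y) i a) = homogeneous (G X Y) i a"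
    if "a \<in> carrier (G X Y i)" for i a
    using that XY comp_orbit_homogeneous[of X Y Y a i "Idt C Y" 0]
    by (simp add: id_closed summand_def comp_id_left shift_functor(5))
qed (use XY in \<open>simp_all add: comp_orbit_hom_right orbit_id_closed ident_hom\<close>)

lemma preadditive_orbit: "preadditive_category (orbit_category C Sh)"
proof (rule preadditive_category.intro)
  show "comm_group (Hom (orbit_category C Sh) X Y)"
    if "X \<in> Obj (orbit_category C Sh)" "Y \<in> Obj (orbit_category C Sh)" for X Y
    using that by (simp add: comm_group_sum_group G_comm_group)
qed (auto simp: orbit_id_closed comp_orbit_closed comp_orbit_id_right comp_orbit_id_left
    comp_orbit_assoc hom_mult[OF comp_orbit_hom_left] hom_mult[OF comp_orbit_hom_right]
    simp del: mult_sum_group)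

lemma orbit_projection_simps [simp]:
  "FObj (orbit_projection C Sh) X = X"
  "FMor (orbit_projection C Sh) X Y f = homogeneous (G X Y) 0 f"
  by (simp_all add: orbit_projection_def homogeneous_def)

lemma is_functor_orbit_projection: "is_functor C (orbit_category C Sh) (orbit_projection C Sh)"
proof (rule is_functorI)
  fix X Y Z f g
  assume *: "X \<in> Obj C" "Y \<in> Obj C" "Z \<in> Obj C" "f \<in> carrier (Hom C X Y)" "g \<in> carrier (Hom C Y Z)"
  then show "FMor (orbit_projection C Sh) X Z (Comp C X Y Z g f) =
       Comp (orbit_category C Sh) (FObj (orbit_projection C Sh) X) (FObj (orbit_projection C Sh) Y)
        (FObj (orbit_projection C Sh) Z) (FMor (orbit_projection C Sh) Y Z g)
        (FMor (orbit_projection C Sh) X Y f)"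
    using comp_orbit_homogeneous[of X Y Z f 0 g 0] by (simp add: summand_def)
qed (auto simp: preadditive_orbit preadditive_category_axioms intro!: homogeneous_closed)

end

section \<open>Functors between orbit categories\<close>

lemma orbit_functor_simps [simp]:
  "FObj (orbit_functor Sh F) = FObj F"
  "FMor (orbit_functor Sh F) X Y f = (\<lambda>i. FMor F X (FObj (Sh i) Y) (f i))"
  by (simp_all add: orbit_functor_def)

text \<open>As \<open>F\<close> commutes strictly with the shifts, it carries
  \<open>b[i] \<circ> a\<close> to \<open>(F b)[i] \<circ> F a\<close>, which settles homogeneous
  maps. By additivity of \<open>F\<close> the induced maps of graded hom-groups are homomorphisms,
  so both sides of the composition law are additive in each variable.\<close>

lemma is_functor_orbit_functor:
  assumes C: "strict_shift C Sh" and D: "strict_shift D Sh'" and F: "additive_functor C D F"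
    and obj: "\<And>i X. X \<in> Obj C \<Longrightarrow> FObj F (FObj (Sh i) X) = FObj (Sh' i) (FObj F X)"
    and mor: "\<And>i X Y f. \<lbrakk>X \<in> Obj C; Y \<in> Obj C; f \<in> carrier (Hom C X Y)\<rbrakk> \<Longrightarrow>
        FMor F (FObj (Sh i) X) (FObj (Sh i) Y) (FMor (Sh i) X Y f)
        = FMor (Sh' i) (FObj F X) (FObj F Y) (FMor F X Y f)"
  shows "is_functor (orbit_category C Sh) (orbit_category D Sh') (orbit_functor Sh F)"
proof -
  interpret C: strict_shift C Sh by fact
  interpret D: strict_shift D Sh' by fact
  note F' = is_functorD[OF additive_functorD(1)[OF F]]
  let ?F = "orbit_functor Sh F"
  have G: "FMor F X (FObj (Sh i) Y) \<in> hom (C.G X Y i) (D.G (FObj F X) (FObj F Y) i)"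
    if "X \<in> Obj C" "Y \<in> Obj C" for X Y i
    using additive_functorD(2)[OF F, of X "FObj (Sh i) Y"] that by (simp add: obj)
  note G1 = hom_one[OF G] and Gc = hom_in_carrier[OF G]
  have h: "FMor ?F X Y (homogeneous (C.G X Y) i a)
       = homogeneous (D.G (FObj F X) (FObj F Y)) i (FMor F X (FObj (Sh i) Y) a)"
    if "X \<in> Obj C" "Y \<in> Obj C" for X Y i a
    using that G1 F'(3) by (auto simp: homogeneous_def)
  have hom: "FMor ?F X Y \<in> hom (C.orbit_hom X Y) (D.orbit_hom (FObj F X) (FObj F Y))"
    if XY: "X \<in> Obj C" "Y \<in> Obj C" for X Y
  proof (rule homI)
    fix f assume f: "f \<in> carrier (C.orbit_hom X Y)"
    have "finite {i. f i \<noteq> \<one>\<^bsub>C.G X Y i\<^esub>}"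
      using f XY by (simp add: C.orbit_hom_iff)
    \<comment> \<open>An additive functor preserves zero maps, so it can only shrink the
      support.\<close>
    moreover have "{i. FMor F X (FObj (Sh i) Y) (f i) \<noteq> \<one>\<^bsub>D.G (FObj F X) (FObj F Y) i\<^esub>} \<subseteq> {i. f i \<noteq> \<one>\<^bsub>C.G X Y i\<^esub>}"
      using XY G1 F'(3) by auto
    ultimately have "finite {i. FMor F X (FObj (Sh i) Y) (f i) \<noteq> \<one>\<^bsub>D.G (FObj F X) (FObj F Y) i\<^esub>}"
      by (rule rev_finite_subset)
    then show "FMor ?F X Y f \<in> carrier (D.orbit_hom (FObj F X) (FObj F Y))"
      using f XY Gc[OF XY] F'(3)[OF XY(1)] F'(3)[OF XY(2)]
      by (simp add: D.orbit_hom_iff C.orbit_hom_iff)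
  next
    fix f f' assume "f \<in> carrier (C.orbit_hom X Y)" "f' \<in> carrier (C.orbit_hom X Y)"
    then show "FMor ?F X Y (f \<otimes>\<^bsub>C.orbit_hom X Y\<^esub> f')
        = FMor ?F X Y f \<otimes>\<^bsub>D.orbit_hom (FObj F X) (FObj F Y)\<^esub> FMor ?F X Y f'"
      using XY by (auto simp: C.orbit_hom_iff hom_mult[OF G])
  qed
  note clC = C.comp_orbit_hom_right C.comp_orbit_hom_left homogeneous_closed
  note clD = D.comp_orbit_hom_right D.comp_orbit_hom_left F'(3) hom_carrier[OF hom] hom
  show ?thesis
  proof (rule is_functorI)
    show "FMor ?F X X (Idt (orbit_category C Sh) X) = Idt (orbit_category D Sh') (FObj ?F X)"
      if "X \<in> Obj (orbit_category C Sh)" for X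
      using that h[of X X 0] F'(5)[of X] by simp
    show "FMor ?F X Z (Comp (orbit_category C Sh) X Y Z g f) =
       Comp (orbit_category D Sh') (FObj ?F X) (FObj ?F Y) (FObj ?F Z) (FMor ?F Y Z g) (FMor ?F X Y f)"
      if "X \<in> Obj (orbit_category C Sh)" "Y \<in> Obj (orbit_category C Sh)" "Z \<in> Obj (orbit_category C Sh)"
        "f \<in> carrier (Hom (orbit_category C Sh) X Y)" "g \<in> carrier (Hom (orbit_category C Sh) Y Z)"
      for X Y Z f g
    proof -
      have XYZ: "X \<in> Obj C" "Y \<in> Obj C" "Z \<in> Obj C"
        and f: "f \<in> carrier (C.orbit_hom X Y)" and g: "g \<in> carrier (C.orbit_hom Y Z)"
        using that by simp_all
      have mem: "FMor ?F X Y f \<in> carrier (D.orbit_hom (FObj F X) (FObj F Y))"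
        if "X \<in> Obj C" "Y \<in> Obj C" "f \<in> carrier (C.orbit_hom X Y)" for X Y f
        using hom[OF that(1,2)] that(3) by (rule hom_in_carrier)
      have summ: "FMor F X (FObj (Sh (i + j)) Z) (C.summand X Y Z i j b a)
         = D.summand (FObj F X) (FObj F Y) (FObj F Z) i j (FMor F Y (FObj (Sh j) Z) b) (FMor F X (FObj (Sh i) Y) a)"
        if "a \<in> carrier (C.G X Y i)" "b \<in> carrier (C.G Y Z j)" for a b i j
        using that XYZ F'(6)[of X "FObj (Sh i) Y" "FObj (Sh (i + j)) Z" a "FMor (Sh i) Y (FObj (Sh j) Z) b"]
          C.shift_mor_closed[of Y Z b j i] mor[of Y "FObj (Sh j) Z" b i]
        by (simp add: C.summand_def D.summand_def obj C.shift_shift_obj D.shift_shift_obj F'(3))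
      have hh: "FMor ?F X Z (C.comp_orbit X Y Z (homogeneous (C.G Y Z) j b) (homogeneous (C.G X Y) i a))
         = D.comp_orbit (FObj F X) (FObj F Y) (FObj F Z) (FMor ?F Y Z (homogeneous (C.G Y Z) j b)) (FMor ?F X Y (homogeneous (C.G X Y) i a))"
        if a: "a \<in> carrier (C.G X Y i)" and b: "b \<in> carrier (C.G Y Z j)" for a b i j
      proof -
        have "FMor F X (FObj (Sh i) Y) a \<in> carrier (D.G (FObj F X) (FObj F Y) i)"
          "FMor F Y (FObj (Sh j) Z) b \<in> carrier (D.G (FObj F Y) (FObj F Z) j)"
          using a b XYZ by (simp_all add: Gc)
        then show ?thesis
          using a b XYZ F'(3)
          by (simp add: h C.comp_orbit_homogeneous D.comp_orbit_homogeneous summ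
              del: orbit_functor_simps(2))
      qed
      have h1: "FMor ?F X Z (C.comp_orbit X Y Z g (homogeneous (C.G X Y) i a))
         = D.comp_orbit (FObj F X) (FObj F Y) (FObj F Z) (FMor ?F Y Z g) (FMor ?F X Y (homogeneous (C.G X Y) i a))"
        if a: "a \<in> carrier (C.G X Y i)" for a i
      proof (rule hom_eq_if_homogeneous_eq[OF _ g, where H = "D.orbit_hom (FObj F X) (FObj F Z)"])
        have "FMor ?F X Z \<circ> (\<lambda>g. C.comp_orbit X Y Z g (homogeneous (C.G X Y) i a))
            \<in> hom (C.orbit_hom Y Z) (D.orbit_hom (FObj F X) (FObj F Z))"
          using a XYZ by (intro hom_compose[where H = "C.orbit_hom X Z"] hom clC) auto
        then show "(\<lambda>g. FMor ?F X Z (C.comp_orbit X Y Z g (homogeneous (C.G X Y) i a)))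
            \<in> hom (C.orbit_hom Y Z) (D.orbit_hom (FObj F X) (FObj F Z))"
          by (simp add: comp_def)
        have "(\<lambda>g. D.comp_orbit (FObj F X) (FObj F Y) (FObj F Z) g (FMor ?F X Y (homogeneous (C.G X Y) i a))) \<circ> FMor ?F Y Z
            \<in> hom (C.orbit_hom Y Z) (D.orbit_hom (FObj F X) (FObj F Z))"
          using a XYZ F'(3) by (intro hom_compose[OF hom] clD(2) mem homogeneous_closed) auto
        then show "(\<lambda>g. D.comp_orbit (FObj F X) (FObj F Y) (FObj F Z) (FMor ?F Y Z g) (FMor ?F X Y (homogeneous (C.G X Y) i a)))
            \<in> hom (C.orbit_hom Y Z) (D.orbit_hom (FObj F X) (FObj F Z))"
          by (simp add: comp_def)
      qed (use XYZ hh a in \<open>auto simp del: orbit_functor_simps(2)\<close>)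
      have "FMor ?F X Z (C.comp_orbit X Y Z g f)
         = D.comp_orbit (FObj F X) (FObj F Y) (FObj F Z) (FMor ?F Y Z g) (FMor ?F X Y f)"
      proof (rule hom_eq_if_homogeneous_eq[OF _ f, where H = "D.orbit_hom (FObj F X) (FObj F Z)"])
        have "FMor ?F X Z \<circ> C.comp_orbit X Y Z g \<in> hom (C.orbit_hom X Y) (D.orbit_hom (FObj F X) (FObj F Z))"
          using g XYZ by (intro hom_compose[where H = "C.orbit_hom X Z"] hom clC) auto
        then show "(\<lambda>f. FMor ?F X Z (C.comp_orbit X Y Z g f)) \<in> hom (C.orbit_hom X Y) (D.orbit_hom (FObj F X) (FObj F Z))"
          by (simp add: comp_def)
        have "D.comp_orbit (FObj F X) (FObj F Y) (FObj F Z) (FMor ?F Y Z g) \<circ> FMor ?F X Y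
            \<in> hom (C.orbit_hom X Y) (D.orbit_hom (FObj F X) (FObj F Z))"
          using g XYZ F'(3) by (intro hom_compose[OF hom] clD(1) mem) auto
        then show "(\<lambda>f. D.comp_orbit (FObj F X) (FObj F Y) (FObj F Z) (FMor ?F Y Z g) (FMor ?F X Y f))
            \<in> hom (C.orbit_hom X Y) (D.orbit_hom (FObj F X) (FObj F Z))"
          by (simp add: comp_def)
      qed (use XYZ h1 in \<open>auto simp del: orbit_functor_simps(2)\<close>)
      then show ?thesis by simp
    qed
    show "FMor ?F X Y f \<in> carrier (Hom (orbit_category D Sh') (FObj ?F X) (FObj ?F Y))"
      if "X \<in> Obj (orbit_category C Sh)" "Y \<in> Obj (orbit_category C Sh)"
        "f \<in> carrier (Hom (orbit_category C Sh) X Y)" for X Y f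
      using that hom[of X Y] hom_in_carrier by fastforce
  qed (auto simp: C.preadditive_orbit D.preadditive_orbit F'(3))
qed


section \<open>Families of finite support\<close>

lemma family_category_simps [simp]:
  "X \<in> Obj (family_category C) \<longleftrightarrow> (\<forall>i. X i \<in> Obj C) \<and> finite {i. \<not> zero_object C (X i)}"
  "Hom (family_category C) X Y = product_group UNIV (\<lambda>i. Hom C (X i) (Y i))"
  "Idt (family_category C) X = (\<lambda>i. Idt C (X i))"
  "Comp (family_category C) X Y Z g f = (\<lambda>i. Comp C (X i) (Y i) (Z i) (g i) (f i))"
  by (simp_all add: family_category_def)

lemma (in preadditive_category) preadditive_family: "preadditive_category (family_category C)"
proof (rule preadditive_category.intro)
  show "comm_group (Hom (family_category C) X Y)"
    if "X \<in> Obj (family_category C)" "Y \<in> Obj (family_category C)" for X Y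
    using that by (simp add: comm_group_product_group hom_group)
qed (auto simp: id_closed comp_closed comp_id_left comp_id_right comp_assoc comp_add_left
    comp_add_right PiE_iff)

lemma family_functor_simps [simp]:
  "FObj (family_functor F) X = (\<lambda>i. FObj F (X i))"
  "FMor (family_functor F) X Y f = (\<lambda>i. FMor F (X i) (Y i) (f i))"
  by (simp_all add: family_functor_def)

text \<open>The support of a family consists of the degrees where its object is not a zero object;
  the hypothesis \<open>zero\<close> keeps the image of a family finitely supported.\<close>

lemma is_functor_family_functor:
  assumes F: "is_functor C D F"
    and zero: "\<And>X. zero_object C X \<Longrightarrow> zero_object D (FObj F X)"
  shows "is_functor (family_category C) (family_category D) (family_functor F)"
proof (rule is_functorI)
  note F' = is_functorD[OF F]
  show "preadditive_category (family_category C)" "preadditive_category (family_category D)"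
    by (simp_all add: F' preadditive_category.preadditive_family)
  show "FObj (family_functor F) X \<in> Obj (family_category D)" if "X \<in> Obj (family_category C)" for X
  proof -
    have "finite {i. \<not> zero_object D (FObj F (X i))}"
      by (rule finite_subset[of _ "{i. \<not> zero_object C (X i)}"]) (use that zero in auto)
    with that show ?thesis
      by (simp add: F')
  qed
qed (auto simp: PiE_iff is_functorD[OF F])


section \<open>Finitely generated abelian groups\<close>

lemma (in comm_group) generate_insert:
  assumes "s \<in> carrier G" "S \<subseteq> carrier G"
  shows "generate G (insert s S) = {s [^] n \<otimes> k | n k. n \<in> (UNIV :: int set) \<and> k \<in> generate G S}"
    (is "_ = ?R")
proof (rule sym, rule generateI)
  interpret K: subgroup "generate G S" G
    using assms by (simp add: generate_is_subgroup)
  show "subgroup ?R G"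
  proof (rule subgroupI)
    show "?R \<subseteq> carrier G"
      using assms by auto
    show "?R \<noteq> {}"
      using K.one_closed by blast
    fix x assume "x \<in> ?R"
    then obtain n k where x: "x = s [^] (n::int) \<otimes> k" "k \<in> generate G S"
      by blast
    then have "inv x = s [^] (- n) \<otimes> inv k"
      using assms by (simp add: inv_mult int_pow_neg)
    then show "inv x \<in> ?R"
      using x by blast
    fix y assume "y \<in> ?R"
    then obtain m l where y: "y = s [^] (m::int) \<otimes> l" "l \<in> generate G S"
      by blast
    have "x \<otimes> y = s [^] (n + m) \<otimes> (k \<otimes> l)"
      using x y assms by (simp add: int_pow_mult m_ac)
    then show "x \<otimes> y \<in> ?R"
      using x y by blast
  qed
  show "insert s S \<subseteq> ?R"
  proof
    fix x assume "x \<in> insert s S"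
    then have "x = s [^] (1::int) \<otimes> \<one> \<or> x = s [^] (0::int) \<otimes> x \<and> x \<in> generate G S"
      using assms by (auto intro: generate.incl)
    then show "x \<in> ?R"
      using K.one_closed by blast
  qed
  fix K assume K: "subgroup K G" "insert s S \<subseteq> K"
  then have "generate G S \<subseteq> K"
    by (simp add: generate_subgroup_incl)
  moreover have "s [^] (n::int) \<in> K" for n
    using K by (simp add: subgroup_int_pow_closed)
  ultimately show "?R \<subseteq> K"
    using K(1) by (auto intro: subgroup.m_closed)
qed

text \<open>If \<open>d\<close> is the least positive exponent of \<open>s\<close> in an element of \<open>H\<close>, and \<open>h\<close> is an element
  with that exponent, then \<open>H\<close> is generated by \<open>h\<close> and the part of \<open>H\<close> that does not involve \<open>s\<close>.\<close>

lemma (in comm_group) subgroup_of_finitely_generated: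
  assumes "finite S" "S \<subseteq> carrier G" "subgroup H G" "H \<subseteq> generate G S"
  obtains T where "finite T" "T \<subseteq> H" "generate G T = H"
proof -
  have "\<exists>T. finite T \<and> T \<subseteq> H \<and> generate G T = H"
    using assms
  proof (induction S arbitrary: H rule: finite_induct)
    case empty
    then have "H = {\<one>}"
      using subgroup.one_closed[OF empty(2)] by (auto simp: generate_empty)
    then show ?case
      by (intro exI[of _ "{}"]) (simp add: generate_empty)
  next
    case (insert s S)
    let ?K = "generate G S"
    have sS: "s \<in> carrier G" "S \<subseteq> carrier G"
      using insert.prems by auto
    interpret H: subgroup H G by fact
    interpret K: subgroup ?K G using sS by (simp add: generate_is_subgroup)
    have "subgroup (H \<inter> ?K) G"
      by (intro subgroups_Inter_pair H.subgroup_axioms K.subgroup_axioms)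
    from insert.IH[OF sS(2) this Int_lower2]
    obtain T where T: "finite T" "T \<subseteq> H \<inter> ?K" "generate G T = H \<inter> ?K"
      by blast
    define D where "D = {d::nat. 0 < d \<and> (\<exists>k\<in>?K. s [^] int d \<otimes> k \<in> H)}"
    have decomp: "\<exists>n k. h = s [^] (n::int) \<otimes> k \<and> k \<in> ?K" if "h \<in> H" for h
      using that insert.prems generate_insert[OF sS] by blast
    show ?case
    proof (cases "D = {}")
      \<comment> \<open>If no positive exponent of \<open>s\<close> occurs in \<open>H\<close>, then
        no nonzero one does, since inverting an element negates its exponent. So \<open>H\<close>
        lies in the subgroup generated by \<open>S\<close>, and the induction hypothesis
        suffices.\<close>
      case True
      have "h \<in> ?K" if h: "h \<in> H" for h
      proof -
        obtain n k where nk: "h = s [^] (n::int) \<otimes> k" "k \<in> ?K"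
          using decomp[OF h] by blast
        have "inv h = s [^] (- n) \<otimes> inv k"
          using nk sS by (simp add: inv_mult int_pow_neg)
        then have "s [^] (- n) \<otimes> inv k \<in> H"
          using H.m_inv_closed[OF h] by simp
        then have "nat (- n) \<in> D" if "n < 0"
          unfolding D_def using that K.m_inv_closed[OF nk(2)]
          by (intro CollectI conjI bexI[of _ "inv k"]) auto
        moreover have "nat n \<in> D" if "0 < n"
          unfolding D_def using that h nk by (intro CollectI conjI bexI[of _ k]) auto
        ultimately have "n = 0"
          using True by fastforce
        with nk show ?thesis
          by simp
      qed
      then have "H \<inter> ?K = H"
        by blast
      with T show ?thesis
        by auto
    next
      case False
      define d where "d = (LEAST d. d \<in> D)"
      have d: "d \<in> D"
        using False unfolding d_def by (metis LeastI equals0I)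
      then obtain k0 where k0: "0 < d" "k0 \<in> ?K" "s [^] int d \<otimes> k0 \<in> H"
        by (auto simp: D_def)
      define h0 where "h0 = s [^] int d \<otimes> k0"
      have h0: "h0 \<in> H"
        using k0 by (simp add: h0_def)
      have "h \<in> generate G (insert h0 T)" if h: "h \<in> H" for h
      proof -
        obtain n k where nk: "h = s [^] (n::int) \<otimes> k" "k \<in> ?K"
          using decomp[OF h] by blast
        \<comment> \<open>Division with remainder: in \<open>h \<otimes> h0 [^] (- q)\<close> the
          exponent of \<open>s\<close> is \<open>r < d\<close>, and minimality of \<open>d\<close>
          forces \<open>r = 0\<close>.\<close>
        define q where "q = n div int d"
        define r where "r = n mod int d"
        have n: "n = int d * q + r" "0 \<le> r" "r < int d"
          using k0(1) by (auto simp: q_def r_def)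
        have k0q: "k0 [^] (- q) \<in> ?K"
          by (rule subgroup_int_pow_closed[OF K.subgroup_axioms k0(2)])
        have "h0 [^] (- q) = s [^] (- (int d * q)) \<otimes> k0 [^] (- q)"
          using sS(1) k0(2) by (simp add: h0_def int_pow_distrib int_pow_pow)
        then have "h \<otimes> h0 [^] (- q) = (s [^] n \<otimes> s [^] (- (int d * q))) \<otimes> (k \<otimes> k0 [^] (- q))"
          using nk k0q sS(1) by (simp add: m_ac)
        also have "s [^] n \<otimes> s [^] (- (int d * q)) = s [^] r"
          using sS(1) n(1) by (simp flip: int_pow_mult)
        finally have eq: "h \<otimes> h0 [^] (- q) = s [^] r \<otimes> (k \<otimes> k0 [^] (- q))" .
        have hq: "h \<otimes> h0 [^] (- q) \<in> H"
          by (rule H.m_closed[OF h subgroup_int_pow_closed[OF H.subgroup_axioms h0]])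
        have kk: "k \<otimes> k0 [^] (- q) \<in> ?K"
          by (rule K.m_closed[OF nk(2) k0q])
        have "nat r \<notin> D"
          using not_less_Least[of "nat r" "\<lambda>d. d \<in> D"] n by (auto simp: d_def[symmetric])
        then have "r = 0"
          using n(2) eq hq kk by (auto simp: D_def)
        then have "h \<otimes> h0 [^] (- q) \<in> generate G T"
          using eq hq kk T(3) by simp
        then have "h \<otimes> h0 [^] (- q) \<in> generate G (insert h0 T)"
          using mono_generate[of T "insert h0 T"] by blast
        moreover have "h0 [^] q \<in> generate G (insert h0 T)"
          using T(2) h0 by (intro subgroup_int_pow_closed generate_is_subgroup generate.incl) auto
        ultimately have "h \<otimes> h0 [^] (- q) \<otimes> h0 [^] q \<in> generate G (insert h0 T)"
          by (rule generate.eng)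
        then show ?thesis
          using h h0 by (simp add: m_assoc flip: int_pow_mult)
      qed
      moreover have "generate G (insert h0 T) \<subseteq> H"
        using h0 T(2) by (intro generate_subgroup_incl H.subgroup_axioms) auto
      ultimately show ?thesis
        using T h0 by (intro exI[of _ "insert h0 T"]) auto
    qed
  qed
  with that show ?thesis by blast
qed

text \<open>The exponents of a new generator can be reduced modulo a positive exponent that kills
  it, so by \<open>generate_insert\<close> the enlarged subgroup is covered by the image of a finite
  product.\<close>

lemma (in comm_group) finite_generate_if_finite_order:
  assumes "finite S" "S \<subseteq> carrier G" "\<And>s. s \<in> S \<Longrightarrow> \<exists>n::nat. 0 < n \<and> s [^] n = \<one>"
  shows "finite (generate G S)"
  using assms
proof (induction S rule: finite_induct)
  case empty
  then show ?case by (simp add: generate_empty)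
next
  case (insert s S)
  then obtain m :: nat where m: "0 < m" "s [^] m = \<one>"
    by blast
  have s: "s \<in> carrier G"
    using insert.prems by simp
  have "s [^] n = s [^] (n mod int m)" for n :: int
  proof -
    have "s [^] n = s [^] (int m * (n div int m) + n mod int m)"
      by simp
    also have "\<dots> = (s [^] int m) [^] (n div int m) \<otimes> s [^] (n mod int m)"
      using s by (simp only: int_pow_mult int_pow_pow)
    finally show ?thesis
      using m s by (simp add: int_pow_int)
  qed
  then have "s [^] n \<in> (\<lambda>n. s [^] n) ` {0..<int m}" for n :: int
    using m by (metis atLeastLessThan_iff imageI of_nat_0_less_iff pos_mod_bound pos_mod_sign)
  then have "generate G (insert s S) \<subseteq> (\<lambda>(x, k). x \<otimes> k) ` (((\<lambda>n. s [^] n) ` {0..<int m}) \<times> generate G S)"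
    using insert.prems by (fastforce simp: generate_insert)
  moreover have "finite (generate G S)"
    using insert by simp
  ultimately show ?case
    by (meson finite_SigmaI finite_atLeastLessThan_int finite_imageI finite_subset)
qed

text \<open>Prepares the transport of groups to another carrier type: a countable set embeds into
  every infinite type.\<close>

lemma (in comm_group) countable_generate:
  assumes "finite S" "S \<subseteq> carrier G"
  shows "countable (generate G S)"
  using assms
proof (induction S rule: finite_induct)
  case empty
  then show ?case by (simp add: generate_empty)
next
  case (insert s S)
  have "generate G (insert s S) = (\<lambda>(n, k). s [^] n \<otimes> k) ` ((UNIV :: int set) \<times> generate G S)"
    using insert.prems by (auto simp: generate_insert image_def)
  then show ?case
    using insert by simp
qed

lemma finitely_generated_surj:
  assumes "group G" "group H" "h \<in> hom G H" "h ` carrier G = carrier H" "finitely_generated G"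
  shows "finitely_generated H"
proof -
  interpret group_hom G H h
    using assms by (simp add: group_hom_def group_hom_axioms_def)
  obtain S where S: "finite S" "S \<subseteq> carrier G" "generate G S = carrier G"
    using assms(5) by (auto simp: finitely_generated_def)
  then have "generate H (h ` S) = carrier H"
    using generate_img[OF S(2)] assms(4) by simp
  moreover have "finite (h ` S)" "h ` S \<subseteq> carrier H"
    using S assms(4) by auto
  ultimately show ?thesis
    unfolding finitely_generated_def by blast
qed

lemma finitely_generated_subgroup:
  assumes "comm_group G" "finitely_generated G" "subgroup H G"
  shows "finitely_generated (G\<lparr>carrier := H\<rparr>)"
proof -
  interpret comm_group G by fact
  obtain S where S: "finite S" "S \<subseteq> carrier G" "generate G S = carrier G"
    using assms(2) by (auto simp: finitely_generated_def)
  obtain T where T: "finite T" "T \<subseteq> H" "generate G T = H"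
    using subgroup_of_finitely_generated[OF S(1,2) assms(3)] subgroup.subset[OF assms(3)] S(3)
    by auto
  then show ?thesis
    unfolding finitely_generated_def
    using generate_consistent[OF T(2) assms(3)] by auto
qed

lemma finitely_generated_finite:
  assumes "group G" "finite (carrier G)"
  shows "finitely_generated G"
proof -
  interpret group G by fact
  have "generate G (carrier G) = carrier G"
    using generate_incl[of "carrier G"] by (auto intro: generate.incl)
  then show ?thesis
    unfolding finitely_generated_def using assms(2) by blast
qed

lemma homogeneous_hom:
  assumes "\<And>i. group (G i)"
  shows "homogeneous G i \<in> hom (G i) (sum_group UNIV G)"
proof (rule homI)
  show "homogeneous G i (x \<otimes>\<^bsub>G i\<^esub> y) = homogeneous G i x \<otimes>\<^bsub>sum_group UNIV G\<^esub> homogeneous G i y"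
    for x y
    using assms by (auto simp: homogeneous_def group.is_monoid)
qed (use assms in \<open>simp add: homogeneous_closed\<close>)

lemma finitely_generated_sum_group:
  fixes G :: "int \<Rightarrow> 'b monoid"
  assumes grp: "\<And>i. group (G i)" and fg: "\<And>i. finitely_generated (G i)"
    and fin: "finite {i. \<not> trivial_group (G i)}"
  shows "finitely_generated (sum_group UNIV G)"
proof -
  from fg obtain S where S: "finite (S i)" "S i \<subseteq> carrier (G i)" "generate (G i) (S i) = carrier (G i)"
    for i
    unfolding finitely_generated_def by metis
  let ?I = "{i. \<not> trivial_group (G i)}"
  \<comment> \<open>The finitely many nontrivial summands contribute the generators; a homogeneous
    element of a trivial summand is the unit.\<close>
  define T where "T = (\<Union>i\<in>?I. homogeneous G i ` S i)"
  have T: "finite T" "T \<subseteq> carrier (sum_group UNIV G)"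
    using fin S grp by (auto simp: T_def intro!: homogeneous_closed)
  interpret SG: group "sum_group UNIV G" using grp by simp
  have "x \<in> generate (sum_group UNIV G) T" if "x \<in> carrier (sum_group UNIV G)" for x
    using grp that
  proof (induction rule: sum_group_induct)
    case (homogeneous i a)
    interpret h: group_hom "G i" "sum_group UNIV G" "homogeneous G i"
      using grp homogeneous_hom[OF grp] by (simp add: group_hom_def group_hom_axioms_def)
    show ?case
    proof (cases "i \<in> ?I")
      case True
      have "homogeneous G i a \<in> generate (sum_group UNIV G) (homogeneous G i ` S i)"
        using homogeneous S(3) by (simp add: h.generate_img[OF S(2)])
      moreover have "homogeneous G i ` S i \<subseteq> T"
        using True by (auto simp: T_def)
      ultimately show ?thesis
        using SG.mono_generate by blast
    next
      case False
      then have "a = \<one>\<^bsub>G i\<^esub>"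
        using homogeneous by (simp add: trivial_group_def)
      then show ?thesis
        using h.hom_one generate.one by metis
    qed
  next
    case (mult x y)
    then show ?case by (intro generate.eng)
  qed
  then have "generate (sum_group UNIV G) T = carrier (sum_group UNIV G)"
    using SG.generate_incl[OF T(2)] by blast
  with T show ?thesis
    unfolding finitely_generated_def by blast
qed

lemma finitely_generated_free_Abelian_group:
  assumes "finite S"
  shows "finitely_generated (free_Abelian_group S)"
proof -
  let ?F = "free_Abelian_group S"
  interpret F: group ?F by simp
  have sub: "frag_of ` S \<subseteq> carrier ?F"
    by auto
  have "x \<in> generate ?F (frag_of ` S)" if "Poly_Mapping.keys x \<subseteq> S" for x
    using that
  proof (induction rule: free_Abelian_group_induct[consumes 1])
    case 1
    then show ?case
      using generate.one[of ?F] by simp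
  next
    case (2 x y)
    then have "x \<otimes>\<^bsub>?F\<^esub> inv\<^bsub>?F\<^esub> y \<in> generate ?F (frag_of ` S)"
      using sub by (intro generate.eng F.generate_m_inv_closed)
    with 2 show ?case
      by simp
  next
    case (3 a)
    then show ?case
      by (simp add: generate.incl)
  qed
  then have "generate ?F (frag_of ` S) = carrier ?F"
    using F.generate_incl[OF sub] by auto
  with assms sub show ?thesis
    unfolding finitely_generated_def by blast
qed

section \<open>Torsion-free groups and torsion-free covers\<close>

definition torsion_free :: "('b, 'c) monoid_scheme \<Rightarrow> bool" where
  "torsion_free G \<longleftrightarrow> (\<forall>x\<in>carrier G. \<forall>n::nat. 0 < n \<and> x [^]\<^bsub>G\<^esub> n = \<one>\<^bsub>G\<^esub> \<longrightarrow> x = \<one>\<^bsub>G\<^esub>)"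

lemma torsion_free_inj:
  assumes "group G" "group H" "h \<in> hom G H" "inj_on h (carrier G)" "torsion_free H"
  shows "torsion_free G"
  unfolding torsion_free_def
proof (intro ballI allI impI)
  interpret group_hom G H h
    using assms by (simp add: group_hom_def group_hom_axioms_def)
  fix x and n :: nat assume x: "x \<in> carrier G" "0 < n \<and> x [^]\<^bsub>G\<^esub> n = \<one>\<^bsub>G\<^esub>"
  then have "h x [^]\<^bsub>H\<^esub> n = \<one>\<^bsub>H\<^esub>"
    using hom_nat_pow[of x n] by simp
  then have "h x = \<one>\<^bsub>H\<^esub>"
    using assms(5)[unfolded torsion_free_def, rule_format, of "h x" n] x by simp
  then show "x = \<one>\<^bsub>G\<^esub>"
    using x(1) assms(4) by (simp add: inj_on_one_iff)
qed

lemma torsion_free_trivial: "trivial_group G \<Longrightarrow> torsion_free G"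
  by (simp add: trivial_group_def torsion_free_def)

lemma image_group_iso:
  assumes "group G" "inj_on f (carrier G)"
  shows "f \<in> iso G (image_group f G)"
proof -
  interpret group G by fact
  show ?thesis
    using assms(2) by (auto simp: iso_def hom_def image_group_def bij_betw_def)
qed

lemma comm_group_image_group:
  assumes "comm_group G" "inj_on f (carrier G)"
  shows "comm_group (image_group f G)"
proof -
  interpret comm_group G by fact
  show ?thesis
  proof (rule comm_groupI)
    fix x assume "x \<in> carrier (image_group f G)"
    then obtain a where "a \<in> carrier G" "x = f a"
      by (auto simp: image_group_def)
    then show "\<exists>y\<in>carrier (image_group f G). y \<otimes>\<^bsub>image_group f G\<^esub> x = \<one>\<^bsub>image_group f G\<^esub>"
      using assms(2) by (intro bexI[of _ "f (inv\<^bsub>G\<^esub> a)"]) (auto simp: image_group_def)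
  qed (use assms(2) in \<open>auto simp: image_group_def m_assoc intro!: arg_cong[of _ _ f] m_comm\<close>)
qed

lemma ex_inj_on_countable:
  assumes "countable A" "infinite (UNIV :: 'b set)"
  shows "\<exists>f :: 'a \<Rightarrow> 'b. inj_on f A"
proof -
  obtain g :: "nat \<Rightarrow> 'b" where g: "inj g"
    using assms(2) infinite_countable_subset by blast
  obtain h :: "'a \<Rightarrow> nat" where h: "inj_on h A"
    using assms(1) by (auto simp: countable_def)
  have "inj_on (g \<circ> h) A"
    using g h by (auto intro: comp_inj_on inj_on_subset)
  then show ?thesis by blast
qed

lemma finitely_generated_countable:
  assumes "comm_group G" "finitely_generated G"
  shows "countable (carrier G)"
  using assms comm_group.countable_generate unfolding finitely_generated_def by metis

text \<open>Unless \<open>G\<close> is trivial, \<open>F\<close> is a free abelian group on a finite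
  generating set of \<open>G\<close>, copied onto the type \<open>'b\<close> so that it is an object
  of the same category. The clause on trivial groups ensures that covers selected degree by degree
  for a family again have finite support.\<close>

lemma ex_torsion_free_cover:
  fixes G :: "'b monoid"
  assumes inf: "infinite (UNIV :: 'b set)" and G: "comm_group G" "finitely_generated G"
  obtains F :: "'b monoid" and e
  where "comm_group F" "finitely_generated F" "torsion_free F" "trivial_group G \<Longrightarrow> trivial_group F"
    "e \<in> hom F G" "e ` carrier F = carrier G"
proof (cases "trivial_group G")
  case True
  \<comment> \<open>A trivial group covers itself: the free group on a nonempty generating set of it
    would not be trivial.\<close>
  show ?thesis
    by (rule that[of G "\<lambda>x. x"]) (use True G in \<open>auto simp: torsion_free_trivial hom_def\<close>)
next
  case False
  interpret G: comm_group G by fact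
  obtain S where S: "finite S" "S \<subseteq> carrier G" "generate G S = carrier G"
    using G(2) by (auto simp: finitely_generated_def)
  let ?A = "free_Abelian_group S"
  have fgA: "finitely_generated ?A"
    by (rule finitely_generated_free_Abelian_group[OF S(1)])
  have "\<exists>h. h \<in> hom ?A G \<and> (\<forall>x\<in>S. h (frag_of x) = x)"
  proof (rule G.free_Abelian_group_universal[of "\<lambda>x. x" S])
    show "(\<lambda>x. x) ` S \<subseteq> carrier G"
      using S(2) by simp
    fix h assume "h \<in> hom ?A G" "\<And>x. x \<in> S \<Longrightarrow> h (frag_of x) = x"
    then show "\<exists>h. h \<in> hom ?A G \<and> (\<forall>x\<in>S. h (frag_of x) = x)"
      by blast
  qed
  then obtain h where h: "h \<in> hom ?A G" "\<forall>x\<in>S. h (frag_of x) = x"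
    by (elim exE conjE)
  interpret h: group_hom ?A G h
    by (intro group_hom.intro group_hom_axioms.intro h(1) G.is_group group_free_Abelian_group)
  have "S \<subseteq> h ` carrier ?A"
  proof
    fix x assume "x \<in> S"
    with h(2) show "x \<in> h ` carrier ?A"
      by (intro image_eqI[of _ _ "frag_of x"]) simp_all
  qed
  from G.generate_subgroup_incl[OF this h.img_is_subgroup]
  have "carrier G \<subseteq> h ` carrier ?A"
    by (simp add: S(3))
  then have surj: "h ` carrier ?A = carrier G"
    using hom_carrier[OF h(1)] by blast
  \<comment> \<open>The free group lives on a type of finitely supported functions. Being countable,
    it embeds into \<open>'b\<close>, and \<open>image_group\<close> transports its structure along
    the embedding.\<close>
  obtain \<iota> :: "_ \<Rightarrow> 'b" where \<iota>: "inj_on \<iota> (carrier ?A)"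
    using ex_inj_on_countable[OF finitely_generated_countable[OF abelian_free_Abelian_group fgA] inf]
    by blast
  let ?F = "image_group \<iota> ?A"
  have cF: "comm_group ?F"
    by (rule comm_group_image_group[OF abelian_free_Abelian_group \<iota>])
  then have gF: "group ?F"
    by (rule comm_group.axioms(2))
  have iso: "\<iota> \<in> iso ?A ?F"
    by (rule image_group_iso[OF _ \<iota>]) simp
  then have inv: "inv_into (carrier ?A) \<iota> \<in> iso ?F ?A"
    by (rule group.iso_set_sym[rotated]) simp
  show ?thesis
  proof (rule that[of ?F "h \<circ> inv_into (carrier ?A) \<iota>"])
    show "finitely_generated ?F"
      using finitely_generated_surj[OF _ gF _ _ fgA, of \<iota>] iso by (simp add: iso_def bij_betw_def)
    have "torsion_free ?A"
      by (auto simp: torsion_free_def)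
    then show "torsion_free ?F"
      using torsion_free_inj[OF gF, of ?A] inv by (auto simp: iso_def bij_betw_def)
    show "h \<circ> inv_into (carrier ?A) \<iota> \<in> hom ?F G"
      using inv h(1) by (auto simp: iso_def intro: hom_compose)
    have "(h \<circ> inv_into (carrier ?A) \<iota>) ` carrier ?F = h ` (inv_into (carrier ?A) \<iota> ` carrier ?F)"
      by (rule image_comp[symmetric])
    then show "(h \<circ> inv_into (carrier ?A) \<iota>) ` carrier ?F = carrier G"
      using inv surj by (simp add: iso_def bij_betw_def)
  qed (use cF False in simp_all)
qed


section \<open>The categories of finitely generated and of finite abelian groups\<close>

lemma hom_group_simps:
  "f \<in> carrier (hom_group G H) \<longleftrightarrow> f \<in> hom G H \<and> f \<in> extensional (carrier G)"
  "f \<otimes>\<^bsub>hom_group G H\<^esub> g = (\<lambda>x\<in>carrier G. f x \<otimes>\<^bsub>H\<^esub> g x)"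
  "\<one>\<^bsub>hom_group G H\<^esub> = (\<lambda>x\<in>carrier G. \<one>\<^bsub>H\<^esub>)"
  by (simp_all add: hom_group_def)

lemma hom_group_closed: "f \<in> carrier (hom_group G H) \<Longrightarrow> x \<in> carrier G \<Longrightarrow> f x \<in> carrier H"
  by (auto simp: hom_group_simps hom_def)

lemma hom_group_mult:
  "\<lbrakk>f \<in> carrier (hom_group G H); x \<in> carrier G; y \<in> carrier G\<rbrakk> \<Longrightarrow> f (x \<otimes>\<^bsub>G\<^esub> y) = f x \<otimes>\<^bsub>H\<^esub> f y"
  by (auto simp: hom_group_simps hom_def)

lemma hom_group_eqI:
  assumes "f \<in> carrier (hom_group G H)" "g \<in> carrier (hom_group G H')" "\<And>x. x \<in> carrier G \<Longrightarrow> f x = g x"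
  shows "f = g"
  using assms extensionalityI by (auto simp: hom_group_simps)

lemma group_m_closed: "\<lbrakk>group G; x \<in> carrier G; y \<in> carrier G\<rbrakk> \<Longrightarrow> x \<otimes>\<^bsub>G\<^esub> y \<in> carrier G"
  by (simp add: group.is_monoid monoid.m_closed)

lemma restrict_hom_group:
  "\<lbrakk>group G; f \<in> hom G H\<rbrakk> \<Longrightarrow> restrict f (carrier G) \<in> carrier (hom_group G H)"
  by (auto simp: hom_group_simps hom_def group_m_closed)

lemma one_hom_group:
  assumes "group G" "group H"
  shows "(\<lambda>x\<in>carrier G. \<one>\<^bsub>H\<^esub>) \<in> carrier (hom_group G H)"
  using assms by (auto simp: hom_group_simps hom_def group_m_closed group.is_monoid)

lemma comm_group_hom_group:
  assumes "group G" "comm_group H"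
  shows "comm_group (hom_group G H)"
proof -
  interpret G: group G by fact
  interpret H: comm_group H by fact
  show ?thesis
  proof (rule comm_groupI)
    fix f g assume f: "f \<in> carrier (hom_group G H)" and g: "g \<in> carrier (hom_group G H)"
    note fc = hom_group_closed[OF f] and gc = hom_group_closed[OF g]
    have "(\<lambda>x\<in>carrier G. f x \<otimes>\<^bsub>H\<^esub> g x) \<in> hom G H"
      by (rule homI) (simp_all add: fc gc hom_group_mult[OF f] hom_group_mult[OF g] H.m_ac)
    then show "f \<otimes>\<^bsub>hom_group G H\<^esub> g \<in> carrier (hom_group G H)"
      by (simp add: hom_group_simps)
    show "f \<otimes>\<^bsub>hom_group G H\<^esub> g = g \<otimes>\<^bsub>hom_group G H\<^esub> f"
      using fc gc by (auto simp: hom_group_simps H.m_comm intro!: restrict_ext)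
    show "f \<otimes>\<^bsub>hom_group G H\<^esub> g \<otimes>\<^bsub>hom_group G H\<^esub> h = f \<otimes>\<^bsub>hom_group G H\<^esub> (g \<otimes>\<^bsub>hom_group G H\<^esub> h)"
      if h: "h \<in> carrier (hom_group G H)" for h
      using fc gc hom_group_closed[OF h] by (auto simp: hom_group_simps H.m_assoc intro!: restrict_ext)
  next
    have "(\<lambda>x\<in>carrier G. \<one>\<^bsub>H\<^esub>) \<in> hom G H"
      by (rule homI) simp_all
    then show "\<one>\<^bsub>hom_group G H\<^esub> \<in> carrier (hom_group G H)"
      by (simp add: hom_group_simps)
  next
    fix f assume f: "f \<in> carrier (hom_group G H)"
    note fc = hom_group_closed[OF f]
    show "\<one>\<^bsub>hom_group G H\<^esub> \<otimes>\<^bsub>hom_group G H\<^esub> f = f"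
      using f fc by (auto simp: hom_group_simps extensional_def)
    have "(\<lambda>x\<in>carrier G. inv\<^bsub>H\<^esub> f x) \<in> hom G H"
      by (rule homI) (simp_all add: fc hom_group_mult[OF f] H.inv_mult)
    then show "\<exists>g\<in>carrier (hom_group G H). g \<otimes>\<^bsub>hom_group G H\<^esub> f = \<one>\<^bsub>hom_group G H\<^esub>"
      using fc by (intro bexI[of _ "\<lambda>x\<in>carrier G. inv\<^bsub>H\<^esub> f x"])
        (auto simp: hom_group_simps intro!: restrict_ext)
  qed
qed

lemma compose_hom_group:
  assumes "group G" "f \<in> carrier (hom_group G H)" "g \<in> carrier (hom_group H K)"
  shows "compose (carrier G) g f \<in> carrier (hom_group G K)"
  using assms by (auto simp: hom_group_simps hom_def compose_def Pi_iff group_m_closed)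

lemma ident_hom_group: "group G \<Longrightarrow> (\<lambda>x\<in>carrier G. x) \<in> carrier (hom_group G G)"
  by (auto simp: hom_group_simps hom_def group_m_closed)

lemma modZ_simps [simp]:
  "G \<in> Obj modZ \<longleftrightarrow> comm_group G \<and> finitely_generated G"
  "Hom modZ = hom_group"
  "Idt modZ G = (\<lambda>x\<in>carrier G. x)"
  "Comp modZ G H K g f = compose (carrier G) g f"
  by (simp_all add: modZ_def)

lemma Ab_fin_simps [simp]:
  "G \<in> Obj Ab_fin \<longleftrightarrow> comm_group G \<and> finite (carrier G)"
  "Hom Ab_fin = hom_group"
  "Idt Ab_fin G = (\<lambda>x\<in>carrier G. x)"
  "Comp Ab_fin G H K g f = compose (carrier G) g f"
  using finitely_generated_finite comm_group.axioms(2)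
  by (auto simp: Ab_fin_def full_subcategory_def modZ_def)

lemma preadditive_modZ: "preadditive_category (modZ :: ('b monoid, 'b \<Rightarrow> 'b) category)"
proof (rule preadditive_category.intro)
  fix X Y :: "'b monoid"
  assume X: "X \<in> Obj modZ" and Y: "Y \<in> Obj modZ"
  then have gX: "group X" and gY: "group Y" and cY: "comm_group Y"
    by (simp_all add: comm_group.axioms(2))
  show "comm_group (Hom modZ X Y)"
    using gX cY by (simp add: comm_group_hom_group)
  show "Idt modZ X \<in> carrier (Hom modZ X X)"
    using gX by (simp add: ident_hom_group)
  fix f assume f: "f \<in> carrier (Hom modZ X Y)"
  show "Comp modZ X X Y f (Idt modZ X) = f"
    using f by (auto simp: hom_group_simps compose_def extensional_def fun_eq_iff)
  show "Comp modZ X Y Y (Idt modZ Y) f = f"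
    using f by (auto simp: hom_group_simps compose_def extensional_def fun_eq_iff hom_def Pi_iff)
  fix Z :: "'b monoid" and g
  assume Z: "Z \<in> Obj modZ" and g: "g \<in> carrier (Hom modZ Y Z)"
  show "Comp modZ X Y Z g f \<in> carrier (Hom modZ X Z)"
    using f g gX by (simp add: compose_hom_group)
  show "Comp modZ X Y Z (g \<otimes>\<^bsub>Hom modZ Y Z\<^esub> g') f
      = Comp modZ X Y Z g f \<otimes>\<^bsub>Hom modZ X Z\<^esub> Comp modZ X Y Z g' f" for g'
    using f by (auto simp: hom_group_simps compose_def fun_eq_iff hom_def Pi_iff)
  show "Comp modZ X Y Z g (f \<otimes>\<^bsub>Hom modZ X Y\<^esub> f')
      = Comp modZ X Y Z g f \<otimes>\<^bsub>Hom modZ X Z\<^esub> Comp modZ X Y Z g f'"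
    if "f' \<in> carrier (Hom modZ X Y)" for f'
    using f g that by (auto simp: hom_group_simps compose_def fun_eq_iff hom_def Pi_iff)
  fix W :: "'b monoid" and h assume "h \<in> carrier (Hom modZ W X)"
  then show "Comp modZ W X Z (Comp modZ X Y Z g f) h = Comp modZ W Y Z g (Comp modZ W X Y f h)"
    by (auto simp: hom_group_simps compose_def fun_eq_iff hom_def Pi_iff)
qed

lemma (in preadditive_category) preadditive_full_subcategory:
  "preadditive_category (full_subcategory C Q)"
  by (rule preadditive_category.intro)
    (auto simp: full_subcategory_def hom_group id_closed comp_closed comp_id_left comp_id_right
      comp_assoc comp_add_left comp_add_right)

lemma preadditive_Ab_fin: "preadditive_category Ab_fin"
  unfolding Ab_fin_def
  by (rule preadditive_category.preadditive_full_subcategory[OF preadditive_modZ])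

text \<open>On a zero object the identity equals the zero endomorphism, so every element is the
  unit. The form with a general \<open>C\<close> lets \<open>modZ\<close> and \<open>Ab_fin\<close>
  share the argument.\<close>

lemma zero_object_hom_group_iff:
  assumes "Hom C = hom_group" "\<And>X. X \<in> Obj C \<Longrightarrow> group X"
  shows "zero_object C X \<longleftrightarrow> X \<in> Obj C \<and> trivial_group X"
proof
  assume Z: "zero_object C X"
  then have X: "X \<in> Obj C" "group X"
    using assms by (auto simp: zero_object_def)
  interpret group X by (rule X(2))
  have "\<exists>!f. f \<in> carrier (hom_group X X)"
    using Z X(1) by (simp add: zero_object_def assms)
  moreover have "(\<lambda>x\<in>carrier X. x) \<in> carrier (hom_group X X)"
    using X(2) by (rule ident_hom_group)
  moreover have "(\<lambda>x\<in>carrier X. \<one>\<^bsub>X\<^esub>) \<in> carrier (hom_group X X)"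
    by (auto simp: hom_group_simps hom_def)
  ultimately have "(\<lambda>x\<in>carrier X. x) = (\<lambda>x\<in>carrier X. \<one>\<^bsub>X\<^esub>)"
    by blast
  then have "x = \<one>\<^bsub>X\<^esub>" if "x \<in> carrier X" for x
    using that by (metis restrict_apply')
  then show "X \<in> Obj C \<and> trivial_group X"
    using X by (auto simp: trivial_group_def)
next
  assume "X \<in> Obj C \<and> trivial_group X"
  then have X: "X \<in> Obj C" "group X" "carrier X = {\<one>\<^bsub>X\<^esub>}"
    by (auto simp: trivial_group_def)
  interpret group X by (rule X(2))
  have "(\<exists>!f. f \<in> carrier (hom_group X Y)) \<and> (\<exists>!f. f \<in> carrier (hom_group Y X))"
    if "Y \<in> Obj C" for Y
  proof
    interpret Y: group Y using assms that by simp
    show "\<exists>!f. f \<in> carrier (hom_group X Y)"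
    proof (rule ex1I)
      show "(\<lambda>x\<in>carrier X. \<one>\<^bsub>Y\<^esub>) \<in> carrier (hom_group X Y)"
        by (auto simp: hom_group_simps hom_def)
      fix f assume f: "f \<in> carrier (hom_group X Y)"
      then have "f \<one>\<^bsub>X\<^esub> = \<one>\<^bsub>Y\<^esub>"
        using X(2) Y.is_group by (auto simp: hom_group_simps intro: hom_one)
      then show "f = (\<lambda>x\<in>carrier X. \<one>\<^bsub>Y\<^esub>)"
        using f X(3) by (auto simp: hom_group_simps extensional_def fun_eq_iff)
    qed
    show "\<exists>!f. f \<in> carrier (hom_group Y X)"
    proof (rule ex1I)
      show "(\<lambda>x\<in>carrier Y. \<one>\<^bsub>X\<^esub>) \<in> carrier (hom_group Y X)"
        by (auto simp: hom_group_simps hom_def)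
      fix f assume f: "f \<in> carrier (hom_group Y X)"
      then show "f = (\<lambda>x\<in>carrier Y. \<one>\<^bsub>X\<^esub>)"
        using X(3) by (auto simp: hom_group_simps extensional_def fun_eq_iff hom_def Pi_iff)
    qed
  qed
  then show "zero_object C X"
    using X(1) by (simp add: zero_object_def assms)
qed

lemma zero_object_modZ_iff: "zero_object modZ X \<longleftrightarrow> X \<in> Obj modZ \<and> trivial_group X"
  and zero_object_Ab_fin_iff: "zero_object Ab_fin Y \<longleftrightarrow> Y \<in> Obj Ab_fin \<and> trivial_group Y"
  by (rule zero_object_hom_group_iff; simp add: comm_group.axioms(2))+

lemma modZ_fam_Obj_iff:
  "X \<in> Obj modZ_fam \<longleftrightarrow>
    (\<forall>i. comm_group (X i) \<and> finitely_generated (X i)) \<and> finite {i. \<not> trivial_group (X i)}"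
  by (auto simp: modZ_fam_def zero_object_modZ_iff)

lemma Ab_fin_fam_Obj_iff:
  "X \<in> Obj Ab_fin_fam \<longleftrightarrow>
    (\<forall>i. comm_group (X i) \<and> finite (carrier (X i))) \<and> finite {i. \<not> trivial_group (X i)}"
  by (auto simp: Ab_fin_fam_def zero_object_Ab_fin_iff)

lemma modZ_fam_simps [simp]:
  "f \<in> carrier (Hom modZ_fam X Y) \<longleftrightarrow> (\<forall>i. f i \<in> carrier (hom_group (X i) (Y i)))"
  "Hom modZ_fam X Y = product_group UNIV (\<lambda>i. hom_group (X i) (Y i))"
  "Idt modZ_fam X = (\<lambda>i. \<lambda>x\<in>carrier (X i). x)"
  "Comp modZ_fam X Y Z g f = (\<lambda>i. compose (carrier (X i)) (g i) (f i))"
  by (auto simp: modZ_fam_def PiE_iff)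

lemma Ab_fin_fam_simps [simp]:
  "f \<in> carrier (Hom Ab_fin_fam X Y) \<longleftrightarrow> (\<forall>i. f i \<in> carrier (hom_group (X i) (Y i)))"
  "Hom Ab_fin_fam X Y = product_group UNIV (\<lambda>i. hom_group (X i) (Y i))"
  "Idt Ab_fin_fam X = (\<lambda>i. \<lambda>x\<in>carrier (X i). x)"
  "Comp Ab_fin_fam X Y Z g f = (\<lambda>i. compose (carrier (X i)) (g i) (f i))"
  by (auto simp: Ab_fin_fam_def PiE_iff)

lemma preadditive_modZ_fam: "preadditive_category modZ_fam"
  and preadditive_Ab_fin_fam: "preadditive_category Ab_fin_fam"
  unfolding modZ_fam_def Ab_fin_fam_def
  by (intro preadditive_category.preadditive_family preadditive_modZ preadditive_Ab_fin)+


section \<open>The torsion functor and the canonical functors modulo projectives\<close>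

lemma torsion_simps [simp]:
  "carrier (torsion G) = {x \<in> carrier G. \<exists>n::nat. 0 < n \<and> x [^]\<^bsub>G\<^esub> n = \<one>\<^bsub>G\<^esub>}"
  "monoid.mult (torsion G) = monoid.mult G"
  "\<one>\<^bsub>torsion G\<^esub> = \<one>\<^bsub>G\<^esub>"
  by (simp_all add: torsion_def)

lemma torsion_subgroup:
  assumes "comm_group G"
  shows "subgroup (carrier (torsion G)) G"
proof -
  interpret comm_group G by fact
  show ?thesis
  proof (rule subgroupI)
    show "carrier (torsion G) \<noteq> {}"
      by (auto intro!: exI[of _ "\<one>\<^bsub>G\<^esub>"] exI[of _ "1::nat"])
  next
    fix x assume "x \<in> carrier (torsion G)"
    then show "inv\<^bsub>G\<^esub> x \<in> carrier (torsion G)"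
      by (auto simp: nat_pow_inv)
  next
    fix x y assume "x \<in> carrier (torsion G)" "y \<in> carrier (torsion G)"
    then obtain n m :: nat where *: "x \<in> carrier G" "0 < n" "x [^]\<^bsub>G\<^esub> n = \<one>\<^bsub>G\<^esub>"
      "y \<in> carrier G" "0 < m" "y [^]\<^bsub>G\<^esub> m = \<one>\<^bsub>G\<^esub>"
      by auto
    have "x [^]\<^bsub>G\<^esub> (n * m) = \<one>\<^bsub>G\<^esub>" "y [^]\<^bsub>G\<^esub> (n * m) = \<one>\<^bsub>G\<^esub>"
      by (metis * nat_pow_pow nat_pow_one, metis * nat_pow_pow nat_pow_one mult.commute)
    then have "(x \<otimes>\<^bsub>G\<^esub> y) [^]\<^bsub>G\<^esub> (n * m) = \<one>\<^bsub>G\<^esub>"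
      using * by (simp add: nat_pow_distrib)
    with * show "x \<otimes>\<^bsub>G\<^esub> y \<in> carrier (torsion G)"
      by (auto intro!: exI[of _ "n * m"])
  qed auto
qed

lemma comm_group_torsion: "comm_group G \<Longrightarrow> comm_group (torsion G)"
  using group.group_comm_groupI[OF subgroup.subgroup_is_group[OF torsion_subgroup[of G]]]
  by (simp add: torsion_def comm_group_def comm_monoid.m_comm)

text \<open>As a subgroup of a finitely generated abelian group, the torsion subgroup is finitely
  generated, and its generators have finite order.\<close>

lemma finite_torsion:
  assumes "comm_group G" "finitely_generated G"
  shows "finite (carrier (torsion G))"
proof -
  interpret comm_group G by fact
  obtain S where S: "finite S" "S \<subseteq> carrier G" "generate G S = carrier G"
    using assms(2) by (auto simp: finitely_generated_def)
  obtain T where T: "finite T" "T \<subseteq> carrier (torsion G)" "generate G T = carrier (torsion G)"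
    using subgroup_of_finitely_generated[OF S(1,2) torsion_subgroup[OF assms(1)]] S(3) by auto
  have "finite (generate G T)"
    using T by (intro finite_generate_if_finite_order) auto
  then show ?thesis
    using T(3) by simp
qed

lemma trivial_torsion: "comm_group G \<Longrightarrow> trivial_group G \<Longrightarrow> trivial_group (torsion G)"
  using comm_group_torsion[of G] comm_group.axioms(2)[of "torsion G"] group.is_monoid[of "torsion G"]
    monoid.one_closed[of "torsion G"]
  by (auto simp: trivial_group_def)

lemma torsion_functor_simps [simp]:
  "FObj torsion_functor = torsion"
  "FMor torsion_functor G H f = restrict f (carrier (torsion G))"
  by (simp_all add: torsion_functor_def)

lemma hom_torsion:
  assumes "group G" "group H" "f \<in> hom G H" "x \<in> carrier (torsion G)"
  shows "f x \<in> carrier (torsion H)"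
proof -
  interpret group_hom G H f
    using assms by (simp add: group_hom_def group_hom_axioms_def)
  obtain n :: nat where n: "x \<in> carrier G" "0 < n" "x [^]\<^bsub>G\<^esub> n = \<one>\<^bsub>G\<^esub>"
    using assms(4) by auto
  then have "f x [^]\<^bsub>H\<^esub> n = \<one>\<^bsub>H\<^esub>"
    using hom_nat_pow[of x n] by simp
  with n show ?thesis
    by auto
qed

lemma is_functor_torsion: "is_functor modZ Ab_fin torsion_functor"
proof (rule is_functorI)
  fix X Y :: "'b monoid" and f
  assume "X \<in> Obj modZ" "Y \<in> Obj modZ" and f: "f \<in> carrier (Hom modZ X Y)"
  then have g: "group X" "group Y"
    by (simp_all add: comm_group.axioms(2))
  have ft: "f x \<in> carrier (torsion Y)" if "x \<in> carrier (torsion X)" for x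
    using hom_torsion[OF g _ that] f by (simp add: hom_group_simps)
  then show "FMor torsion_functor X Y f
      \<in> carrier (Hom Ab_fin (FObj torsion_functor X) (FObj torsion_functor Y))"
    using torsion_subgroup f g \<open>X \<in> Obj modZ\<close> hom_group_mult[of f X Y]
      subgroup.m_closed[OF torsion_subgroup[of X]]
    by (simp add: hom_group_simps(1) hom_def Pi_iff)
  fix Z :: "'b monoid" and g
  show "FMor torsion_functor X Z (Comp modZ X Y Z g f)
      = Comp Ab_fin (FObj torsion_functor X) (FObj torsion_functor Y) (FObj torsion_functor Z)
          (FMor torsion_functor Y Z g) (FMor torsion_functor X Y f)"
    using ft by (auto simp: compose_def fun_eq_iff simp del: torsion_simps(1)) auto
next
  show "FMor torsion_functor X X (Idt modZ X) = Idt Ab_fin (FObj torsion_functor X)" for X :: "'b monoid"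
    by (auto simp: fun_eq_iff)
qed (auto simp: preadditive_modZ preadditive_Ab_fin comm_group_torsion finite_torsion
      simp del: torsion_simps(1))

section \<open>Projective groups and projective families are torsion-free\<close>

lemma epimorphism_if_surj:
  assumes "e \<in> carrier (hom_group X Y)" "e ` carrier X = carrier Y"
    and "g \<in> carrier (hom_group Y Z)" "h \<in> carrier (hom_group Y Z)"
    and "compose (carrier X) g e = compose (carrier X) h e"
  shows "g = h"
proof (rule hom_group_eqI[OF assms(3,4)])
  fix y assume "y \<in> carrier Y"
  then obtain x where "x \<in> carrier X" "y = e x"
    using assms(2) by blast
  then show "g y = h y"
    using fun_cong[OF assms(5), of x] by (simp add: compose_def)
qed

text \<open>A map with a left inverse is injective, so \<open>P\<close> embeds into the torsion-free
  group \<open>F\<close>.\<close>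

lemma torsion_free_retract:
  assumes "group P" "group F" "g \<in> carrier (hom_group P F)" "torsion_free F"
    and "compose (carrier P) e g = (\<lambda>x\<in>carrier P. x)"
  shows "torsion_free P"
proof (rule torsion_free_inj[OF assms(1,2) _ _ assms(4)])
  show "inj_on g (carrier P)"
  proof (rule inj_on_inverseI[of _ e])
    fix x assume "x \<in> carrier P"
    then show "e (g x) = x"
      using fun_cong[OF assms(5), of x] by (simp add: compose_def)
  qed
qed (use assms in \<open>simp add: hom_group_simps\<close>)

text \<open>Torsion-free covers of the groups \<open>P i\<close> form an epimorphism of families,
  which splits because \<open>P\<close> is projective; thus each \<open>P i\<close> is a retract of
  its cover. The argument treats the family as a whole because projectivity is given in
  \<open>modZ_fam\<close>.\<close>

lemma projective_family_torsion_free: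
  fixes P :: "int \<Rightarrow> 'b monoid"
  assumes inf: "infinite (UNIV :: 'b set)" and P: "projective_object modZ_fam P"
  shows "torsion_free (P i)"
proof -
  have PO: "P \<in> Obj modZ_fam"
    using P by (simp add: projective_object_def)
  then have cP: "comm_group (P i)" "group (P i)" "finitely_generated (P i)" for i
    by (auto simp: modZ_fam_Obj_iff comm_group.axioms(2))
  have "\<exists>(F :: 'b monoid) e. comm_group F \<and> finitely_generated F \<and> torsion_free F \<and>
      (trivial_group (P i) \<longrightarrow> trivial_group F) \<and> e \<in> hom F (P i) \<and> e ` carrier F = carrier (P i)" for i
    by (rule ex_torsion_free_cover[OF inf cP(1,3)[of i]]) (intro exI conjI impI, assumption+)
  then obtain F :: "int \<Rightarrow> 'b monoid" and e where
    F: "\<And>i. comm_group (F i)" "\<And>i. finitely_generated (F i)" "\<And>i. torsion_free (F i)"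
      "\<And>i. trivial_group (P i) \<Longrightarrow> trivial_group (F i)"
    and e: "\<And>i. e i \<in> hom (F i) (P i)" "\<And>i. e i ` carrier (F i) = carrier (P i)"
    by metis
  note gF = F(1)[THEN comm_group.axioms(2)]
  \<comment> \<open>\<open>F i\<close> is trivial wherever \<open>P i\<close> is, so
    \<open>F\<close> inherits the finite support of \<open>P\<close>.\<close>
  have FO: "F \<in> Obj modZ_fam"
    using F PO by (auto simp: modZ_fam_Obj_iff intro: rev_finite_subset)
  define e' where "e' i = restrict (e i) (carrier (F i))" for i
  have e': "e' i \<in> carrier (hom_group (F i) (P i))" "e' i ` carrier (F i) = carrier (P i)" for i
    using e gF by (auto simp: e'_def restrict_hom_group)
  have "epimorphism modZ_fam F P e'"
    unfolding epimorphism_def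
  proof (intro conjI ballI impI)
    show "e' \<in> carrier (Hom modZ_fam F P)"
      by (simp only: modZ_fam_simps(1) e' simp_thms)
    fix Z g h assume "g \<in> carrier (Hom modZ_fam P Z)" "h \<in> carrier (Hom modZ_fam P Z)"
      and "Comp modZ_fam F P Z g e' = Comp modZ_fam F P Z h e'"
    then have gh: "\<And>i. g i \<in> carrier (hom_group (P i) (Z i))" "\<And>i. h i \<in> carrier (hom_group (P i) (Z i))"
      "\<And>i. compose (carrier (F i)) (g i) (e' i) = compose (carrier (F i)) (h i) (e' i)"
      by (simp_all only: modZ_fam_simps(1,4)) metis
    have "g i = h i" for i
      by (rule epimorphism_if_surj[OF e' gh])
    then show "g = h"
      by (rule ext)
  qed
  moreover have "Idt modZ_fam P \<in> carrier (Hom modZ_fam P P)"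
    using preadditive_category.id_closed[OF preadditive_modZ_fam PO] .
  ultimately obtain g where g: "g \<in> carrier (Hom modZ_fam P F)" "Comp modZ_fam P F P e' g = Idt modZ_fam P"
    using P FO PO unfolding projective_object_def by meson
  show ?thesis
  proof (rule torsion_free_retract[OF cP(2) gF _ F(3)])
    show "g i \<in> carrier (hom_group (P i) (F i))"
      using g(1) by (simp only: modZ_fam_simps(1))
    show "compose (carrier (P i)) (e' i) (g i) = (\<lambda>x\<in>carrier (P i). x)"
      using fun_cong[OF g(2), of i] by simp
  qed
qed

lemma projective_torsion_free:
  fixes P :: "'b monoid"
  assumes inf: "infinite (UNIV :: 'b set)" and P: "projective_object modZ P"
  shows "torsion_free P"
proof -
  have cP: "comm_group P" "group P" "finitely_generated P"
    using P by (auto simp: projective_object_def comm_group.axioms(2))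
  obtain F :: "'b monoid" and e where
    F: "comm_group F" "finitely_generated F" "torsion_free F"
    and e: "e \<in> hom F P" "e ` carrier F = carrier P"
    using ex_torsion_free_cover[OF inf cP(1,3)] by metis
  note gF = F(1)[THEN comm_group.axioms(2)]
  define e' where "e' = restrict e (carrier F)"
  have e': "e' \<in> carrier (hom_group F P)" "e' ` carrier F = carrier P"
    using e gF by (auto simp: e'_def restrict_hom_group)
  have "epimorphism modZ F P e'"
    unfolding epimorphism_def
  proof (intro conjI ballI impI)
    fix Z g h assume "g \<in> carrier (Hom modZ P Z)" "h \<in> carrier (Hom modZ P Z)"
      "Comp modZ F P Z g e' = Comp modZ F P Z h e'"
    then show "g = h"
      by (simp add: epimorphism_if_surj[OF e'])
  qed (simp add: e')
  moreover have "(\<lambda>x\<in>carrier P. x) \<in> carrier (Hom modZ P P)"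
    using cP by (simp add: ident_hom_group)
  ultimately obtain g where g: "g \<in> carrier (Hom modZ P F)" "Comp modZ P F P e' g = (\<lambda>x\<in>carrier P. x)"
    using P F unfolding projective_object_def by (metis modZ_simps(1))
  show ?thesis
    by (rule torsion_free_retract[OF cP(2) gF _ F(3)]) (use g in auto)
qed

section \<open>The effect on torsion of maps through projective objects\<close>

lemma torsion_factor:
  assumes "group X" "group P" "group Y" "torsion_free P"
    and "a \<in> carrier (hom_group X P)" "b \<in> carrier (hom_group P Y)" "x \<in> carrier (torsion X)"
  shows "b (a x) = \<one>\<^bsub>Y\<^esub>"
proof -
  have "a x \<in> carrier (torsion P)"
    using hom_torsion[OF assms(1,2) _ assms(7)] assms(5) by (simp add: hom_group_simps)
  then have "a x = \<one>\<^bsub>P\<^esub>"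
    using assms(4) unfolding torsion_free_def torsion_simps by blast
  then show ?thesis
    using assms(2,3,6) hom_one by (auto simp: hom_group_simps)
qed

text \<open>Zero objects are projective, so this supplies a projective object through which every
  zero map factors, as \<open>eq_coset_factoring\<close> requires.\<close>

lemma ex_zero_object_modZ: "\<exists>Z :: 'b monoid. zero_object modZ Z"
  by (intro exI[of _ "singleton_group undefined"])
    (auto simp: zero_object_modZ_iff intro!: finitely_generated_finite)

lemma zero_object_family:
  assumes "zero_object C Z"
  shows "zero_object (family_category C) (\<lambda>_. Z)"
proof -
  have "\<exists>!f. f \<in> carrier (product_group UNIV (\<lambda>i. Hom C (X i) (Y i)))"
    if unique: "\<And>i. \<exists>!f. f \<in> carrier (Hom C (X i) (Y i))" for X Y :: "int \<Rightarrow> 'a"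
  proof -
    have "\<forall>i. \<exists>f. f \<in> carrier (Hom C (X i) (Y i))"
      using unique by blast
    then obtain f where f: "\<And>i. f i \<in> carrier (Hom C (X i) (Y i))"
      by metis
    have "g = f" if "\<And>i. g i \<in> carrier (Hom C (X i) (Y i))" for g
    proof
      show "g i = f i" for i
        using unique[of i] that[of i] f[of i] by blast
    qed
    with f show ?thesis
      by (intro ex1I[of _ f]) (auto simp: PiE_iff)
  qed
  moreover have "Z \<in> Obj C" "\<And>Y. Y \<in> Obj C \<Longrightarrow> \<exists>!f. f \<in> carrier (Hom C Z Y)"
    "\<And>Y. Y \<in> Obj C \<Longrightarrow> \<exists>!f. f \<in> carrier (Hom C Y Z)"
    using assms by (auto simp: zero_object_def)
  ultimately show ?thesis
    unfolding zero_object_def[of "family_category C"] using assms by simp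
qed

lemma (in preadditive_category) zero_hom_eq:
  assumes "zero_object C Z" "X \<in> Obj C"
  shows "f \<in> carrier (Hom C Z X) \<Longrightarrow> f = \<one>\<^bsub>Hom C Z X\<^esub>"
  using assms one_closed unfolding zero_object_def by blast

lemma (in preadditive_category) projective_zero_object:
  assumes Z: "zero_object C Z"
  shows "projective_object C Z"
  unfolding projective_object_def
proof (intro conjI ballI allI impI)
  show ZO: "Z \<in> Obj C"
    using Z by (simp add: zero_object_def)
  fix X Y e f
  assume *: "X \<in> Obj C" "Y \<in> Obj C" "epimorphism C X Y e" "f \<in> carrier (Hom C Z Y)"
  then have "Comp C Z X Y e \<one>\<^bsub>Hom C Z X\<^esub> = f"
    using zero_hom_eq[OF Z] ZO by (auto simp: epimorphism_def)
  with * show "\<exists>g\<in>carrier (Hom C Z X). Comp C Z X Y e g = f"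
    using one_closed ZO by blast
qed

lemma (in preadditive_category) one_factoring:
  assumes "Z \<in> Obj C" "Q Z" "X \<in> Obj C" "Y \<in> Obj C"
  shows "\<one>\<^bsub>Hom C X Y\<^esub> \<in> factoring_maps C Q X Y"
proof -
  have "\<one>\<^bsub>Hom C X Y\<^esub> = Comp C X Z Y \<one>\<^bsub>Hom C Z Y\<^esub> \<one>\<^bsub>Hom C X Z\<^esub>"
    using assms by (simp add: one_closed)
  with assms show ?thesis
    unfolding factoring_maps_def using one_closed by blast
qed

text \<open>The zero map factors through \<open>Z\<close>, which puts \<open>f'\<close> into its own
  coset and hence into that of \<open>f\<close>. The difference of the two maps is then read off
  from membership in this coset.\<close>

lemma (in preadditive_category) eq_coset_factoring:
  assumes "Z \<in> Obj C" "Q Z" "X \<in> Obj C" "Y \<in> Obj C" "f' \<in> carrier (Hom C X Y)"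
    and eq: "factoring_maps C Q X Y #>\<^bsub>Hom C X Y\<^esub> f' = factoring_maps C Q X Y #>\<^bsub>Hom C X Y\<^esub> f"
  obtains n where "n \<in> factoring_maps C Q X Y" "f' = n \<otimes>\<^bsub>Hom C X Y\<^esub> f"
proof -
  interpret H: group "Hom C X Y"
    using assms by (simp add: hom_is_group)
  have "f' \<in> factoring_maps C Q X Y #>\<^bsub>Hom C X Y\<^esub> f'"
    unfolding r_coset_def by (rule UN_I[OF one_factoring[of Z Q X Y, OF assms(1-4)]]) (use assms(5) in simp)
  with eq that show thesis
    by (auto simp: r_coset_def)
qed

text \<open>The summand \<open>b \<circ> a\<close> sends torsion elements to torsion elements of
  \<open>P\<close> on the way, that is, to the unit.\<close>

lemma torsion_eq_if_factoring:
  assumes "group X" "group P" "group Y" "torsion_free P" "f \<in> carrier (hom_group X Y)"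
    and "a \<in> carrier (hom_group X P)" "b \<in> carrier (hom_group P Y)"
    and f': "f' = compose (carrier X) b a \<otimes>\<^bsub>hom_group X Y\<^esub> f"
  shows "restrict f' (carrier (torsion X)) = restrict f (carrier (torsion X))"
proof (rule restrict_ext)
  fix x assume x: "x \<in> carrier (torsion X)"
  then have "x \<in> carrier X"
    by simp
  then show "f' x = f x"
    using torsion_factor[OF assms(1-4) assms(6,7) x] hom_group_closed[OF assms(5)] assms(3)
    by (simp add: f' hom_group_simps compose_def group.is_monoid)
qed

text \<open>The representative that \<open>descend\<close> selects may differ from \<open>f\<close>,
  but only by a map through a projective group. Such a group is torsion-free, which takes an
  infinite carrier type, and so the restriction to torsion is the same for all
  representatives.\<close>

lemma FMor_P_H1:
  fixes X Y :: "'b monoid"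
  assumes inf: "infinite (UNIV :: 'b set)"
    and XY: "X \<in> Obj modZ" "Y \<in> Obj modZ" and f: "f \<in> carrier (hom_group X Y)"
  shows "FMor P_H1 X Y f = FMor torsion_functor X Y f"
proof -
  interpret preadditive_category "modZ :: ('b monoid, _) category"
    by (rule preadditive_modZ)
  let ?Q = "projective_object (modZ :: ('b monoid, _) category)"
  let ?N = "factoring_maps modZ ?Q X Y"
  obtain Z :: "'b monoid" where Z: "zero_object modZ Z"
    using ex_zero_object_modZ by blast
  then have ZO: "Z \<in> Obj modZ" "?Q Z"
    using projective_zero_object[OF Z] by (simp_all add: zero_object_def)
  have const: "FMor torsion_functor X Y f' = FMor torsion_functor X Y f"
    if f': "f' \<in> carrier (Hom modZ X Y)" "?N #>\<^bsub>Hom modZ X Y\<^esub> f' = ?N #>\<^bsub>Hom modZ X Y\<^esub> f" for f'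
  proof -
    obtain n where n: "n \<in> ?N" "f' = n \<otimes>\<^bsub>Hom modZ X Y\<^esub> f"
      by (rule eq_coset_factoring[OF ZO XY f'])
    then obtain P a b where P: "P \<in> Obj modZ" "?Q P" "a \<in> carrier (hom_group X P)"
      "b \<in> carrier (hom_group P Y)" "n = compose (carrier X) b a"
      unfolding factoring_maps_def modZ_simps(2,4) by blast
    then show ?thesis
      using torsion_eq_if_factoring[OF _ _ _ projective_torsion_free[OF inf P(2)] f P(3,4)] n(2) XY
      by (simp add: comm_group.axioms(2))
  qed
  have "FMor (descend modZ (quotient_functor modZ ?Q) torsion_functor) X Y (FMor (quotient_functor modZ ?Q) X Y f)
      = FMor torsion_functor X Y f"
  proof (rule FMor_descend)
    fix f' assume "f' \<in> carrier (Hom modZ X Y)"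
      "FMor (quotient_functor modZ ?Q) X Y f' = FMor (quotient_functor modZ ?Q) X Y f"
    then show "FMor torsion_functor X Y f' = FMor torsion_functor X Y f"
      unfolding quotient_functor_simps by (rule const)
  qed (use f in simp)
  then show ?thesis
    by (simp only: P_H1_def Let_def FMor_comp quotient_functor_simps(1))
qed

lemma FObj_P_H1 [simp]: "FObj P_H1 X = torsion X"
  by (simp add: P_H1_def Let_def)

lemma is_functor_P_H1:
  assumes "infinite (UNIV :: 'b set)"
  shows "is_functor (modZ :: ('b monoid, _) category) Ab_fin P_H1"
  by (rule is_functor_cong[OF is_functor_torsion]) (auto simp: FMor_P_H1[OF assms] simp del: torsion_functor_simps(2))

lemma FObj_P_H [simp]: "FObj P_H X = (\<lambda>i. torsion (X i))"
  by (simp add: P_H_def Let_def)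


lemma FMor_P_H:
  fixes X Y :: "int \<Rightarrow> 'b monoid"
  assumes inf: "infinite (UNIV :: 'b set)"
    and XY: "X \<in> Obj modZ_fam" "Y \<in> Obj modZ_fam" and f: "f \<in> carrier (Hom modZ_fam X Y)"
  shows "FMor P_H X Y f = FMor (family_functor torsion_functor) X Y f"
proof -
  interpret preadditive_category "modZ_fam :: (int \<Rightarrow> 'b monoid, _) category"
    by (rule preadditive_modZ_fam)
  let ?Q = "projective_object (modZ_fam :: (int \<Rightarrow> 'b monoid, _) category)"
  let ?N = "factoring_maps modZ_fam ?Q X Y"
  obtain Z0 :: "'b monoid" where Z0: "zero_object modZ Z0"
    using ex_zero_object_modZ by blast
  define Z :: "int \<Rightarrow> 'b monoid" where "Z = (\<lambda>_. Z0)"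
  have Z: "zero_object modZ_fam Z"
    unfolding modZ_fam_def Z_def by (rule zero_object_family[OF Z0])
  then have ZO: "Z \<in> Obj modZ_fam" "?Q Z"
    using projective_zero_object[OF Z] by (simp_all add: zero_object_def)
  have const: "FMor (family_functor torsion_functor) X Y f' = FMor (family_functor torsion_functor) X Y f"
    if f': "f' \<in> carrier (Hom modZ_fam X Y)"
      "?N #>\<^bsub>Hom modZ_fam X Y\<^esub> f' = ?N #>\<^bsub>Hom modZ_fam X Y\<^esub> f" for f'
  proof -
    obtain n where n: "n \<in> ?N" "f' = n \<otimes>\<^bsub>Hom modZ_fam X Y\<^esub> f"
      by (rule eq_coset_factoring[OF ZO XY f'])
    then obtain P a b where P: "P \<in> Obj modZ_fam" "?Q P" "a \<in> carrier (Hom modZ_fam X P)"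
      "b \<in> carrier (Hom modZ_fam P Y)" "n = Comp modZ_fam X P Y b a"
      unfolding factoring_maps_def by blast
    have "restrict (f' i) (carrier (torsion (X i))) = restrict (f i) (carrier (torsion (X i)))" for i
    proof (rule torsion_eq_if_factoring)
      show "group (X i)" "group (P i)" "group (Y i)"
        using XY P(1) by (auto simp: modZ_fam_Obj_iff comm_group.axioms(2))
      show "torsion_free (P i)"
        by (rule projective_family_torsion_free[OF inf P(2)])
      show "f i \<in> carrier (hom_group (X i) (Y i))" "a i \<in> carrier (hom_group (X i) (P i))"
        "b i \<in> carrier (hom_group (P i) (Y i))"
        using f P(3,4) by (simp_all only: modZ_fam_simps(1))
      show "f' i = compose (carrier (X i)) (b i) (a i) \<otimes>\<^bsub>hom_group (X i) (Y i)\<^esub> f i"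
        using n(2) P(5) by simp
    qed
    then show ?thesis
      by (simp add: fun_eq_iff)
  qed
  have "FMor (descend modZ_fam (quotient_functor modZ_fam ?Q) (family_functor torsion_functor)) X Y (FMor (quotient_functor modZ_fam ?Q) X Y f)
      = FMor (family_functor torsion_functor) X Y f"
  proof (rule FMor_descend)
    fix f' assume "f' \<in> carrier (Hom modZ_fam X Y)"
      "FMor (quotient_functor modZ_fam ?Q) X Y f' = FMor (quotient_functor modZ_fam ?Q) X Y f"
    then show "FMor (family_functor torsion_functor) X Y f' = FMor (family_functor torsion_functor) X Y f"
      unfolding quotient_functor_simps by (rule const)
  qed (use f in simp)
  then show ?thesis
    by (simp only: P_H_def Let_def FMor_comp quotient_functor_simps(1))
qed

lemma is_functor_P_H:
  assumes "infinite (UNIV :: 'b set)"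
  shows "is_functor (modZ_fam :: (int \<Rightarrow> 'b monoid, _) category) Ab_fin_fam P_H"
proof (rule is_functor_cong)
  show "is_functor modZ_fam Ab_fin_fam (family_functor torsion_functor)"
    unfolding modZ_fam_def Ab_fin_fam_def
    by (rule is_functor_family_functor[OF is_functor_torsion])
      (auto simp: zero_object_modZ_iff zero_object_Ab_fin_iff comm_group_torsion trivial_torsion
        finite_torsion simp del: torsion_simps(1))
qed (simp_all only: FMor_P_H[OF assms] FObj_P_H family_functor_simps(1) torsion_functor_simps(1))

section \<open>Direct sums of families and their torsion\<close>

lemma direct_sum_functor_simps [simp]:
  "FObj direct_sum_functor G = sum_group UNIV G"
  "FMor direct_sum_functor G H f = (\<lambda>x\<in>carrier (sum_group UNIV G). (\<lambda>i. f i (x i)))"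
  by (simp_all add: direct_sum_functor_def)

lemma direct_sum_map_closed:
  assumes G: "\<And>i. group (G i)" and H: "\<And>i. group (H i)"
    and f: "\<And>i. f i \<in> carrier (hom_group (G i) (H i))" and x: "x \<in> carrier (sum_group UNIV G)"
  shows "(\<lambda>i. f i (x i)) \<in> carrier (sum_group UNIV H)"
proof -
  have "f i \<one>\<^bsub>G i\<^esub> = \<one>\<^bsub>H i\<^esub>" for i
    using f[of i] hom_one[OF _ G H, of "f i" i i] by (simp add: hom_group_simps)
  then have "{i. f i (x i) \<noteq> \<one>\<^bsub>H i\<^esub>} \<subseteq> {i. x i \<noteq> \<one>\<^bsub>G i\<^esub>}"
    by auto
  then show ?thesis
    using x G H hom_group_closed[OF f] by (auto simp: carrier_sum_group_UNIV intro: finite_subset)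
qed

lemma direct_sum_map_hom:
  assumes "\<And>i. group (G i)" and "\<And>i. group (H i)"
    and f: "\<And>i. f i \<in> carrier (hom_group (G i) (H i))"
  shows "(\<lambda>x\<in>carrier (sum_group UNIV G). (\<lambda>i. f i (x i)))
    \<in> carrier (hom_group (sum_group UNIV G) (sum_group UNIV H))"
proof (rule restrict_hom_group)
  show "(\<lambda>x i. f i (x i)) \<in> hom (sum_group UNIV G) (sum_group UNIV H)"
  proof (rule homI)
    show "(\<lambda>i. f i (x i)) \<in> carrier (sum_group UNIV H)" if "x \<in> carrier (sum_group UNIV G)" for x
      by (rule direct_sum_map_closed[OF assms that])
    show "(\<lambda>i. f i ((x \<otimes>\<^bsub>sum_group UNIV G\<^esub> y) i))
        = (\<lambda>i. f i (x i)) \<otimes>\<^bsub>sum_group UNIV H\<^esub> (\<lambda>i. f i (y i))"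
      if "x \<in> carrier (sum_group UNIV G)" "y \<in> carrier (sum_group UNIV G)" for x y
      using that assms(1) by (simp add: carrier_sum_group_UNIV hom_group_mult[OF f] restrict_UNIV)
  qed
qed (use assms in simp)

lemma finite_sum_group:
  assumes "\<And>i. group (G i)" "\<And>i. finite (carrier (G i))" "finite {i. \<not> trivial_group (G i)}"
  shows "finite (carrier (sum_group UNIV G))"
proof (rule finite_subset)
  show "carrier (sum_group UNIV G) \<subseteq> carrier (product_group UNIV G)"
    using assms(1) by (auto simp: carrier_sum_group)
  show "finite (carrier (product_group UNIV G))"
    using assms finite_product_group[of UNIV G] by simp
qed

text \<open>Both functors have the same underlying data, so the identity and composition laws are
  established once. What differs is that one class of groups has to be closed under sums by finite
  generation, the other by finiteness.\<close>

lemma is_functor_S_H: "is_functor (modZ_fam :: (int \<Rightarrow> 'b monoid, _) category) modZ S_H"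
  and is_functor_S_HP: "is_functor (Ab_fin_fam :: (int \<Rightarrow> 'b monoid, _) category) Ab_fin S_HP"
proof -
  have id: "(\<lambda>x\<in>carrier (sum_group UNIV X). (\<lambda>i. (\<lambda>x\<in>carrier (X i). x) (x i))) = (\<lambda>x\<in>carrier (sum_group UNIV X). x)"
    if "\<And>i. group (X i)" for X :: "int \<Rightarrow> 'b monoid"
    using that by (auto simp: carrier_sum_group_UNIV intro!: restrict_ext)
  have comp: "(\<lambda>x\<in>carrier (sum_group UNIV X). (\<lambda>i. compose (carrier (X i)) (g i) (f i) (x i)))
    = compose (carrier (sum_group UNIV X)) (\<lambda>x\<in>carrier (sum_group UNIV Y). (\<lambda>i. g i (x i)))
        (\<lambda>x\<in>carrier (sum_group UNIV X). (\<lambda>i. f i (x i)))"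
    if "\<And>i. group (X i)" "\<And>i. group (Y i)" "\<And>i. f i \<in> carrier (hom_group (X i) (Y i))"
    for X Y Z :: "int \<Rightarrow> 'b monoid" and f g
    using that direct_sum_map_closed[of X Y f]
    by (auto simp: compose_def carrier_sum_group_UNIV intro!: restrict_ext)
  show "is_functor (modZ_fam :: (int \<Rightarrow> 'b monoid, _) category) modZ S_H"
  proof (rule is_functorI; (unfold S_H_def modZ_fam_simps modZ_simps direct_sum_functor_simps modZ_fam_Obj_iff
      carrier_product_group PiE_iff)?)
  qed (auto simp only: ball_UNIV preadditive_modZ preadditive_modZ_fam comm_group.axioms(2) comp id
      direct_sum_map_hom comm_group_sum_group finitely_generated_sum_group)
  show "is_functor (Ab_fin_fam :: (int \<Rightarrow> 'b monoid, _) category) Ab_fin S_HP"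
  proof (rule is_functorI; (unfold S_HP_def Ab_fin_fam_simps Ab_fin_simps direct_sum_functor_simps Ab_fin_fam_Obj_iff
      carrier_product_group PiE_iff)?)
  qed (auto simp only: ball_UNIV preadditive_Ab_fin preadditive_Ab_fin_fam comm_group.axioms(2) comp id
      direct_sum_map_hom comm_group_sum_group finite_sum_group)
qed

lemma pow_sum_group: "x [^]\<^bsub>sum_group UNIV G\<^esub> (n::nat) = (\<lambda>i. x i [^]\<^bsub>G i\<^esub> n)"
  by (induction n) (simp_all add: nat_pow_def)

text \<open>This is an equality of groups, and it makes the face formed by \<open>P_H\<close> and
  \<open>S_H\<close> commute strictly. The inclusion from right to left needs one exponent that
  kills all components at once, which exists because supports are finite.\<close>

lemma torsion_sum_group:
  fixes G :: "int \<Rightarrow> 'b monoid"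
  assumes G: "\<And>i. comm_group (G i)"
  shows "torsion (sum_group UNIV G) = sum_group UNIV (\<lambda>i. torsion (G i))"
proof (rule monoid.equality)
  have gG: "group (G i)" and gT: "group (torsion (G i))" for i
    using G comm_group_torsion by (auto intro: comm_group.axioms(2))
  have "\<exists>n::nat. 0 < n \<and> (\<forall>i. x i [^]\<^bsub>G i\<^esub> n = \<one>\<^bsub>G i\<^esub>)"
    if fin: "finite {i. x i \<noteq> \<one>\<^bsub>G i\<^esub>}" and x: "\<And>i. x i \<in> carrier (torsion (G i))" for x
  proof -
    obtain n :: "int \<Rightarrow> nat" where n: "\<And>i. x i \<in> carrier (G i)" "\<And>i. 0 < n i"
      "\<And>i. x i [^]\<^bsub>G i\<^esub> n i = \<one>\<^bsub>G i\<^esub>"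
      using x by simp metis
    \<comment> \<open>The product over the support of exponents killing the single components;
      outside the support every exponent works.\<close>
    let ?N = "\<Prod>i\<in>{i. x i \<noteq> \<one>\<^bsub>G i\<^esub>}. n i"
    have "x i [^]\<^bsub>G i\<^esub> ?N = \<one>\<^bsub>G i\<^esub>" for i
    proof (cases "x i = \<one>\<^bsub>G i\<^esub>")
      case True
      then show ?thesis
        using gG by (simp add: group.is_monoid monoid.nat_pow_one)
    next
      case False
      then have "n i dvd ?N"
        using fin by (intro dvd_prodI) auto
      then obtain m where "?N = n i * m"
        by (auto elim: dvdE)
      then have "x i [^]\<^bsub>G i\<^esub> ?N = (x i [^]\<^bsub>G i\<^esub> n i) [^]\<^bsub>G i\<^esub> m"
        using n(1) gG by (simp add: group.is_monoid monoid.nat_pow_pow)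
      then show ?thesis
        using n(3) gG by (simp add: group.is_monoid monoid.nat_pow_one)
    qed
    moreover have "0 < ?N"
      using n(2) by (simp add: prod_pos)
    ultimately show ?thesis by blast
  qed
  then have *: "x \<in> carrier (torsion (sum_group UNIV G)) \<longleftrightarrow> x \<in> carrier (sum_group UNIV (\<lambda>i. torsion (G i)))"
    for x
    unfolding carrier_sum_group_UNIV[of "\<lambda>i. torsion (G i)", OF gT] torsion_simps
    by (simp add: carrier_sum_group_UNIV[OF gG] pow_sum_group fun_eq_iff) blast
  show "carrier (torsion (sum_group UNIV G)) = carrier (sum_group UNIV (\<lambda>i. torsion (G i)))"
    using * by blast
qed simp_all


section \<open>Shifts on quotient categories\<close>

text \<open>The zero map factors through any object satisfying \<open>Q\<close>, and
  \<open>- (b \<circ> a) = (- b) \<circ> a\<close> factors through the same object as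
  \<open>b \<circ> a\<close>. Closure under addition remains, since the two summands may use
  different objects.\<close>

lemma (in preadditive_category) ideal_quotientI:
  assumes ex: "\<exists>Z\<in>Obj C. Q Z"
    and mult: "\<And>X Y f g. \<lbrakk>X \<in> Obj C; Y \<in> Obj C; f \<in> factoring_maps C Q X Y; g \<in> factoring_maps C Q X Y\<rbrakk>
      \<Longrightarrow> f \<otimes>\<^bsub>Hom C X Y\<^esub> g \<in> factoring_maps C Q X Y"
  shows "ideal_quotient C Q"
proof (intro ideal_quotient.intro ideal_quotient_axioms.intro preadditive_category_axioms)
  fix X Y assume XY: "X \<in> Obj C" "Y \<in> Obj C"
  interpret H: comm_group "Hom C X Y"
    using XY by (simp add: hom_group)
  show "subgroup (factoring_maps C Q X Y) (Hom C X Y)"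
  proof (rule H.subgroupI)
    show "factoring_maps C Q X Y \<subseteq> carrier (Hom C X Y)"
      using XY by (auto simp: factoring_maps_def comp_closed)
    obtain Z where "Z \<in> Obj C" "Q Z"
      using ex by blast
    then show "factoring_maps C Q X Y \<noteq> {}"
      using one_factoring[of Z Q X Y] XY by blast
    fix f assume "f \<in> factoring_maps C Q X Y"
    then obtain P a b where P: "P \<in> Obj C" "Q P" "a \<in> carrier (Hom C X P)"
      "b \<in> carrier (Hom C P Y)" "f = Comp C X P Y b a"
      by (auto simp: factoring_maps_def)
    interpret h: group_hom "Hom C P Y" "Hom C X Y" "\<lambda>b. Comp C X P Y b a"
      using comp_hom_left[OF XY(1) P(1) XY(2) P(3)] hom_is_group P(1) XY
      by (simp add: group_hom_def group_hom_axioms_def)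
    have "inv\<^bsub>Hom C X Y\<^esub> f = Comp C X P Y (inv\<^bsub>Hom C P Y\<^esub> b) a"
      using h.hom_inv[OF P(4)] P(5) by simp
    moreover have "inv\<^bsub>Hom C P Y\<^esub> b \<in> carrier (Hom C P Y)"
      using P(4) by simp
    ultimately show "inv\<^bsub>Hom C X Y\<^esub> f \<in> factoring_maps C Q X Y"
      unfolding factoring_maps_def using P by blast
  qed (use mult XY in blast)
qed

locale shift_ideal = strict_shift C Sh + ideal_quotient C Q
  for C :: "('o, 'm) category" and Sh and Q +
  assumes shift_factoring: "\<lbrakk>X \<in> Obj C; Y \<in> Obj C; a \<in> factoring_maps C Q X Y\<rbrakk>
    \<Longrightarrow> FMor (Sh k) X Y a \<in> factoring_maps C Q (FObj (Sh k) X) (FObj (Sh k) Y)"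
begin

definition shift_quotient :: "int \<Rightarrow> ('o, 'm set, 'o, 'm set) functor_data" where
  "shift_quotient k = descend C (quotient_functor C Q) (quotient_functor C Q \<circ>\<^sub>F Sh k)"

lemma FObj_shift_quotient [simp]: "FObj (shift_quotient k) X = FObj (Sh k) X"
  by (simp add: shift_quotient_def)

lemma shift_coset_eq:
  assumes XY: "X \<in> Obj C" "Y \<in> Obj C" and f: "f \<in> carrier (Hom C X Y)" "f' \<in> carrier (Hom C X Y)"
    and eq: "coset X Y f' = coset X Y f"
  shows "coset (FObj (Sh k) X) (FObj (Sh k) Y) (FMor (Sh k) X Y f')
    = coset (FObj (Sh k) X) (FObj (Sh k) Y) (FMor (Sh k) X Y f)"
proof -
  obtain a where a: "a \<in> factoring_maps C Q X Y" "f = a \<otimes>\<^bsub>Hom C X Y\<^esub> f'"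
    using eq f XY by (auto simp: coset_eq_iff)
  have "FMor (Sh k) X Y f = FMor (Sh k) X Y a \<otimes>\<^bsub>Hom C (FObj (Sh k) X) (FObj (Sh k) Y)\<^esub> FMor (Sh k) X Y f'"
    using hom_mult[OF shift_hom[OF XY] factoring_closed[OF XY a(1)] f(2)] a(2) by simp
  then show ?thesis
    using shift_factoring[OF XY a(1), of k]
    by (subst coset_eq_iff[OF shift_obj[OF XY(1)] shift_obj[OF XY(2)]
          shift_functor(4)[OF XY f(2)] shift_functor(4)[OF XY f(1)]]) auto
qed

lemma FMor_shift_quotient:
  assumes XY: "X \<in> Obj C" "Y \<in> Obj C" and f: "f \<in> carrier (Hom C X Y)"
  shows "FMor (shift_quotient k) X Y (coset X Y f)
    = coset (FObj (Sh k) X) (FObj (Sh k) Y) (FMor (Sh k) X Y f)"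
proof -
  have "FMor (descend C (quotient_functor C Q) (quotient_functor C Q \<circ>\<^sub>F Sh k)) X Y
      (FMor (quotient_functor C Q) X Y f) = FMor (quotient_functor C Q \<circ>\<^sub>F Sh k) X Y f"
  proof (rule FMor_descend[OF f])
    fix f' assume f': "f' \<in> carrier (Hom C X Y)"
      "FMor (quotient_functor C Q) X Y f' = FMor (quotient_functor C Q) X Y f"
    then show "FMor (quotient_functor C Q \<circ>\<^sub>F Sh k) X Y f' = FMor (quotient_functor C Q \<circ>\<^sub>F Sh k) X Y f"
      using shift_coset_eq[OF XY f f'(1)] by simp
  qed
  then show ?thesis
    by (simp add: shift_quotient_def)
qed

lemma additive_shift_quotient:
  "additive_functor (quotient_category C Q) (quotient_category C Q) (shift_quotient k)"
  unfolding additive_functor_def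
proof (intro conjI ballI)
  have "is_functor (quotient_category C Q) (quotient_category C Q)
      (descend C (quotient_functor C Q) (quotient_functor C Q \<circ>\<^sub>F Sh k))"
  proof (rule is_functor_descend)
    show "is_functor C (quotient_category C Q) (quotient_functor C Q \<circ>\<^sub>F Sh k)"
      by (rule is_functor_comp[OF additive_functorD(1)[OF shift_additive]
            additive_functorD(1)[OF additive_quotient_functor]])
    show "is_functor C (quotient_category C Q) (quotient_functor C Q)"
      by (rule additive_functorD(1)[OF additive_quotient_functor])
    show "\<exists>f\<in>carrier (Hom C X Y). FMor (quotient_functor C Q) X Y f = g"
      if "g \<in> carrier (Hom (quotient_category C Q) X Y)" for X Y g
      using that by (auto elim: coset_carrierE)
    show "FMor (quotient_functor C Q \<circ>\<^sub>F Sh k) X Y f' = FMor (quotient_functor C Q \<circ>\<^sub>F Sh k) X Y f"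
      if "X \<in> Obj C" "Y \<in> Obj C" "f \<in> carrier (Hom C X Y)" "f' \<in> carrier (Hom C X Y)"
        "FMor (quotient_functor C Q) X Y f' = FMor (quotient_functor C Q) X Y f" for X Y f f'
      using shift_coset_eq[of X Y f f' k] that by simp
  qed simp_all
  then show "is_functor (quotient_category C Q) (quotient_category C Q) (shift_quotient k)"
    by (simp add: shift_quotient_def)
  fix X Y assume "X \<in> Obj (quotient_category C Q)" "Y \<in> Obj (quotient_category C Q)"
  then have XY: "X \<in> Obj C" "Y \<in> Obj C" and XY': "FObj (Sh k) X \<in> Obj C" "FObj (Sh k) Y \<in> Obj C"
    by simp_all
  note cl = shift_functor(4)[OF XY]
  show "FMor (shift_quotient k) X Y \<in> hom (Hom (quotient_category C Q) X Y)
      (Hom (quotient_category C Q) (FObj (shift_quotient k) X) (FObj (shift_quotient k) Y))"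
  proof (rule homI)
    fix c assume "c \<in> carrier (Hom (quotient_category C Q) X Y)"
    then obtain f where f: "f \<in> carrier (Hom C X Y)" "c = coset X Y f"
      by (auto elim: coset_carrierE)
    then show "FMor (shift_quotient k) X Y c
        \<in> carrier (Hom (quotient_category C Q) (FObj (shift_quotient k) X) (FObj (shift_quotient k) Y))"
      using cl XY by (simp add: FMor_shift_quotient coset_carrier)
    fix c' assume "c' \<in> carrier (Hom (quotient_category C Q) X Y)"
    then obtain f' where f': "f' \<in> carrier (Hom C X Y)" "c' = coset X Y f'"
      by (auto elim: coset_carrierE)
    have "c \<otimes>\<^bsub>Hom (quotient_category C Q) X Y\<^esub> c' = coset X Y (f \<otimes>\<^bsub>Hom C X Y\<^esub> f')"
      using coset_mult[OF XY f(1) f'(1)] f f' by simp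
    moreover have "FMor (shift_quotient k) X Y (coset X Y (f \<otimes>\<^bsub>Hom C X Y\<^esub> f'))
       = coset (FObj (Sh k) X) (FObj (Sh k) Y) (FMor (Sh k) X Y f \<otimes>\<^bsub>Hom C (FObj (Sh k) X) (FObj (Sh k) Y)\<^esub> FMor (Sh k) X Y f')"
      using FMor_shift_quotient[OF XY coset_mult_closed[OF XY f(1) f'(1)]]
        hom_mult[OF shift_hom[OF XY] f(1) f'(1)] by simp
    ultimately show "FMor (shift_quotient k) X Y (c \<otimes>\<^bsub>Hom (quotient_category C Q) X Y\<^esub> c')
      = FMor (shift_quotient k) X Y c
        \<otimes>\<^bsub>Hom (quotient_category C Q) (FObj (shift_quotient k) X) (FObj (shift_quotient k) Y)\<^esub>
        FMor (shift_quotient k) X Y c'"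
      using coset_mult[OF XY' cl[OF f(1)] cl[OF f'(1)]] FMor_shift_quotient[OF XY] f f' by simp
  qed
qed

lemma strict_shift_quotient: "strict_shift (quotient_category C Q) shift_quotient"
proof (intro strict_shift.intro strict_shift_axioms.intro)
  show "preadditive_category (quotient_category C Q)"
    by (rule preadditive_quotient)
  show "additive_functor (quotient_category C Q) (quotient_category C Q) (shift_quotient k)" for k
    by (rule additive_shift_quotient)
  fix X Y f i j
  assume "X \<in> Obj (quotient_category C Q)"
  then have X: "X \<in> Obj C"
    by simp
  then show "FObj (shift_quotient i) (FObj (shift_quotient j) X) = FObj (shift_quotient (i + j)) X"
    "FObj (shift_quotient 0) X = X"
    by (simp_all add: shift_shift_obj)
  assume "Y \<in> Obj (quotient_category C Q)" "f \<in> carrier (Hom (quotient_category C Q) X Y)"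
  then obtain f' where Y: "Y \<in> Obj C" and f': "f' \<in> carrier (Hom C X Y)" "f = coset X Y f'"
    by (auto elim: coset_carrierE)
  then show "FMor (shift_quotient i) (FObj (shift_quotient j) X) (FObj (shift_quotient j) Y)
        (FMor (shift_quotient j) X Y f) = FMor (shift_quotient (i + j)) X Y f"
    "FMor (shift_quotient 0) X Y f = f"
    using X shift_functor(4)[OF X Y f'(1)]
    by (simp_all add: FMor_shift_quotient shift_shift_obj shift_shift_mor)
qed

lemma is_functor_orbit_quotient:
  "is_functor (orbit_category C Sh) (orbit_category (quotient_category C Q) shift_quotient)
    (orbit_functor Sh (quotient_functor C Q))"
  by (rule is_functor_orbit_functor[OF strict_shift_axioms strict_shift_quotient additive_quotient_functor])
    (simp_all add: FMor_shift_quotient)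

text \<open>A family of cosets is lifted degree by degree, and the lift must have finite support
  again. Hence the zero map is selected wherever \<open>g i\<close> is the zero coset, which is the
  set of factoring maps itself.\<close>

lemma orbit_functor_full:
  assumes XY: "X \<in> Obj C" "Y \<in> Obj C"
    and g: "g \<in> carrier (Hom (orbit_category (quotient_category C Q) shift_quotient) X Y)"
  shows "\<exists>f\<in>carrier (orbit_hom X Y). FMor (orbit_functor Sh (quotient_functor C Q)) X Y f = g"
proof -
  interpret D: strict_shift "quotient_category C Q" shift_quotient
    by (rule strict_shift_quotient)
  let ?N = "\<lambda>i. factoring_maps C Q X (FObj (Sh i) Y)"
  have g': "\<And>i. g i \<in> carrier (Hom C X (FObj (Sh i) Y) Mod ?N i)" "finite {i. g i \<noteq> ?N i}"
    using g XY D.orbit_hom_iff[of X Y g] by simp_all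
  have "\<exists>f. f \<in> carrier (G X Y i) \<and> coset X (FObj (Sh i) Y) f = g i \<and> (g i = ?N i \<longrightarrow> f = \<one>\<^bsub>G X Y i\<^esub>)" for i
  proof (cases "g i = ?N i")
    case True
    then show ?thesis
      using XY one_closed[of X "FObj (Sh i) Y"] factoring_closed[of X "FObj (Sh i) Y"]
      by (intro exI[of _ "\<one>\<^bsub>G X Y i\<^esub>"]) (auto intro!: group.coset_mult_one)
  next
    case False
    then show ?thesis
      using coset_carrierE[OF g'(1)[of i]] by metis
  qed
  then obtain f where f: "\<And>i. f i \<in> carrier (G X Y i)" "\<And>i. coset X (FObj (Sh i) Y) (f i) = g i"
    "\<And>i. g i = ?N i \<Longrightarrow> f i = \<one>\<^bsub>G X Y i\<^esub>"
    by metis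
  have "{i. f i \<noteq> \<one>\<^bsub>G X Y i\<^esub>} \<subseteq> {i. g i \<noteq> ?N i}"
    using f(3) by auto
  then have "f \<in> carrier (orbit_hom X Y)"
    using f(1) g'(2) XY by (auto simp: orbit_hom_iff intro: finite_subset)
  then show ?thesis
    using f(2) by (intro bexI[of _ f]) auto
qed

end


section \<open>Chain maps\<close>

text \<open>Unlike in \<open>Cb\<close>, the carriers may lie in different types: the sums of disc complexes below are
  complexes over \<open>nat \<Rightarrow> int\<close>.\<close>

definition chain_hom :: "'a complex \<Rightarrow> 'b complex \<Rightarrow> (int \<Rightarrow> 'a \<Rightarrow> 'b) set" where
  "chain_hom X Y =
     {f. (\<forall>i. f i \<in> carrier (hom_group (Grp X i) (Grp Y i))) \<and>
         (\<forall>i. \<forall>x\<in>carrier (Grp X i). f (i + 1) (diff X i x) = diff Y i (f i x))}"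

lemma chain_maps_eq: "chain_maps X Y = chain_hom X Y"
  by (simp add: chain_maps_def chain_hom_def)

lemma fg_freeD:
  assumes "fg_free G"
  shows "comm_group G" "group G" "finitely_generated G"
proof -
  show cG: "comm_group G"
    using assms by (simp add: fg_free_def)
  then show gG: "group G"
    by (rule comm_group.axioms(2))
  obtain n :: nat where "G \<cong> free_Abelian_group {..<n}"
    using assms by (auto simp: fg_free_def)
  then have "free_Abelian_group {..<n} \<cong> G"
    using gG by (simp add: group.iso_sym)
  then obtain h where "h \<in> iso (free_Abelian_group {..<n}) G"
    by (auto simp: is_iso_def)
  then show "finitely_generated G"
    using finitely_generated_surj[OF group_free_Abelian_group gG, of h "{..<n}"]
    by (simp add: finitely_generated_free_Abelian_group iso_def bij_betw_def)
qed

lemma bounded_free_complexD: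
  assumes "bounded_free_complex X"
  shows "fg_free (Grp X i)" "comm_group (Grp X i)" "group (Grp X i)" "finitely_generated (Grp X i)"
    and "diff X i \<in> carrier (hom_group (Grp X i) (Grp X (i + 1)))"
    and "x \<in> carrier (Grp X i) \<Longrightarrow> diff X i x \<in> carrier (Grp X (i + 1))"
    and "x \<in> carrier (Grp X i) \<Longrightarrow> diff X (i + 1) (diff X i x) = \<one>\<^bsub>Grp X (i + 2)\<^esub>"
    and "finite {i. \<not> trivial_group (Grp X i)}"
  using assms fg_freeD hom_group_closed unfolding bounded_free_complex_def by metis+

lemma chain_homD:
  assumes "f \<in> chain_hom X Y"
  shows "f i \<in> carrier (hom_group (Grp X i) (Grp Y i))"
    and "x \<in> carrier (Grp X i) \<Longrightarrow> f i x \<in> carrier (Grp Y i)"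
    and "x \<in> carrier (Grp X i) \<Longrightarrow> f (i + 1) (diff X i x) = diff Y i (f i x)"
proof -
  show *: "f i \<in> carrier (hom_group (Grp X i) (Grp Y i))"
    using assms by (simp add: chain_hom_def)
  show "f i x \<in> carrier (Grp Y i)" "f (i + 1) (diff X i x) = diff Y i (f i x)"
    if "x \<in> carrier (Grp X i)"
    using hom_group_closed[OF * that] assms that by (simp_all add: chain_hom_def)
qed

lemma chain_homI:
  assumes "\<And>i. f i \<in> carrier (hom_group (Grp X i) (Grp Y i))"
    and "\<And>i x. x \<in> carrier (Grp X i) \<Longrightarrow> f (i + 1) (diff X i x) = diff Y i (f i x)"
  shows "f \<in> chain_hom X Y"
  using assms by (simp add: chain_hom_def)

lemma chain_hom_compose:
  assumes X: "bounded_free_complex X" and f: "f \<in> chain_hom X Y" and g: "g \<in> chain_hom Y Z"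
  shows "(\<lambda>i. compose (carrier (Grp X i)) (g i) (f i)) \<in> chain_hom X Z"
proof (rule chain_homI)
  show "compose (carrier (Grp X i)) (g i) (f i) \<in> carrier (hom_group (Grp X i) (Grp Z i))" for i
    by (rule compose_hom_group[OF bounded_free_complexD(3)[OF X] chain_homD(1)[OF f] chain_homD(1)[OF g]])
  show "compose (carrier (Grp X (i + 1))) (g (i + 1)) (f (i + 1)) (diff X i x)
      = diff Z i (compose (carrier (Grp X i)) (g i) (f i) x)" if "x \<in> carrier (Grp X i)" for i x
    using that bounded_free_complexD(6)[OF X that] chain_homD(3)[OF f that]
      chain_homD(3)[OF g chain_homD(2)[OF f that]] by (simp add: compose_def)
qed

lemma chain_hom_mult:
  assumes X: "bounded_free_complex X" and Y: "bounded_free_complex Y"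
    and f: "f \<in> chain_hom X Y" and g: "g \<in> chain_hom X Y"
  shows "(\<lambda>i. f i \<otimes>\<^bsub>hom_group (Grp X i) (Grp Y i)\<^esub> g i) \<in> chain_hom X Y"
proof (rule chain_homI)
  have "comm_group (hom_group (Grp X i) (Grp Y i))" for i
    by (intro comm_group_hom_group bounded_free_complexD(2,3)[OF X] bounded_free_complexD(2)[OF Y])
  then show "f i \<otimes>\<^bsub>hom_group (Grp X i) (Grp Y i)\<^esub> g i \<in> carrier (hom_group (Grp X i) (Grp Y i))" for i
    by (intro group_m_closed comm_group.axioms(2) chain_homD(1)[OF f] chain_homD(1)[OF g])
  show "(f (i + 1) \<otimes>\<^bsub>hom_group (Grp X (i + 1)) (Grp Y (i + 1))\<^esub> g (i + 1)) (diff X i x)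
      = diff Y i ((f i \<otimes>\<^bsub>hom_group (Grp X i) (Grp Y i)\<^esub> g i) x)" if "x \<in> carrier (Grp X i)" for i x
    using that bounded_free_complexD(6)[OF X that] chain_homD(3)[OF f that] chain_homD(3)[OF g that]
      hom_group_mult[OF bounded_free_complexD(5)[OF Y] chain_homD(2)[OF f that] chain_homD(2)[OF g that]]
    by (simp add: hom_group_simps)
qed

lemma hom_group_one: "\<lbrakk>f \<in> carrier (hom_group G H); group G; group H\<rbrakk> \<Longrightarrow> f \<one>\<^bsub>G\<^esub> = \<one>\<^bsub>H\<^esub>"
  by (auto simp: hom_group_simps intro: hom_one)

lemma hom_group_inv:
  assumes "f \<in> carrier (hom_group G H)" "group G" "group H" "x \<in> carrier G"
  shows "f (inv\<^bsub>G\<^esub> x) = inv\<^bsub>H\<^esub> f x"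
proof -
  interpret group_hom G H f
    using assms by (simp add: group_hom_def group_hom_axioms_def hom_group_simps)
  show ?thesis
    using assms(4) by simp
qed

lemma chain_hom_one:
  assumes X: "bounded_free_complex X" and Y: "bounded_free_complex Y"
  shows "(\<lambda>i. \<one>\<^bsub>hom_group (Grp X i) (Grp Y i)\<^esub>) \<in> chain_hom X Y"
proof (rule chain_homI)
  note gX = bounded_free_complexD(3)[OF X] and gY = bounded_free_complexD(3)[OF Y]
  show "\<one>\<^bsub>hom_group (Grp X i) (Grp Y i)\<^esub> \<in> carrier (hom_group (Grp X i) (Grp Y i))" for i
    using one_hom_group[OF gX gY] by (simp add: hom_group_simps(3))
  show "\<one>\<^bsub>hom_group (Grp X (i + 1)) (Grp Y (i + 1))\<^esub> (diff X i x)
      = diff Y i (\<one>\<^bsub>hom_group (Grp X i) (Grp Y i)\<^esub> x)" if "x \<in> carrier (Grp X i)" for i x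
    using that bounded_free_complexD(6)[OF X that] hom_group_one[OF bounded_free_complexD(5)[OF Y] gY gY]
    by (simp add: hom_group_simps)
qed

lemma chain_hom_inv:
  assumes X: "bounded_free_complex X" and Y: "bounded_free_complex Y" and f: "f \<in> chain_hom X Y"
  shows "(\<lambda>i. \<lambda>x\<in>carrier (Grp X i). inv\<^bsub>Grp Y i\<^esub> f i x) \<in> chain_hom X Y"
proof (rule chain_homI)
  note gX = bounded_free_complexD(3)[OF X] and gY = bounded_free_complexD(3)[OF Y]
  show "(\<lambda>x\<in>carrier (Grp X i). inv\<^bsub>Grp Y i\<^esub> f i x) \<in> carrier (hom_group (Grp X i) (Grp Y i))" for i
  proof (rule restrict_hom_group[OF gX homI])
    interpret Y: comm_group "Grp Y i"
      by (rule bounded_free_complexD(2)[OF Y])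
    fix x assume x: "x \<in> carrier (Grp X i)"
    then show "inv\<^bsub>Grp Y i\<^esub> f i x \<in> carrier (Grp Y i)"
      using chain_homD(2)[OF f] by simp
    fix y assume "y \<in> carrier (Grp X i)"
    with x show "inv\<^bsub>Grp Y i\<^esub> f i (x \<otimes>\<^bsub>Grp X i\<^esub> y) = inv\<^bsub>Grp Y i\<^esub> f i x \<otimes>\<^bsub>Grp Y i\<^esub> inv\<^bsub>Grp Y i\<^esub> f i y"
      using chain_homD(2)[OF f] by (simp add: hom_group_mult[OF chain_homD(1)[OF f]] Y.inv_mult)
  qed
  show "(\<lambda>x\<in>carrier (Grp X (i + 1)). inv\<^bsub>Grp Y (i + 1)\<^esub> f (i + 1) x) (diff X i x)
      = diff Y i ((\<lambda>x\<in>carrier (Grp X i). inv\<^bsub>Grp Y i\<^esub> f i x) x)" if "x \<in> carrier (Grp X i)" for i x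
    using that bounded_free_complexD(6)[OF X that] chain_homD(3)[OF f that]
      hom_group_inv[OF bounded_free_complexD(5)[OF Y] gY gY chain_homD(2)[OF f that]] by simp
qed

section \<open>The category of bounded complexes\<close>

lemma Cb_simps [simp]:
  "X \<in> Obj Cb \<longleftrightarrow> bounded_free_complex X"
  "carrier (Hom Cb X Y) = chain_hom X Y"
  "f \<otimes>\<^bsub>Hom Cb X Y\<^esub> g = (\<lambda>i. f i \<otimes>\<^bsub>hom_group (Grp X i) (Grp Y i)\<^esub> g i)"
  "\<one>\<^bsub>Hom Cb X Y\<^esub> = (\<lambda>i. \<one>\<^bsub>hom_group (Grp X i) (Grp Y i)\<^esub>)"
  "Idt Cb X = (\<lambda>i. \<lambda>x\<in>carrier (Grp X i). x)"
  "Comp Cb X Y Z g f = (\<lambda>i. compose (carrier (Grp X i)) (g i) (f i))"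
  by (simp_all add: Cb_def chain_maps_eq)

lemma preadditive_Cb: "preadditive_category (Cb :: ('a complex, _) category)"
proof (rule preadditive_category.intro)
  fix X Y :: "'a complex"
  assume "X \<in> Obj Cb" and "Y \<in> Obj Cb"
  then have X: "bounded_free_complex X" and Y: "bounded_free_complex Y"
    by simp_all
  have cg: "comm_group (hom_group (Grp X i) (Grp Y i))" for i
    by (intro comm_group_hom_group bounded_free_complexD(2,3)[OF X] bounded_free_complexD(2)[OF Y])
  show "comm_group (Hom Cb X Y)"
  proof (rule comm_groupI)
    fix f g assume f: "f \<in> carrier (Hom Cb X Y)" and g: "g \<in> carrier (Hom Cb X Y)"
    show "f \<otimes>\<^bsub>Hom Cb X Y\<^esub> g \<in> carrier (Hom Cb X Y)"
      using chain_hom_mult[OF X Y] f g by simp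
    show "f \<otimes>\<^bsub>Hom Cb X Y\<^esub> g = g \<otimes>\<^bsub>Hom Cb X Y\<^esub> f"
    proof
      interpret H: comm_group "hom_group (Grp X i) (Grp Y i)" for i by (rule cg)
      show "(f \<otimes>\<^bsub>Hom Cb X Y\<^esub> g) i = (g \<otimes>\<^bsub>Hom Cb X Y\<^esub> f) i" for i
        using chain_homD(1) f g H.m_comm by (metis Cb_simps(2,3))
    qed
    fix h assume h: "h \<in> carrier (Hom Cb X Y)"
    show "f \<otimes>\<^bsub>Hom Cb X Y\<^esub> g \<otimes>\<^bsub>Hom Cb X Y\<^esub> h = f \<otimes>\<^bsub>Hom Cb X Y\<^esub> (g \<otimes>\<^bsub>Hom Cb X Y\<^esub> h)"
    proof
      interpret H: comm_group "hom_group (Grp X i) (Grp Y i)" for i by (rule cg)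
      show "(f \<otimes>\<^bsub>Hom Cb X Y\<^esub> g \<otimes>\<^bsub>Hom Cb X Y\<^esub> h) i = (f \<otimes>\<^bsub>Hom Cb X Y\<^esub> (g \<otimes>\<^bsub>Hom Cb X Y\<^esub> h)) i" for i
        using chain_homD(1)[of f X Y] chain_homD(1)[of g X Y] chain_homD(1)[of h X Y] f g h H.m_assoc
        by simp
    qed
  next
    show "\<one>\<^bsub>Hom Cb X Y\<^esub> \<in> carrier (Hom Cb X Y)"
      using chain_hom_one[OF X Y] by simp
    fix f assume f: "f \<in> carrier (Hom Cb X Y)"
    show "\<one>\<^bsub>Hom Cb X Y\<^esub> \<otimes>\<^bsub>Hom Cb X Y\<^esub> f = f"
    proof
      interpret H: comm_group "hom_group (Grp X i) (Grp Y i)" for i by (rule cg)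
      show "(\<one>\<^bsub>Hom Cb X Y\<^esub> \<otimes>\<^bsub>Hom Cb X Y\<^esub> f) i = f i" for i
        using chain_homD(1)[of f X Y] f by simp
    qed
    show "\<exists>g\<in>carrier (Hom Cb X Y). g \<otimes>\<^bsub>Hom Cb X Y\<^esub> f = \<one>\<^bsub>Hom Cb X Y\<^esub>"
    proof (rule bexI)
      show "(\<lambda>i. \<lambda>x\<in>carrier (Grp X i). inv\<^bsub>Grp Y i\<^esub> f i x) \<in> carrier (Hom Cb X Y)"
        using chain_hom_inv[OF X Y] f by simp
      show "(\<lambda>i. \<lambda>x\<in>carrier (Grp X i). inv\<^bsub>Grp Y i\<^esub> f i x) \<otimes>\<^bsub>Hom Cb X Y\<^esub> f = \<one>\<^bsub>Hom Cb X Y\<^esub>"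
        using chain_homD(2)[of f X Y] f bounded_free_complexD(3)[OF Y]
        by (auto simp: hom_group_simps group.l_inv intro!: restrict_ext)
    qed
  qed
  show "Idt Cb X \<in> carrier (Hom Cb X X)"
    using bounded_free_complexD(3,6)[OF X] by (auto intro!: chain_homI ident_hom_group)
  fix f assume "f \<in> carrier (Hom Cb X Y)"
  then have f: "f \<in> chain_hom X Y"
    by simp
  show "Comp Cb X X Y f (Idt Cb X) = f"
    using chain_homD(1)[OF f] by (auto simp: hom_group_simps compose_def extensional_def fun_eq_iff)
  show "Comp Cb X Y Y (Idt Cb Y) f = f"
    using chain_homD(1,2)[OF f] by (auto simp: hom_group_simps compose_def extensional_def fun_eq_iff)
  fix Z :: "'a complex" and g
  assume "Z \<in> Obj Cb" and "g \<in> carrier (Hom Cb Y Z)"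
  then have Z: "bounded_free_complex Z" and g: "g \<in> chain_hom Y Z"
    by simp_all
  show "Comp Cb X Y Z g f \<in> carrier (Hom Cb X Z)"
    using chain_hom_compose[OF X f g] by simp
  show "Comp Cb X Y Z (g \<otimes>\<^bsub>Hom Cb Y Z\<^esub> g') f
      = Comp Cb X Y Z g f \<otimes>\<^bsub>Hom Cb X Z\<^esub> Comp Cb X Y Z g' f" for g'
    using chain_homD(2)[OF f] by (auto simp: hom_group_simps compose_def fun_eq_iff)
  show "Comp Cb X Y Z g (f \<otimes>\<^bsub>Hom Cb X Y\<^esub> f')
      = Comp Cb X Y Z g f \<otimes>\<^bsub>Hom Cb X Z\<^esub> Comp Cb X Y Z g f'"
    if "f' \<in> carrier (Hom Cb X Y)" for f'
    using chain_homD(2)[OF f] chain_homD(2)[of f' X Y] that hom_group_mult[OF chain_homD(1)[OF g]]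
    by (auto simp: hom_group_simps compose_def fun_eq_iff)
  fix W :: "'a complex" and h assume "h \<in> carrier (Hom Cb W X)"
  then show "Comp Cb W X Z (Comp Cb X Y Z g f) h = Comp Cb W Y Z g (Comp Cb W X Y f h)"
    using chain_homD(2)[of h W X] by (auto simp: compose_def fun_eq_iff)
qed

section \<open>Shifts of complexes\<close>

lemma Grp_shift_complex [simp]: "Grp (shift_complex k X) i = Grp X (i + k)"
  by (simp add: shift_complex_def)

lemma diff_shift_complex:
  "x \<in> carrier (Grp X (i + k)) \<Longrightarrow> diff (shift_complex k X) i x
    = (if even k then diff X (i + k) x else inv\<^bsub>Grp X (i + k + 1)\<^esub> diff X (i + k) x)"
  by (simp add: shift_complex_def)

lemma bounded_free_shift_complex:
  assumes X: "bounded_free_complex X"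
  shows "bounded_free_complex (shift_complex k X)"
  unfolding bounded_free_complex_def
proof (intro conjI allI ballI)
  note gX = bounded_free_complexD(3)[OF X] and d = bounded_free_complexD(6)[OF X]
  \<comment> \<open>Degree \<open>i + 1\<close> of the shifted complex is degree
    \<open>i + 1 + k\<close> of \<open>X\<close>, whereas \<open>diff X (i + k)\<close> lands in
    degree \<open>i + k + 1\<close>; the two indices are equal but not syntactically.\<close>
  have idx: "i + 1 + k = i + k + 1" "i + 2 + k = i + k + 2" for i
    by simp_all
  fix i
  show "fg_free (Grp (shift_complex k X) i)"
    by (simp add: bounded_free_complexD(1)[OF X])
  interpret Y: comm_group "Grp X (i + k + 1)"
    by (rule bounded_free_complexD(2)[OF X])
  have "(\<lambda>x. if even k then diff X (i + k) x else inv\<^bsub>Grp X (i + k + 1)\<^esub> diff X (i + k) x)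
      \<in> hom (Grp X (i + k)) (Grp X (i + k + 1))"
    by (rule homI) (auto simp: d hom_group_mult[OF bounded_free_complexD(5)[OF X]] Y.inv_mult)
  then have "restrict (\<lambda>x. if even k then diff X (i + k) x else inv\<^bsub>Grp X (i + k + 1)\<^esub> diff X (i + k) x)
      (carrier (Grp X (i + k))) \<in> carrier (hom_group (Grp X (i + k)) (Grp X (i + k + 1)))"
    by (rule restrict_hom_group[OF gX])
  then show "diff (shift_complex k X) i
      \<in> carrier (hom_group (Grp (shift_complex k X) i) (Grp (shift_complex k X) (i + 1)))"
    by (simp add: shift_complex_def idx)
  fix x assume "x \<in> carrier (Grp (shift_complex k X) i)"
  then have x: "x \<in> carrier (Grp X (i + k))"
    by simp
  have dd: "diff X (i + k + 1) (diff X (i + k) x) = \<one>\<^bsub>Grp X (i + k + 2)\<^esub>"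
    by (rule bounded_free_complexD(7)[OF X x])
  have "diff X (i + k + 1) (inv\<^bsub>Grp X (i + k + 1)\<^esub> diff X (i + k) x) = \<one>\<^bsub>Grp X (i + k + 2)\<^esub>"
    using hom_group_inv[OF bounded_free_complexD(5)[OF X] gX gX d[OF x]] dd
      monoid.inv_one[OF group.is_monoid[OF gX]] by (simp add: add.assoc)
  moreover have "diff (shift_complex k X) (i + 1) y
      = (if even k then diff X (i + k + 1) y else inv\<^bsub>Grp X (i + k + 2)\<^esub> diff X (i + k + 1) y)"
    if "y \<in> carrier (Grp X (i + k + 1))" for y
  proof -
    have "i + 1 + k + 1 = i + k + 2"
      by simp
    with diff_shift_complex[of y X "i + 1" k] that show ?thesis
      by (simp only: idx)
  qed
  ultimately show "diff (shift_complex k X) (i + 1) (diff (shift_complex k X) i x)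
      = \<one>\<^bsub>Grp (shift_complex k X) (i + 2)\<^esub>"
    unfolding diff_shift_complex[OF x] Grp_shift_complex idx(2)
    using d[OF x] dd monoid.inv_one[OF group.is_monoid[OF gX[of "i + k + 2"]]]
    by (cases "even k") simp_all
next
  have "{i. \<not> trivial_group (Grp X (i + k))} = (\<lambda>i. i - k) ` {i. \<not> trivial_group (Grp X i)}"
    by (auto simp: image_iff intro!: exI[of _ "_ + k"])
  then show "finite {i. \<not> trivial_group (Grp (shift_complex k X) i)}"
    using bounded_free_complexD(8)[OF X] by simp
qed

lemma complex_eqI:
  fixes X Y :: "'a complex"
  shows "\<lbrakk>\<And>i. Grp X i = Grp Y i; \<And>i. diff X i = diff Y i\<rbrakk> \<Longrightarrow> X = Y"
  by (rule complex.equality) auto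

text \<open>The sign of the iterated shift is \<open>(-1)\<close> to the power \<open>i + j\<close>,
  because two inversions cancel. The differentials are equal as functions because each shift
  restricts them to the carrier.\<close>

lemma shift_complex_shift_complex:
  assumes X: "bounded_free_complex X"
  shows "shift_complex i (shift_complex j X) = shift_complex (i + j) X"
proof (rule complex_eqI)
  note d = bounded_free_complexD(6)[OF X] and gX = bounded_free_complexD(3)[OF X]
  have a: "n + i + j = n + (i + j)" "n + i + 1 + j = n + (i + j) + 1" for n
    by simp_all
  show "diff (shift_complex i (shift_complex j X)) n = diff (shift_complex (i + j) X) n" for n
    unfolding shift_complex_def
    by (auto simp: a d gX group.inv_inv intro!: restrict_ext)
qed (simp add: add.assoc)

text \<open>Shifting restricts the differential to the carrier. This does not alter it, because the
  differentials of a bounded free complex are extensional.\<close>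

lemma shift_complex_0:
  assumes X: "bounded_free_complex X"
  shows "shift_complex 0 X = X"
proof (rule complex_eqI)
  show "diff (shift_complex 0 X) n = diff X n" for n
    using bounded_free_complexD(5)[OF X, of n]
    by (auto simp: shift_complex_def hom_group_simps extensional_def fun_eq_iff)
qed simp

text \<open>Homomorphisms commute with inversion, so the sign of the shifted differentials is
  harmless and the shifted map carries none.\<close>

lemma chain_hom_shift:
  assumes X: "bounded_free_complex X" and Y: "bounded_free_complex Y" and f: "f \<in> chain_hom X Y"
  shows "(\<lambda>i. f (i + k)) \<in> chain_hom (shift_complex k X) (shift_complex k Y)"
proof (rule chain_homI)
  fix i x assume "x \<in> carrier (Grp (shift_complex k X) i)"
  then have x: "x \<in> carrier (Grp X (i + k))"
    by simp
  have idx: "i + 1 + k = i + k + 1"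
    by simp
  show "f (i + 1 + k) (diff (shift_complex k X) i x) = diff (shift_complex k Y) i (f (i + k) x)"
    using hom_group_inv[OF chain_homD(1)[OF f] bounded_free_complexD(3)[OF X] bounded_free_complexD(3)[OF Y]
        bounded_free_complexD(6)[OF X x]] x chain_homD(2)[OF f x] chain_homD(3)[OF f x]
    by (simp add: diff_shift_complex idx)
qed (simp add: chain_homD(1)[OF f])

lemma shift_simps [simp]:
  "FObj (shift k) X = shift_complex k X"
  "FMor (shift k) X Y f = (\<lambda>i. f (i + k))"
  by (simp_all add: shift_def)

lemma strict_shift_Cb: "strict_shift (Cb :: ('a complex, _) category) shift"
proof (intro strict_shift.intro strict_shift_axioms.intro)
  have "is_functor (Cb :: ('a complex, _) category) Cb (shift k)" for k
    by (rule is_functorI) (simp_all add: preadditive_Cb bounded_free_shift_complex chain_hom_shift restrict_def)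
  moreover have "FMor (shift k) X Y \<in> hom (Hom Cb X Y) (Hom Cb (FObj (shift k) X) (FObj (shift k) Y))"
    if "X \<in> Obj Cb" "Y \<in> Obj Cb" for k and X Y :: "'a complex"
    using that by (intro homI) (simp_all add: chain_hom_shift)
  ultimately show "additive_functor (Cb :: ('a complex, _) category) Cb (shift k)" for k
    by (simp add: additive_functor_def)
qed (simp_all add: preadditive_Cb shift_complex_shift_complex shift_complex_0 add.assoc)


section \<open>Projective complexes\<close>

text \<open>This is \<open>direct_sum_complex\<close> applied to shifts of \<open>disc\<close>, except that the differential is
  extensional, as \<open>bounded_free_complex\<close> requires.\<close>

definition discs :: "int list \<Rightarrow> (nat \<Rightarrow> int) complex" where
  "discs ks = \<lparr>
     Grp = (\<lambda>i. sum_group {..<length ks} (\<lambda>j. Grp disc (i + ks ! j))),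
     diff = (\<lambda>i. \<lambda>x\<in>carrier (sum_group {..<length ks} (\<lambda>j. Grp disc (i + ks ! j))).
       \<lambda>j\<in>{..<length ks}. if i + ks ! j = 0 then (if even (ks ! j) then x j else - x j) else 0)\<rparr>"

section \<open>Sums of disc complexes\<close>

lemma Grp_disc:
  "carrier (Grp disc m) = (if m = 0 \<or> m = 1 then UNIV else {0})"
  "\<one>\<^bsub>Grp disc m\<^esub> = 0"
  "\<lbrakk>x \<in> carrier (Grp disc m); y \<in> carrier (Grp disc m)\<rbrakk> \<Longrightarrow> x \<otimes>\<^bsub>Grp disc m\<^esub> y = x + y"
  by (auto simp: disc_def singleton_group_def)

lemma comm_group_Grp_disc: "comm_group (Grp disc m)" and group_Grp_disc: "group (Grp disc m)"
  by (simp_all add: disc_def abelian_integer_group)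

lemma inv_Grp_disc:
  assumes "x \<in> carrier (Grp disc m)"
  shows "inv\<^bsub>Grp disc m\<^esub> x = - x"
  by (rule group.inv_equality[OF group_Grp_disc])
    (use assms in \<open>auto simp: Grp_disc split: if_splits\<close>)

lemma Grp_discs: "Grp (discs ks) i = sum_group {..<length ks} (\<lambda>j. Grp disc (i + ks ! j))"
  by (simp add: discs_def)

lemma carrier_discs:
  "x \<in> carrier (Grp (discs ks) i) \<longleftrightarrow> x \<in> extensional {..<length ks} \<and>
     (\<forall>j<length ks. i + ks ! j \<noteq> 0 \<and> i + ks ! j \<noteq> 1 \<longrightarrow> x j = 0)"
  by (auto simp: Grp_discs carrier_sum_group group_Grp_disc PiE_iff Grp_disc)

lemma one_discs: "\<one>\<^bsub>Grp (discs ks) i\<^esub> = (\<lambda>j\<in>{..<length ks}. 0)"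
  by (simp add: Grp_discs Grp_disc)

lemma mult_discs:
  assumes "x \<in> carrier (Grp (discs ks) i)" "y \<in> carrier (Grp (discs ks) i)"
  shows "x \<otimes>\<^bsub>Grp (discs ks) i\<^esub> y = (\<lambda>j\<in>{..<length ks}. x j + y j)"
  using assms unfolding Grp_discs mult_sum_group
  by (auto simp: carrier_sum_group group_Grp_disc PiE_iff Grp_disc(3) intro!: restrict_ext)

lemma inv_discs:
  assumes "x \<in> carrier (Grp (discs ks) i)"
  shows "inv\<^bsub>Grp (discs ks) i\<^esub> x = (\<lambda>j\<in>{..<length ks}. - x j)"
  using assms unfolding Grp_discs
  by (subst inv_sum_group)
    (auto simp: carrier_sum_group group_Grp_disc PiE_iff inv_Grp_disc intro!: restrict_ext)

lemma diff_discs: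
  assumes "x \<in> carrier (Grp (discs ks) i)"
  shows "diff (discs ks) i x
    = (\<lambda>j\<in>{..<length ks}. if i + ks ! j = 0 then (if even (ks ! j) then x j else - x j) else 0)"
  using assms by (simp add: discs_def)

text \<open>\<open>isomorphic_complexes\<close> compares differentials on carriers only, and there
  \<open>discs ks\<close> agrees with the direct sum of the shifted discs. The sign in
  \<open>discs\<close> is the one that the shift introduces.\<close>

lemma isomorphic_discs:
  "isomorphic_complexes X (direct_sum_complex {..<length ks} (\<lambda>j. shift_complex (ks ! j) disc))
    \<longleftrightarrow> isomorphic_complexes X (discs ks)"
proof -
  let ?D = "direct_sum_complex {..<length ks} (\<lambda>j. shift_complex (ks ! j) disc)"
  have Grp: "Grp ?D i = Grp (discs ks) i" for i
    by (simp add: discs_def direct_sum_complex_def)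
  have diff: "diff ?D i x = diff (discs ks) i x" if x: "x \<in> carrier (Grp (discs ks) i)" for i x
  proof -
    have "diff (shift_complex (ks ! j) disc) i (x j)
       = (if i + ks ! j = 0 then (if even (ks ! j) then x j else - x j) else 0)" if "j < length ks" for j
    proof -
      have xj: "x j \<in> carrier (Grp disc (i + ks ! j))"
        using x that by (auto simp: carrier_discs Grp_disc)
      have d: "diff disc (i + ks ! j) (x j) = (if i + ks ! j = 0 then x j else 0)"
        by (simp add: disc_def)
      then have dc: "diff disc (i + ks ! j) (x j) \<in> carrier (Grp disc (i + ks ! j + 1))"
        by (simp add: Grp_disc)
      show ?thesis
        unfolding diff_shift_complex[OF xj] inv_Grp_disc[OF dc] unfolding d by simp
    qed
    then show ?thesis
      unfolding diff_discs[OF x] by (auto simp: direct_sum_complex_def intro!: restrict_ext)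
  qed
  have "f i x \<in> carrier (Grp (discs ks) i)"
    if "f i \<in> iso (Grp X i) (Grp (discs ks) i)" "x \<in> carrier (Grp X i)" for f i x
    using that by (auto simp: iso_def hom_def)
  then show ?thesis
    unfolding isomorphic_complexes_def Grp by (metis diff)
qed

lemma comm_group_discs: "comm_group (Grp (discs ks) i)"
  unfolding Grp_discs by (rule comm_group_sum_group) (rule comm_group_Grp_disc)

lemma fg_free_discs: "fg_free (Grp (discs ks) i)"
proof -
  \<comment> \<open>The discs that are nonzero in degree \<open>i\<close>. Each of them contributes
    one copy of the integers, so the rank is \<open>card T\<close>.\<close>
  define T where "T = {j. j < length ks \<and> (i + ks ! j = 0 \<or> i + ks ! j = 1)}"
  have T: "finite T" "T \<subseteq> {..<length ks}"
    by (auto simp: T_def)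
  let ?S = "\<lambda>j. if j \<in> T then {j} else {}"
  have "Grp disc (i + ks ! j) \<cong> free_Abelian_group (?S j)" if "j < length ks" for j
  proof (cases "j \<in> T")
    case True
    then have "Grp disc (i + ks ! j) = integer_group"
      by (auto simp: T_def disc_def)
    with True show ?thesis
      by (simp add: isomorphic_group_integer_free_Abelian_group_singleton)
  next
    case False
    then have G: "Grp disc (i + ks ! j) = singleton_group 0"
      using that by (auto simp: T_def disc_def)
    have "(\<lambda>x. 0) \<in> iso (singleton_group (0::int)) (free_Abelian_group {})"
      by (auto simp: iso_def hom_def bij_betw_def singleton_group_def free_Abelian_group_def)
    from is_isoI[OF this] False show ?thesis
      by (simp add: G)
  qed
  then have "Grp (discs ks) i \<cong> sum_group {..<length ks} (\<lambda>j. free_Abelian_group (?S j))"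
    unfolding Grp_discs by (intro iso_sum_groupI) (auto simp: group_Grp_disc)
  also have "sum_group {..<length ks} (\<lambda>j. free_Abelian_group (?S j))
      \<cong> free_Abelian_group (\<Union> (?S ` {..<length ks}))"
    by (rule is_isoI[OF iso_free_Abelian_group_sum]) (auto simp: pairwise_def)
  also have "\<Union> (?S ` {..<length ks}) = T"
    using T(2) by auto
  also have "free_Abelian_group T \<cong> free_Abelian_group {..<card T}"
    using T(1) by (simp add: isomorphic_free_Abelian_groups eqpoll_iff_card)
  finally have "Grp (discs ks) i \<cong> free_Abelian_group {..<card T}" .
  then show ?thesis
    unfolding fg_free_def using comm_group_discs by blast
qed

lemma bounded_free_discs: "bounded_free_complex (discs ks)"
  unfolding bounded_free_complex_def
proof (intro conjI allI ballI)
  have g: "group (Grp (discs ks) i)" for i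
    using comm_group_discs by (rule comm_group.axioms(2))
  have dc: "diff (discs ks) i x \<in> carrier (Grp (discs ks) (i + 1))"
    if "x \<in> carrier (Grp (discs ks) i)" for i x
    using that by (auto simp: diff_discs) (auto simp: carrier_discs)
  fix i
  show "fg_free (Grp (discs ks) i)"
    by (rule fg_free_discs)
  have ext: "diff (discs ks) i \<in> extensional (carrier (Grp (discs ks) i))"
    by (simp add: discs_def)
  have "diff (discs ks) i \<in> hom (Grp (discs ks) i) (Grp (discs ks) (i + 1))"
  proof (rule homI)
    fix x y assume xy: "x \<in> carrier (Grp (discs ks) i)" "y \<in> carrier (Grp (discs ks) i)"
    show "diff (discs ks) i (x \<otimes>\<^bsub>Grp (discs ks) i\<^esub> y)
      = diff (discs ks) i x \<otimes>\<^bsub>Grp (discs ks) (i + 1)\<^esub> diff (discs ks) i y"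
      using group_m_closed[OF g xy] mult_discs[OF dc[OF xy(1)] dc[OF xy(2)]] xy
      by (auto simp: diff_discs mult_discs intro!: restrict_ext)
  qed (rule dc)
  with ext show "diff (discs ks) i \<in> carrier (hom_group (Grp (discs ks) i) (Grp (discs ks) (i + 1)))"
    by (simp add: hom_group_simps)
  fix x assume x: "x \<in> carrier (Grp (discs ks) i)"
  \<comment> \<open>The differential of the \<open>j\<close>-th disc is nonzero only in degree
    \<open>- (ks ! j)\<close>, so two consecutive differentials never both act on the same
    component.\<close>
  show "diff (discs ks) (i + 1) (diff (discs ks) i x) = \<one>\<^bsub>Grp (discs ks) (i + 2)\<^esub>"
    using diff_discs[OF dc[OF x]] by (auto simp: diff_discs[OF x] one_discs intro!: restrict_ext)
next
  show "finite {i. \<not> trivial_group (Grp (discs ks) i)}"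
  proof (rule finite_subset)
    \<comment> \<open>The disc shifted by \<open>k\<close> occupies the degrees \<open>- k\<close>
      and \<open>1 - k\<close>.\<close>
    show "{i. \<not> trivial_group (Grp (discs ks) i)} \<subseteq> (\<Union>j<length ks. {- (ks ! j), 1 - ks ! j})"
    proof (rule ccontr)
      assume "\<not> ?thesis"
      then obtain i where i: "\<not> trivial_group (Grp (discs ks) i)"
        "\<And>j. j < length ks \<Longrightarrow> i \<noteq> - (ks ! j) \<and> i \<noteq> 1 - ks ! j"
        by auto
      have "i + ks ! j \<noteq> 0 \<and> i + ks ! j \<noteq> 1" if "j < length ks" for j
        using i(2)[OF that] by linarith
      then have "carrier (Grp (discs ks) i) = {\<one>\<^bsub>Grp (discs ks) i\<^esub>}"
        by (auto simp: carrier_discs one_discs extensional_def fun_eq_iff)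
      then show False
        using i(1) comm_group.axioms(2)[OF comm_group_discs] by (auto simp: trivial_group_def)
    qed
  qed simp
qed


text \<open>A witness of \<open>isomorphic_complexes\<close> is arbitrary outside the carriers, so
  it is cut down to extensional maps. That the inverse commutes with the differentials follows by
  applying it to the corresponding identity for \<open>f\<close>.\<close>

lemma isomorphic_complexes_chain_hom:
  assumes X: "bounded_free_complex X" and Y: "bounded_free_complex Y" and iso: "isomorphic_complexes X Y"
  obtains \<phi> \<psi> where "\<phi> \<in> chain_hom X Y" "\<psi> \<in> chain_hom Y X"
    "\<And>i x. x \<in> carrier (Grp X i) \<Longrightarrow> \<psi> i (\<phi> i x) = x"
    "\<And>i y. y \<in> carrier (Grp Y i) \<Longrightarrow> \<phi> i (\<psi> i y) = y"
proof -
  note gX = bounded_free_complexD(3)[OF X] and gY = bounded_free_complexD(3)[OF Y]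
  obtain f where f: "\<And>i. f i \<in> iso (Grp X i) (Grp Y i)"
    and fd: "\<And>i x. x \<in> carrier (Grp X i) \<Longrightarrow> f (i + 1) (diff X i x) = diff Y i (f i x)"
    using iso by (auto simp: isomorphic_complexes_def)
  have "\<exists>g. group_isomorphisms (Grp X i) (Grp Y i) (f i) g" for i
    using f[of i] group.iso_iff_group_isomorphisms[OF gX] by blast
  then obtain g where g: "\<And>i. group_isomorphisms (Grp X i) (Grp Y i) (f i) (g i)"
    by metis
  then have fh: "f i \<in> hom (Grp X i) (Grp Y i)" and gh: "g i \<in> hom (Grp Y i) (Grp X i)"
    and gf: "x \<in> carrier (Grp X i) \<Longrightarrow> g i (f i x) = x"
    and fg: "y \<in> carrier (Grp Y i) \<Longrightarrow> f i (g i y) = y" for i x y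
    by (simp_all add: group_isomorphisms_def)
  define \<phi> where "\<phi> i = restrict (f i) (carrier (Grp X i))" for i
  define \<psi> where "\<psi> i = restrict (g i) (carrier (Grp Y i))" for i
  have \<phi>c: "f i x \<in> carrier (Grp Y i)" if "x \<in> carrier (Grp X i)" for i x
    by (rule hom_in_carrier[OF fh that])
  have \<psi>c: "g i y \<in> carrier (Grp X i)" if "y \<in> carrier (Grp Y i)" for i y
    by (rule hom_in_carrier[OF gh that])
  show ?thesis
  proof (rule that)
    show "\<phi> \<in> chain_hom X Y"
    proof (rule chain_homI)
      show "\<phi> i \<in> carrier (hom_group (Grp X i) (Grp Y i))" for i
        unfolding \<phi>_def by (rule restrict_hom_group[OF gX fh])
    qed (simp add: \<phi>_def fd bounded_free_complexD(6)[OF X])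
    show "\<psi> \<in> chain_hom Y X"
    proof (rule chain_homI)
      show "\<psi> i \<in> carrier (hom_group (Grp Y i) (Grp X i))" for i
        unfolding \<psi>_def by (rule restrict_hom_group[OF gY gh])
      fix i y assume y: "y \<in> carrier (Grp Y i)"
      have "g (i + 1) (diff Y i y) = g (i + 1) (f (i + 1) (diff X i (g i y)))"
        using fd[OF \<psi>c[OF y]] fg[OF y] by simp
      also have "\<dots> = diff X i (g i y)"
        by (rule gf[OF bounded_free_complexD(6)[OF X \<psi>c[OF y]]])
      finally show "\<psi> (i + 1) (diff Y i y) = diff X i (\<psi> i y)"
        using y by (simp add: \<psi>_def bounded_free_complexD(6)[OF Y])
    qed
  qed (simp_all add: \<phi>_def \<psi>_def \<phi>c \<psi>c gf fg)
qed

text \<open>Sums of discs live over \<open>nat \<Rightarrow> int\<close>, the objects of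
  \<open>Cb\<close> over \<open>'a\<close>. Finitely generated groups are countable, so each of them
  can be copied into \<open>'a\<close>; the differential is transported along the bijections
  \<open>\<iota>\<close> and their inverses \<open>\<kappa>\<close>.\<close>

lemma ex_isomorphic_complex:
  fixes Z :: "'c complex"
  assumes inf: "infinite (UNIV :: 'a set)" and Z: "bounded_free_complex Z"
  obtains Z' :: "'a complex" where "bounded_free_complex Z'" "isomorphic_complexes Z' Z"
proof -
  note gZ = bounded_free_complexD(3)[OF Z] and cZ = bounded_free_complexD(2)[OF Z]
  have "\<exists>\<iota> :: 'c \<Rightarrow> 'a. inj_on \<iota> (carrier (Grp Z i))" for i
    using ex_inj_on_countable[OF finitely_generated_countable[OF cZ bounded_free_complexD(4)[OF Z]] inf] .
  then obtain \<iota> :: "int \<Rightarrow> 'c \<Rightarrow> 'a" where \<iota>: "\<And>i. inj_on (\<iota> i) (carrier (Grp Z i))"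
    by metis
  define G where "G i = image_group (\<iota> i) (Grp Z i)" for i
  define \<kappa> where "\<kappa> i = inv_into (carrier (Grp Z i)) (\<iota> i)" for i
  define Z' where "Z' = \<lparr>Grp = G, diff = (\<lambda>i. \<lambda>x\<in>carrier (G i). \<iota> (i + 1) (diff Z i (\<kappa> i x)))\<rparr>"
  have cG: "comm_group (G i)" for i
    unfolding G_def by (rule comm_group_image_group[OF cZ \<iota>])
  then have gG: "group (G i)" for i
    by (rule comm_group.axioms(2))
  have iso: "\<iota> i \<in> iso (Grp Z i) (G i)" for i
    unfolding G_def by (rule image_group_iso[OF gZ \<iota>])
  then have iso': "\<kappa> i \<in> iso (G i) (Grp Z i)" for i
    unfolding \<kappa>_def by (rule group.iso_set_sym[OF gZ])
  have \<kappa>\<iota>: "\<kappa> i (\<iota> i z) = z" if "z \<in> carrier (Grp Z i)" for i z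
    unfolding \<kappa>_def by (rule inv_into_f_f[OF \<iota> that])
  have \<iota>c: "\<iota> i z \<in> carrier (G i)" if "z \<in> carrier (Grp Z i)" for i z
    using iso[of i] that by (auto simp: iso_def hom_def)
  have \<kappa>c: "\<kappa> i x \<in> carrier (Grp Z i)" if "x \<in> carrier (G i)" for i x
    using iso'[of i] that by (auto simp: iso_def hom_def)
  have d: "diff Z' i x = \<iota> (i + 1) (diff Z i (\<kappa> i x))" if "x \<in> carrier (G i)" for i x
    using that by (simp add: Z'_def)
  have Grp: "Grp Z' = G"
    by (simp add: Z'_def)
  have Z': "bounded_free_complex Z'"
    unfolding bounded_free_complex_def Grp
  proof (intro conjI allI ballI)
    fix i
    obtain n :: nat where "Grp Z i \<cong> free_Abelian_group {..<n}"
      using bounded_free_complexD(1)[OF Z, of i] by (auto simp: fg_free_def)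
    then have "G i \<cong> free_Abelian_group {..<n}"
      using iso_trans[OF is_isoI[OF iso']] by blast
    with cG show "fg_free (G i)"
      by (auto simp: fg_free_def)
    have "diff Z i \<in> hom (Grp Z i) (Grp Z (i + 1))"
      using bounded_free_complexD(5)[OF Z] by (simp add: hom_group_simps)
    then have "\<iota> (i + 1) \<circ> (diff Z i \<circ> \<kappa> i) \<in> hom (G i) (G (i + 1))"
      using iso[of "i + 1"] iso'[of i] by (intro hom_compose[of _ _ "Grp Z (i + 1)"] hom_compose[of _ _ "Grp Z i"]) (simp_all add: iso_def)
    from restrict_hom_group[OF gG this]
    show "diff Z' i \<in> carrier (hom_group (G i) (G (i + 1)))"
      by (simp add: Z'_def comp_def)
    fix x assume x: "x \<in> carrier (G i)"
    have idx: "i + 1 + 1 = i + 2"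
      by simp
    note y = bounded_free_complexD(6)[OF Z \<kappa>c[OF x]]
    have "diff Z' (i + 1) (diff Z' i x) = \<iota> (i + 1 + 1) (diff Z (i + 1) (\<kappa> (i + 1) (\<iota> (i + 1) (diff Z i (\<kappa> i x)))))"
      unfolding d[OF x] by (rule d[OF \<iota>c[OF y]])
    also have "\<dots> = \<one>\<^bsub>G (i + 2)\<^esub>"
      unfolding \<kappa>\<iota>[OF y] bounded_free_complexD(7)[OF Z \<kappa>c[OF x]] G_def image_group_one idx ..
    finally show "diff Z' (i + 1) (diff Z' i x) = \<one>\<^bsub>G (i + 2)\<^esub>" .
  next
    have "trivial_group (G i) \<longleftrightarrow> trivial_group (Grp Z i)" for i
      by (rule isomorphic_group_triviality[OF is_isoI[OF iso'] gG gZ])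
    then show "finite {i. \<not> trivial_group (G i)}"
      using bounded_free_complexD(8)[OF Z] by simp
  qed
  moreover have "isomorphic_complexes Z' Z"
    unfolding isomorphic_complexes_def Grp
    using iso' \<kappa>\<iota>[OF bounded_free_complexD(6)[OF Z \<kappa>c]]
    by (intro exI[of _ \<kappa>]) (simp add: d)
  ultimately show ?thesis
    by (rule that)
qed

section \<open>The ideal of maps through projective complexes\<close>

lemma factoring_CbE:
  fixes X Y :: "'a complex"
  assumes "f \<in> factoring_maps Cb projective_complex X Y"
  obtains P :: "'a complex" and a b where "bounded_free_complex P" "projective_complex P" "a \<in> chain_hom X P"
    "b \<in> chain_hom P Y" "f = (\<lambda>i. compose (carrier (Grp X i)) (b i) (a i))"
  using assms unfolding factoring_maps_def Cb_simps by blast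

text \<open>Replaces an unknown projective complex by an explicit list of discs. From left to right,
  an isomorphism and its inverse are inserted in the middle of the composite; from right to left, a
  copy of \<open>discs ks\<close> over \<open>'a\<close> provides the projective object.\<close>

lemma factoring_Cb_iff:
  fixes X Y :: "'a complex"
  assumes inf: "infinite (UNIV :: 'a set)" and X: "bounded_free_complex X" and Y: "bounded_free_complex Y"
  shows "f \<in> factoring_maps Cb projective_complex X Y \<longleftrightarrow>
    (\<exists>ks a b. a \<in> chain_hom X (discs ks) \<and> b \<in> chain_hom (discs ks) Y \<and>
      f = (\<lambda>i. compose (carrier (Grp X i)) (b i) (a i)))"
proof
  assume "f \<in> factoring_maps Cb projective_complex X Y"
  then obtain P :: "'a complex" and a b where P: "bounded_free_complex P" "projective_complex P" "a \<in> chain_hom X P"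
    "b \<in> chain_hom P Y" "f = (\<lambda>i. compose (carrier (Grp X i)) (b i) (a i))"
    by (rule factoring_CbE)
  then obtain ks where "isomorphic_complexes P (discs ks)"
    by (auto simp: projective_complex_def isomorphic_discs)
  from isomorphic_complexes_chain_hom[OF P(1) bounded_free_discs this]
  obtain \<phi> \<psi> where *: "\<phi> \<in> chain_hom P (discs ks)" "\<psi> \<in> chain_hom (discs ks) P"
    "\<And>i x. x \<in> carrier (Grp P i) \<Longrightarrow> \<psi> i (\<phi> i x) = x"
    by metis
  have "f = (\<lambda>i. compose (carrier (Grp X i)) (compose (carrier (Grp (discs ks) i)) (b i) (\<psi> i))
      (compose (carrier (Grp X i)) (\<phi> i) (a i)))"
    by (rule ext) (auto simp: P(5) *(3) chain_homD(2)[OF P(3)] chain_homD(2)[OF *(1)] compose_def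
        intro!: restrict_ext)
  then show "\<exists>ks a b. a \<in> chain_hom X (discs ks) \<and> b \<in> chain_hom (discs ks) Y \<and>
      f = (\<lambda>i. compose (carrier (Grp X i)) (b i) (a i))"
    using chain_hom_compose[OF X P(3) *(1)] chain_hom_compose[OF bounded_free_discs *(2) P(4)] by blast
next
  assume "\<exists>ks a b. a \<in> chain_hom X (discs ks) \<and> b \<in> chain_hom (discs ks) Y \<and>
      f = (\<lambda>i. compose (carrier (Grp X i)) (b i) (a i))"
  then obtain ks a b where ab: "a \<in> chain_hom X (discs ks)" "b \<in> chain_hom (discs ks) Y"
    "f = (\<lambda>i. compose (carrier (Grp X i)) (b i) (a i))"
    by blast
  obtain P :: "'a complex" where P: "bounded_free_complex P" "isomorphic_complexes P (discs ks)"
    by (rule ex_isomorphic_complex[OF inf bounded_free_discs])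
  then have proj: "projective_complex P"
    unfolding projective_complex_def isomorphic_discs by blast
  from isomorphic_complexes_chain_hom[OF P(1) bounded_free_discs P(2)]
  obtain \<phi> \<psi> where *: "\<phi> \<in> chain_hom P (discs ks)" "\<psi> \<in> chain_hom (discs ks) P"
    "\<And>i y. y \<in> carrier (Grp (discs ks) i) \<Longrightarrow> \<phi> i (\<psi> i y) = y"
    by metis
  have "f = Comp Cb X P Y (\<lambda>i. compose (carrier (Grp P i)) (b i) (\<phi> i))
      (\<lambda>i. compose (carrier (Grp X i)) (\<psi> i) (a i))"
    by (rule ext) (auto simp: ab(3) *(3) chain_homD(2)[OF ab(1)] chain_homD(2)[OF *(2)] compose_def
        intro!: restrict_ext)
  then show "f \<in> factoring_maps Cb projective_complex X Y"
    unfolding factoring_maps_def Cb_simps(1,2)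
    using P(1) proj chain_hom_compose[OF X ab(1) *(2)] chain_hom_compose[OF P(1) *(1) ab(2)] by blast
qed

text \<open>Together with the second projection and the pairing that follow, this gives
  \<open>discs (ks @ ls)\<close> the structure of a product of \<open>discs ks\<close> and
  \<open>discs ls\<close>, through which sums of factoring maps are made to factor.\<close>

lemma discs_append_fst:
  "(\<lambda>i. \<lambda>y\<in>carrier (Grp (discs (ks @ ls)) i). restrict y {..<length ks})
    \<in> chain_hom (discs (ks @ ls)) (discs ks)"
proof (rule chain_homI)
  note g = bounded_free_complexD(3)[OF bounded_free_discs]
  have cl: "restrict y {..<length ks} \<in> carrier (Grp (discs ks) i)"
    if "y \<in> carrier (Grp (discs (ks @ ls)) i)" for i y
    using that by (auto simp: carrier_discs nth_append)
  show "(\<lambda>y\<in>carrier (Grp (discs (ks @ ls)) i). restrict y {..<length ks})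
      \<in> carrier (hom_group (Grp (discs (ks @ ls)) i) (Grp (discs ks) i))" for i
    by (rule restrict_hom_group[OF g homI]) (auto simp: cl mult_discs intro!: restrict_ext)
  show "(\<lambda>y\<in>carrier (Grp (discs (ks @ ls)) (i + 1)). restrict y {..<length ks}) (diff (discs (ks @ ls)) i x)
      = diff (discs ks) i ((\<lambda>y\<in>carrier (Grp (discs (ks @ ls)) i). restrict y {..<length ks}) x)"
    if "x \<in> carrier (Grp (discs (ks @ ls)) i)" for i x
    using that cl[OF that] bounded_free_complexD(6)[OF bounded_free_discs that]
    by (auto simp: diff_discs nth_append intro!: restrict_ext)
qed

lemma discs_append_snd:
  "(\<lambda>i. \<lambda>y\<in>carrier (Grp (discs (ks @ ls)) i). \<lambda>j\<in>{..<length ls}. y (length ks + j))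
    \<in> chain_hom (discs (ks @ ls)) (discs ls)"
proof (rule chain_homI)
  note g = bounded_free_complexD(3)[OF bounded_free_discs]
  have cl: "(\<lambda>j\<in>{..<length ls}. y (length ks + j)) \<in> carrier (Grp (discs ls) i)"
    if "y \<in> carrier (Grp (discs (ks @ ls)) i)" for i y
    using that by (auto simp: carrier_discs nth_append)
  show "(\<lambda>y\<in>carrier (Grp (discs (ks @ ls)) i). \<lambda>j\<in>{..<length ls}. y (length ks + j))
      \<in> carrier (hom_group (Grp (discs (ks @ ls)) i) (Grp (discs ls) i))" for i
    by (rule restrict_hom_group[OF g homI]) (auto simp: cl mult_discs intro!: restrict_ext)
  show "(\<lambda>y\<in>carrier (Grp (discs (ks @ ls)) (i + 1)). \<lambda>j\<in>{..<length ls}. y (length ks + j)) (diff (discs (ks @ ls)) i x)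
      = diff (discs ls) i ((\<lambda>y\<in>carrier (Grp (discs (ks @ ls)) i). \<lambda>j\<in>{..<length ls}. y (length ks + j)) x)"
    if "x \<in> carrier (Grp (discs (ks @ ls)) i)" for i x
    using that cl[OF that] bounded_free_complexD(6)[OF bounded_free_discs that]
    by (auto simp: diff_discs nth_append intro!: restrict_ext)
qed

lemma discs_append_pair:
  assumes X: "bounded_free_complex X" and a: "a \<in> chain_hom X (discs ks)" and b: "b \<in> chain_hom X (discs ls)"
  shows "(\<lambda>i. \<lambda>x\<in>carrier (Grp X i). \<lambda>j\<in>{..<length (ks @ ls)}.
      if j < length ks then a i x j else b i x (j - length ks)) \<in> chain_hom X (discs (ks @ ls))"
proof (rule chain_homI)
  let ?c = "\<lambda>i x. \<lambda>j\<in>{..<length (ks @ ls)}. if j < length ks then a i x j else b i x (j - length ks)"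
  have cl: "?c i x \<in> carrier (Grp (discs (ks @ ls)) i)" if "x \<in> carrier (Grp X i)" for i x
    using chain_homD(2)[OF a that] chain_homD(2)[OF b that]
    by (auto simp: carrier_discs nth_append)
  show "(\<lambda>x\<in>carrier (Grp X i). ?c i x) \<in> carrier (hom_group (Grp X i) (Grp (discs (ks @ ls)) i))" for i
  proof (rule restrict_hom_group[OF bounded_free_complexD(3)[OF X] homI])
    fix x y assume x: "x \<in> carrier (Grp X i)" and y: "y \<in> carrier (Grp X i)"
    show "?c i (x \<otimes>\<^bsub>Grp X i\<^esub> y) = ?c i x \<otimes>\<^bsub>Grp (discs (ks @ ls)) i\<^esub> ?c i y"
      unfolding mult_discs[OF cl[OF x] cl[OF y]]
        hom_group_mult[OF chain_homD(1)[OF a] x y] hom_group_mult[OF chain_homD(1)[OF b] x y]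
        mult_discs[OF chain_homD(2)[OF a x] chain_homD(2)[OF a y]]
        mult_discs[OF chain_homD(2)[OF b x] chain_homD(2)[OF b y]]
      by (auto intro!: restrict_ext)
  qed (rule cl)
  fix i x assume x: "x \<in> carrier (Grp X i)"
  show "(\<lambda>x\<in>carrier (Grp X (i + 1)). ?c (i + 1) x) (diff X i x)
      = diff (discs (ks @ ls)) i ((\<lambda>x\<in>carrier (Grp X i). ?c i x) x)"
    using x bounded_free_complexD(6)[OF X x] diff_discs[OF cl[OF x]]
      chain_homD(3)[OF a x] chain_homD(3)[OF b x]
    by (auto simp: diff_discs[OF chain_homD(2)[OF a x]] diff_discs[OF chain_homD(2)[OF b x]] nth_append
        intro!: restrict_ext)
qed

lemma ideal_quotient_Cb:
  assumes inf: "infinite (UNIV :: 'a set)"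
  shows "ideal_quotient (Cb :: ('a complex, _) category) projective_complex"
proof (rule preadditive_category.ideal_quotientI[OF preadditive_Cb])
  \<comment> \<open>The empty sum of discs is the zero complex, the simplest projective
    object.\<close>
  obtain Z :: "'a complex" where "bounded_free_complex Z" "isomorphic_complexes Z (discs [])"
    by (rule ex_isomorphic_complex[OF inf bounded_free_discs])
  then show "\<exists>Z :: 'a complex\<in>Obj Cb. projective_complex Z"
    unfolding projective_complex_def isomorphic_discs by (auto simp del: list.size)
  fix X Y :: "'a complex" and f f'
  assume "X \<in> Obj Cb" "Y \<in> Obj Cb"
  then have X: "bounded_free_complex X" and Y: "bounded_free_complex Y"
    by simp_all
  assume "f \<in> factoring_maps Cb projective_complex X Y" "f' \<in> factoring_maps Cb projective_complex X Y"
  then obtain ks a b ls a' b' where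
    ab: "a \<in> chain_hom X (discs ks)" "b \<in> chain_hom (discs ks) Y"
      "f = (\<lambda>i. compose (carrier (Grp X i)) (b i) (a i))" and
    ab': "a' \<in> chain_hom X (discs ls)" "b' \<in> chain_hom (discs ls) Y"
      "f' = (\<lambda>i. compose (carrier (Grp X i)) (b' i) (a' i))"
    unfolding factoring_Cb_iff[OF inf X Y] by blast
  let ?D = "discs (ks @ ls)"
  define c where "c = (\<lambda>i. \<lambda>x\<in>carrier (Grp X i). \<lambda>j\<in>{..<length (ks @ ls)}.
      if j < length ks then a i x j else a' i x (j - length ks))"
  define p where "p = (\<lambda>i. \<lambda>y\<in>carrier (Grp ?D i). restrict y {..<length ks})"
  define q where "q = (\<lambda>i. \<lambda>y\<in>carrier (Grp ?D i). \<lambda>j\<in>{..<length ls}. y (length ks + j))"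
  have c: "c \<in> chain_hom X ?D" and p: "p \<in> chain_hom ?D (discs ks)" and q: "q \<in> chain_hom ?D (discs ls)"
    unfolding c_def p_def q_def
    by (rule discs_append_pair[OF X ab(1) ab'(1)] discs_append_fst discs_append_snd)+
  let ?b = "\<lambda>i. compose (carrier (Grp ?D i)) (b i) (p i)"
  let ?b' = "\<lambda>i. compose (carrier (Grp ?D i)) (b' i) (q i)"
  have d: "(\<lambda>i. ?b i \<otimes>\<^bsub>hom_group (Grp ?D i) (Grp Y i)\<^esub> ?b' i) \<in> chain_hom ?D Y"
    by (intro chain_hom_mult[OF bounded_free_discs Y] chain_hom_compose[OF bounded_free_discs p ab(2)]
        chain_hom_compose[OF bounded_free_discs q ab'(2)])
  have pc: "p i (c i x) = a i x" "q i (c i x) = a' i x" if x: "x \<in> carrier (Grp X i)" for i x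
  proof -
    have "a i x \<in> extensional {..<length ks}" "a' i x \<in> extensional {..<length ls}"
      using chain_homD(2)[OF ab(1) x] chain_homD(2)[OF ab'(1) x] by (simp_all add: carrier_discs)
    then show "p i (c i x) = a i x" "q i (c i x) = a' i x"
      using x chain_homD(2)[OF c x] by (auto simp: p_def q_def c_def extensional_def fun_eq_iff)
  qed
  \<comment> \<open>With \<open>c\<close> the pairing of \<open>a\<close> and \<open>a'\<close>, the
    sum \<open>b \<circ> a + b' \<circ> a'\<close> equals
    \<open>(b \<circ> p + b' \<circ> q) \<circ> c\<close>, because \<open>p \<circ> c = a\<close>
    and \<open>q \<circ> c = a'\<close>.\<close>
  have "f \<otimes>\<^bsub>Hom Cb X Y\<^esub> f'
      = (\<lambda>i. compose (carrier (Grp X i)) (?b i \<otimes>\<^bsub>hom_group (Grp ?D i) (Grp Y i)\<^esub> ?b' i) (c i))"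
    unfolding Cb_simps
    by (rule ext) (auto simp: ab(3) ab'(3) hom_group_simps compose_def chain_homD(2)[OF c] pc
        intro!: restrict_ext)
  with c d show "f \<otimes>\<^bsub>Hom Cb X Y\<^esub> f' \<in> factoring_maps Cb projective_complex X Y"
    unfolding factoring_Cb_iff[OF inf X Y] by blast
qed

lemma projective_shift_complex:
  assumes P: "projective_complex P"
  shows "projective_complex (shift_complex k P)"
proof -
  have bP: "bounded_free_complex P"
    using P by (simp add: projective_complex_def)
  obtain ks where "isomorphic_complexes P (discs ks)"
    using P unfolding projective_complex_def isomorphic_discs by blast
  then obtain f where f: "\<And>i. f i \<in> iso (Grp P i) (Grp (discs ks) i)"
    and fd: "\<And>i x. x \<in> carrier (Grp P i) \<Longrightarrow> f (i + 1) (diff P i x) = diff (discs ks) i (f i x)"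
    by (auto simp: isomorphic_complexes_def)
  \<comment> \<open>Shifting a disc by \<open>l\<close> and then by \<open>k\<close> shifts it by
    \<open>k + l\<close>. In degree \<open>i\<close> the carrier for \<open>?ls\<close> is that for
    \<open>ks\<close> in degree \<open>i + k\<close>, so the given isomorphism can be reused with
    shifted index.\<close>
  let ?ls = "map (\<lambda>l. k + l) ks"
  have c: "carrier (Grp (discs ?ls) i) = carrier (Grp (discs ks) (i + k))" for i
    by (auto simp: carrier_discs add.assoc)
  have m: "x \<otimes>\<^bsub>Grp (discs ?ls) i\<^esub> y = x \<otimes>\<^bsub>Grp (discs ks) (i + k)\<^esub> y"
    if "x \<in> carrier (Grp (discs ks) (i + k))" "y \<in> carrier (Grp (discs ks) (i + k))" for i x y
    using that by (simp add: mult_discs c)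
  have fc: "f i x \<in> carrier (Grp (discs ks) i)" if "x \<in> carrier (Grp P i)" for i x
    using f[of i] that by (auto simp: iso_def hom_def)
  have "f (i + k) \<in> iso (Grp (shift_complex k P) i) (Grp (discs ?ls) i)" for i
    using f[of "i + k"] fc[of _ "i + k"] by (auto simp: iso_def hom_def c m)
  moreover have "f (i + 1 + k) (diff (shift_complex k P) i x) = diff (discs ?ls) i (f (i + k) x)"
    if "x \<in> carrier (Grp (shift_complex k P) i)" for i x
  proof -
    have x: "x \<in> carrier (Grp P (i + k))"
      using that by simp
    note gP = bounded_free_complexD(3)[OF bP] and gD = bounded_free_complexD(3)[OF bounded_free_discs]
    interpret h: group_hom "Grp P (i + k + 1)" "Grp (discs ks) (i + k + 1)" "f (i + k + 1)"
      using f[of "i + k + 1"] gP gD by (simp add: group_hom_def group_hom_axioms_def iso_def)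
    have idx: "i + 1 + k = i + k + 1"
      by simp
    have y: "f (i + k) x \<in> carrier (Grp (discs ks) (i + k))"
      by (rule fc[OF x])
    have y': "f (i + k) x \<in> carrier (Grp (discs ?ls) i)"
      using y by (simp add: c)
    have "f (i + 1 + k) (diff (shift_complex k P) i x)
      = (if even k then diff (discs ks) (i + k) (f (i + k) x)
         else inv\<^bsub>Grp (discs ks) (i + k + 1)\<^esub> diff (discs ks) (i + k) (f (i + k) x))"
      using x bounded_free_complexD(6)[OF bP x] fd[OF x] by (simp add: diff_shift_complex idx)
    \<comment> \<open>The sign of the outer shift and the parity of \<open>ks ! j\<close> combine to
      the parity of \<open>k + ks ! j\<close>.\<close>
    also have "\<dots> = diff (discs ?ls) i (f (i + k) x)"
      unfolding inv_discs[OF bounded_free_complexD(6)[OF bounded_free_discs y]]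
      unfolding diff_discs[OF y] diff_discs[OF y']
      by (auto simp: add.assoc intro!: restrict_ext)
    finally show ?thesis .
  qed
  ultimately have "isomorphic_complexes (shift_complex k P) (discs ?ls)"
    unfolding isomorphic_complexes_def by (intro exI[of _ "\<lambda>i. f (i + k)"]) simp
  then show ?thesis
    unfolding projective_complex_def isomorphic_discs[symmetric]
    using bounded_free_shift_complex[OF bP] by blast
qed

lemma shift_ideal_Cb:
  assumes inf: "infinite (UNIV :: 'a set)"
  shows "shift_ideal (Cb :: ('a complex, _) category) shift projective_complex"
proof (intro shift_ideal.intro shift_ideal_axioms.intro strict_shift_Cb ideal_quotient_Cb[OF inf])
  fix X Y :: "'a complex" and f k
  assume "X \<in> Obj Cb" "Y \<in> Obj Cb"
  then have X: "bounded_free_complex X" and Y: "bounded_free_complex Y"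
    by simp_all
  assume "f \<in> factoring_maps Cb projective_complex X Y"
  then obtain P :: "'a complex" and a b where P: "bounded_free_complex P" "projective_complex P" "a \<in> chain_hom X P"
    "b \<in> chain_hom P Y" "f = (\<lambda>i. compose (carrier (Grp X i)) (b i) (a i))"
    by (rule factoring_CbE)
  have "FMor (shift k) X Y f = Comp Cb (shift_complex k X) (shift_complex k P) (shift_complex k Y)
      (\<lambda>i. b (i + k)) (\<lambda>i. a (i + k))"
    by (simp add: P(5))
  then show "FMor (shift k) X Y f \<in> factoring_maps Cb projective_complex (FObj (shift k) X) (FObj (shift k) Y)"
    unfolding factoring_maps_def shift_simps(1) Cb_simps(1,2)
    using projective_shift_complex[OF P(2)] bounded_free_shift_complex[OF P(1)]
      chain_hom_shift[OF X P(1,3)] chain_hom_shift[OF P(1) Y P(4)] by blast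
qed


section \<open>Homology\<close>

definition cocycles :: "'a complex \<Rightarrow> int \<Rightarrow> 'a set" where
  "cocycles X i = {z \<in> carrier (Grp X i). diff X i z = \<one>\<^bsub>Grp X (i + 1)\<^esub>}"

definition homology_class :: "'a complex \<Rightarrow> int \<Rightarrow> 'a \<Rightarrow> 'a set" where
  "homology_class X i z = boundaries X i #>\<^bsub>Grp X i\<^esub> z"

locale cochain_complex =
  fixes X :: "'a complex"
  assumes bounded: "bounded_free_complex X"
begin

lemmas complexD = bounded_free_complexD[OF bounded]

lemma cocycles_subgroup: "subgroup (cocycles X i) (Grp X i)"
proof -
  interpret h: group_hom "Grp X i" "Grp X (i + 1)" "diff X i"
    using complexD(3,5) by (simp add: group_hom_def group_hom_axioms_def hom_group_simps)
  show ?thesis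
    using h.subgroup_kernel by (simp add: kernel_def cocycles_def)
qed

lemma boundaries_subset: "boundaries X i \<subseteq> cocycles X i"
proof
  fix b assume "b \<in> boundaries X i"
  then obtain x where x: "x \<in> carrier (Grp X (i - 1))" "b = diff X (i - 1) x"
    by (auto simp: boundaries_def)
  have idx: "i - 1 + 1 = i" "i - 1 + 2 = i + 1"
    by simp_all
  show "b \<in> cocycles X i"
    using complexD(6,7)[OF x(1), unfolded idx] x(2) by (simp add: cocycles_def)
qed

lemma boundaries_subgroup: "subgroup (boundaries X i) (Grp X i)"
proof -
  have "diff X (i - 1) \<in> hom (Grp X (i - 1)) (Grp X i)"
    using complexD(5)[of "i - 1"] by (simp add: hom_group_simps)
  then interpret h: group_hom "Grp X (i - 1)" "Grp X i" "diff X (i - 1)"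
    using complexD(3) by (simp add: group_hom_def group_hom_axioms_def)
  show ?thesis
    using h.img_is_subgroup by (simp add: boundaries_def)
qed

text \<open>The group of cocycles, in which the boundaries form a normal subgroup. It differs from
  \<open>Grp X i\<close> in its carrier only, so a coset of boundaries is the same set in either
  group.\<close>

definition K :: "int \<Rightarrow> 'a monoid" where
  "K i = (Grp X i)\<lparr>carrier := cocycles X i\<rparr>"

lemma K_comm_group: "comm_group (K i)"
  unfolding K_def
proof (rule group.group_comm_groupI[OF subgroup.subgroup_is_group[OF cocycles_subgroup complexD(3)]])
  show "x \<otimes>\<^bsub>(Grp X i)\<lparr>carrier := cocycles X i\<rparr>\<^esub> y = y \<otimes>\<^bsub>(Grp X i)\<lparr>carrier := cocycles X i\<rparr>\<^esub> x"
    if "x \<in> carrier ((Grp X i)\<lparr>carrier := cocycles X i\<rparr>)"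
      "y \<in> carrier ((Grp X i)\<lparr>carrier := cocycles X i\<rparr>)" for x y
    using that comm_monoid.m_comm[OF comm_group.axioms(1)[OF complexD(2)[of i]], of x y]
    by (simp add: cocycles_def)
qed

lemma boundaries_subgroup_K: "subgroup (boundaries X i) (K i)"
  unfolding K_def
  by (rule group.subgroup_incl[OF complexD(3) boundaries_subgroup cocycles_subgroup boundaries_subset])

lemma boundaries_normal_K: "boundaries X i \<lhd> K i"
  by (rule comm_group.subgroup_imp_normal[OF K_comm_group boundaries_subgroup_K])

lemma homology_eq: "homology X i = K i Mod boundaries X i"
  by (simp add: homology_def K_def cocycles_def kernel_def)

lemma homology_class_eq: "homology_class X i z = boundaries X i #>\<^bsub>K i\<^esub> z"
  by (simp add: homology_class_def K_def)

lemma carrier_homology: "carrier (homology X i) = homology_class X i ` cocycles X i"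
  unfolding homology_eq carrier_FactGroup by (simp add: homology_class_eq[abs_def] K_def)

lemma homologyE:
  assumes "c \<in> carrier (homology X i)"
  obtains z where "z \<in> cocycles X i" "c = homology_class X i z"
  using assms by (auto simp: carrier_homology)

lemma homology_class_mult:
  "\<lbrakk>z \<in> cocycles X i; w \<in> cocycles X i\<rbrakk> \<Longrightarrow>
    homology_class X i z \<otimes>\<^bsub>homology X i\<^esub> homology_class X i w = homology_class X i (z \<otimes>\<^bsub>Grp X i\<^esub> w)"
  unfolding homology_eq homology_class_eq mult_FactGroup
  using normal.rcos_sum[OF boundaries_normal_K, of z i w] by (simp add: K_def)

lemma one_homology: "\<one>\<^bsub>homology X i\<^esub> = homology_class X i \<one>\<^bsub>Grp X i\<^esub>"
  unfolding homology_eq homology_class_def one_FactGroup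
  by (rule group.coset_mult_one[OF complexD(3), symmetric]) (rule subgroup.subset[OF boundaries_subgroup])

lemma homology_class_boundary: "b \<in> boundaries X i \<Longrightarrow> homology_class X i b = \<one>\<^bsub>homology X i\<^esub>"
  unfolding homology_eq homology_class_def one_FactGroup
  by (rule subgroup.rcos_const[OF boundaries_subgroup complexD(3)])

lemma comm_group_homology: "comm_group (homology X i)"
  unfolding homology_eq by (rule comm_group.abelian_FactGroup[OF K_comm_group boundaries_subgroup_K])

lemma group_homology: "group (homology X i)"
  by (rule comm_group.axioms(2)[OF comm_group_homology])

lemma finitely_generated_homology: "finitely_generated (homology X i)"
proof (rule finitely_generated_surj)
  show "group (K i)"
    by (rule comm_group.axioms(2)[OF K_comm_group])
  show "group (homology X i)"
    by (rule group_homology)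
  show "(\<lambda>z. boundaries X i #>\<^bsub>K i\<^esub> z) \<in> hom (K i) (homology X i)"
    unfolding homology_eq by (rule normal.r_coset_hom_Mod[OF boundaries_normal_K])
  show "(\<lambda>z. boundaries X i #>\<^bsub>K i\<^esub> z) ` carrier (K i) = carrier (homology X i)"
    unfolding homology_eq carrier_FactGroup ..
  show "finitely_generated (K i)"
    unfolding K_def by (rule finitely_generated_subgroup[OF complexD(2,4) cocycles_subgroup])
qed

lemma trivial_homology:
  assumes "cocycles X i \<subseteq> boundaries X i"
  shows "trivial_group (homology X i)"
proof -
  have "c = \<one>\<^bsub>homology X i\<^esub>" if c: "c \<in> carrier (homology X i)" for c
  proof -
    obtain z where z: "z \<in> cocycles X i" "c = homology_class X i z"
      using c by (rule homologyE)
    with assms have "z \<in> boundaries X i"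
      by blast
    then show ?thesis
      by (simp add: z(2) homology_class_boundary)
  qed
  then have "carrier (homology X i) = {\<one>\<^bsub>homology X i\<^esub>}"
    using monoid.one_closed[OF group.is_monoid[OF group_homology]] by blast
  then show ?thesis
    using group_homology by (simp add: trivial_group_def)
qed

lemma finite_homology_support: "finite {i. \<not> trivial_group (homology X i)}"
proof (rule finite_subset)
  have "trivial_group (homology X i)" if "trivial_group (Grp X i)" for i
  proof (rule trivial_homology)
    show "cocycles X i \<subseteq> boundaries X i"
      using that subgroup.one_closed[OF boundaries_subgroup, of i]
      by (auto simp: cocycles_def trivial_group_def)
  qed
  then show "{i. \<not> trivial_group (homology X i)} \<subseteq> {i. \<not> trivial_group (Grp X i)}"
    by blast
qed (rule complexD(8))

end

section \<open>Maps induced on homology\<close>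

lemma chain_hom_cocycles:
  assumes "bounded_free_complex X" "bounded_free_complex Y" and f: "f \<in> chain_hom X Y"
    and z: "z \<in> cocycles X i"
  shows "f i z \<in> cocycles Y i"
proof -
  have zc: "z \<in> carrier (Grp X i)" and dz: "diff X i z = \<one>\<^bsub>Grp X (i + 1)\<^esub>"
    using z by (simp_all add: cocycles_def)
  have "diff Y i (f i z) = f (i + 1) (diff X i z)"
    by (rule chain_homD(3)[OF f zc, symmetric])
  also have "\<dots> = \<one>\<^bsub>Grp Y (i + 1)\<^esub>"
    unfolding dz
    by (rule hom_group_one[OF chain_homD(1)[OF f] bounded_free_complexD(3)[OF assms(1)]
          bounded_free_complexD(3)[OF assms(2)]])
  finally show ?thesis
    using chain_homD(2)[OF f zc] by (simp add: cocycles_def)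
qed

lemma chain_hom_boundaries:
  assumes f: "f \<in> chain_hom X Y" and b: "b \<in> boundaries X i"
  shows "f i b \<in> boundaries Y i"
proof -
  obtain x where x: "x \<in> carrier (Grp X (i - 1))" "b = diff X (i - 1) x"
    using b by (auto simp: boundaries_def)
  have "f i b = diff Y (i - 1) (f (i - 1) x)"
    using chain_homD(3)[OF f x(1)] x(2) by simp
  then show ?thesis
    using chain_homD(2)[OF f x(1)] by (auto simp: boundaries_def)
qed

text \<open>The image under \<open>f i\<close> of a coset of boundaries may be smaller than a coset
  in \<open>Y\<close>; multiplication by \<open>boundaries Y i\<close> in
  \<open>homology_map\<close> fills it up to the full class of \<open>f i z\<close>.\<close>

lemma homology_map_class:
  assumes X: "bounded_free_complex X" and Y: "bounded_free_complex Y" and f: "f \<in> chain_hom X Y"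
    and z: "z \<in> cocycles X i"
  shows "homology_map X Y f i (homology_class X i z) = homology_class Y i (f i z)"
proof -
  interpret X: cochain_complex X using X by unfold_locales
  interpret Y: cochain_complex Y using Y by unfold_locales
  interpret GX: group "Grp X i" by (rule X.complexD(3))
  interpret GY: group "Grp Y i" by (rule Y.complexD(3))
  interpret BX: subgroup "boundaries X i" "Grp X i" by (rule X.boundaries_subgroup)
  interpret BY: subgroup "boundaries Y i" "Grp Y i" by (rule Y.boundaries_subgroup)
  have zc: "z \<in> carrier (Grp X i)"
    using z by (simp add: cocycles_def)
  have fzc: "f i z \<in> carrier (Grp Y i)"
    by (rule chain_homD(2)[OF f zc])
  have eq: "f i (b \<otimes>\<^bsub>Grp X i\<^esub> z) = f i b \<otimes>\<^bsub>Grp Y i\<^esub> f i z" if "b \<in> boundaries X i" for b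
    by (rule hom_group_mult[OF chain_homD(1)[OF f] BX.mem_carrier[OF that] zc])
  have "boundaries Y i <#>\<^bsub>Grp Y i\<^esub> (f i ` homology_class X i z) = homology_class Y i (f i z)"
  proof (intro equalityI subsetI)
    fix w assume "w \<in> boundaries Y i <#>\<^bsub>Grp Y i\<^esub> (f i ` homology_class X i z)"
    then obtain b b' where b: "b \<in> boundaries Y i" "b' \<in> boundaries X i"
      "w = b \<otimes>\<^bsub>Grp Y i\<^esub> (f i (b' \<otimes>\<^bsub>Grp X i\<^esub> z))"
      by (auto simp: set_mult_def homology_class_def r_coset_def)
    have b'': "f i b' \<in> boundaries Y i"
      by (rule chain_hom_boundaries[OF f b(2)])
    have "w = (b \<otimes>\<^bsub>Grp Y i\<^esub> f i b') \<otimes>\<^bsub>Grp Y i\<^esub> f i z"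
      using b b'' fzc by (simp add: eq GY.m_assoc)
    moreover have "b \<otimes>\<^bsub>Grp Y i\<^esub> f i b' \<in> boundaries Y i"
      using b(1) b'' by simp
    ultimately show "w \<in> homology_class Y i (f i z)"
      by (auto simp: homology_class_def r_coset_def)
  next
    fix w assume "w \<in> homology_class Y i (f i z)"
    then obtain b where b: "b \<in> boundaries Y i" "w = b \<otimes>\<^bsub>Grp Y i\<^esub> f i z"
      by (auto simp: homology_class_def r_coset_def)
    have "z \<in> homology_class X i z"
      unfolding homology_class_def by (rule GX.rcos_self[OF zc X.boundaries_subgroup])
    with b show "w \<in> boundaries Y i <#>\<^bsub>Grp Y i\<^esub> (f i ` homology_class X i z)"
      by (auto simp: set_mult_def)
  qed
  moreover have "homology_class X i z \<in> carrier (homology X i)"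
    using z by (simp add: X.carrier_homology)
  ultimately show ?thesis
    by (simp add: homology_map_def)
qed

lemma homology_map_hom_group:
  assumes X: "bounded_free_complex X" and Y: "bounded_free_complex Y" and f: "f \<in> chain_hom X Y"
  shows "homology_map X Y f i \<in> carrier (hom_group (homology X i) (homology Y i))"
proof -
  interpret X: cochain_complex X using X by unfold_locales
  interpret Y: cochain_complex Y using Y by unfold_locales
  have "homology_map X Y f i \<in> hom (homology X i) (homology Y i)"
  proof (rule homI)
    fix c assume "c \<in> carrier (homology X i)"
    then obtain z where z: "z \<in> cocycles X i" "c = homology_class X i z"
      by (rule X.homologyE)
    then show "homology_map X Y f i c \<in> carrier (homology Y i)"
      using chain_hom_cocycles[OF X Y f z(1)]
      by (simp add: homology_map_class[OF X Y f] Y.carrier_homology)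
    fix d assume "d \<in> carrier (homology X i)"
    then obtain w where w: "w \<in> cocycles X i" "d = homology_class X i w"
      by (rule X.homologyE)
    have c: "z \<in> carrier (Grp X i)" "w \<in> carrier (Grp X i)"
      using z(1) w(1) by (simp_all add: cocycles_def)
    show "homology_map X Y f i (c \<otimes>\<^bsub>homology X i\<^esub> d)
        = homology_map X Y f i c \<otimes>\<^bsub>homology Y i\<^esub> homology_map X Y f i d"
      unfolding z(2) w(2) X.homology_class_mult[OF z(1) w(1)]
        homology_map_class[OF X Y f subgroup.m_closed[OF X.cocycles_subgroup z(1) w(1)]]
        homology_map_class[OF X Y f z(1)] homology_map_class[OF X Y f w(1)]
        Y.homology_class_mult[OF chain_hom_cocycles[OF X Y f z(1)] chain_hom_cocycles[OF X Y f w(1)]]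
        hom_group_mult[OF chain_homD(1)[OF f] c] ..
  qed
  then show ?thesis
    by (simp add: hom_group_simps homology_map_def)
qed

lemma homology_map_ident:
  assumes X: "bounded_free_complex X"
  shows "homology_map X X (\<lambda>i. \<lambda>x\<in>carrier (Grp X i). x) i = (\<lambda>c\<in>carrier (homology X i). c)"
proof -
  interpret X: cochain_complex X using X by unfold_locales
  have id: "(\<lambda>i. \<lambda>x\<in>carrier (Grp X i). x) \<in> chain_hom X X"
    using preadditive_category.id_closed[OF preadditive_Cb, of X] X by simp
  show ?thesis
  proof (rule hom_group_eqI)
    show "homology_map X X (\<lambda>i. \<lambda>x\<in>carrier (Grp X i). x) i c = (\<lambda>c\<in>carrier (homology X i). c) c"
      if "c \<in> carrier (homology X i)" for c
      using X.homologyE[OF that] homology_map_class[OF X X id] that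
      by (metis (no_types, lifting) cocycles_def mem_Collect_eq restrict_apply')
  qed (rule homology_map_hom_group[OF X X id] ident_hom_group[OF X.group_homology])+
qed

lemma homology_map_compose:
  assumes X: "bounded_free_complex X" and Y: "bounded_free_complex Y" and Z: "bounded_free_complex Z"
    and f: "f \<in> chain_hom X Y" and g: "g \<in> chain_hom Y Z"
  shows "homology_map X Z (\<lambda>i. compose (carrier (Grp X i)) (g i) (f i)) i
    = compose (carrier (homology X i)) (homology_map Y Z g i) (homology_map X Y f i)"
proof (rule hom_group_eqI)
  interpret X: cochain_complex X using X by unfold_locales
  note gf = chain_hom_compose[OF X f g]
  show "homology_map X Z (\<lambda>i. compose (carrier (Grp X i)) (g i) (f i)) i
      \<in> carrier (hom_group (homology X i) (homology Z i))"
    by (rule homology_map_hom_group[OF X Z gf])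
  show "compose (carrier (homology X i)) (homology_map Y Z g i) (homology_map X Y f i)
      \<in> carrier (hom_group (homology X i) (homology Z i))"
    by (rule compose_hom_group[OF X.group_homology homology_map_hom_group[OF X Y f]
          homology_map_hom_group[OF Y Z g]])
  fix c assume c: "c \<in> carrier (homology X i)"
  then obtain z where z: "z \<in> cocycles X i" "c = homology_class X i z"
    by (rule X.homologyE)
  have "z \<in> carrier (Grp X i)"
    using z(1) by (simp add: cocycles_def)
  with c show "homology_map X Z (\<lambda>i. compose (carrier (Grp X i)) (g i) (f i)) i c
      = compose (carrier (homology X i)) (homology_map Y Z g i) (homology_map X Y f i) c"
    unfolding z(2) homology_map_class[OF X Z gf z(1)]
    by (simp add: compose_def homology_map_class[OF X Y f z(1)]
        homology_map_class[OF Y Z g chain_hom_cocycles[OF X Y f z(1)]])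
qed

lemma homology_map_mult:
  assumes X: "bounded_free_complex X" and Y: "bounded_free_complex Y"
    and f: "f \<in> chain_hom X Y" and g: "g \<in> chain_hom X Y" and c: "c \<in> carrier (homology X i)"
  shows "homology_map X Y (\<lambda>i. f i \<otimes>\<^bsub>hom_group (Grp X i) (Grp Y i)\<^esub> g i) i c
    = homology_map X Y f i c \<otimes>\<^bsub>homology Y i\<^esub> homology_map X Y g i c"
proof -
  interpret X: cochain_complex X using X by unfold_locales
  interpret Y: cochain_complex Y using Y by unfold_locales
  obtain z where z: "z \<in> cocycles X i" "c = homology_class X i z"
    using c by (rule X.homologyE)
  have "z \<in> carrier (Grp X i)"
    using z(1) by (simp add: cocycles_def)
  then show ?thesis
    unfolding z(2) homology_map_class[OF X Y chain_hom_mult[OF X Y f g] z(1)]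
      homology_map_class[OF X Y f z(1)] homology_map_class[OF X Y g z(1)]
      Y.homology_class_mult[OF chain_hom_cocycles[OF X Y f z(1)] chain_hom_cocycles[OF X Y g z(1)]]
    by (simp add: hom_group_simps)
qed

lemma homology_map_one:
  assumes X: "bounded_free_complex X" and Y: "bounded_free_complex Y" and c: "c \<in> carrier (homology X i)"
  shows "homology_map X Y (\<lambda>i. \<one>\<^bsub>hom_group (Grp X i) (Grp Y i)\<^esub>) i c = \<one>\<^bsub>homology Y i\<^esub>"
proof -
  interpret X: cochain_complex X using X by unfold_locales
  interpret Y: cochain_complex Y using Y by unfold_locales
  obtain z where z: "z \<in> cocycles X i" "c = homology_class X i z"
    using c by (rule X.homologyE)
  have "z \<in> carrier (Grp X i)"
    using z(1) by (simp add: cocycles_def)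
  then show ?thesis
    unfolding z(2) homology_map_class[OF X Y chain_hom_one[OF X Y] z(1)] Y.one_homology
    by (simp add: hom_group_simps)
qed

text \<open>The differential of a disc is plus or minus the identity between two copies of the
  integers, so a preimage of a cocycle can be written down componentwise.\<close>

lemma trivial_homology_discs: "cocycles (discs ks) i \<subseteq> boundaries (discs ks) i"
proof
  fix z assume z: "z \<in> cocycles (discs ks) i"
  then have zc: "z \<in> carrier (Grp (discs ks) i)" and dz: "diff (discs ks) i z = \<one>\<^bsub>Grp (discs ks) (i + 1)\<^esub>"
    by (simp_all add: cocycles_def)
  \<comment> \<open>A contraction applied to \<open>z\<close>: the components in the upper degree of
    their disc are moved to the lower degree, with the sign that the differential will
    cancel.\<close>
  define w where "w = (\<lambda>j\<in>{..<length ks}. if i + ks ! j = 1 then (if even (ks ! j) then z j else - z j) else 0)"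
  have w: "w \<in> carrier (Grp (discs ks) (i - 1))"
    by (auto simp: carrier_discs w_def)
  have z0: "z j = 0" if "j < length ks" "i + ks ! j \<noteq> 1" for j
  proof (cases "i + ks ! j = 0")
    \<comment> \<open>In the lower degree of a disc the differential is injective, so a cocycle has
      no component there.\<close>
    case True
    have "diff (discs ks) i z j = 0"
      using that(1) by (simp add: dz one_discs)
    with True that(1) show ?thesis
      by (simp add: diff_discs[OF zc] split: if_splits)
  next
    case False
    with zc that show ?thesis
      by (simp add: carrier_discs)
  qed
  have "z = diff (discs ks) (i - 1) w"
  proof (rule extensionalityI)
    show "z \<in> extensional {..<length ks}"
      using zc by (simp add: carrier_discs)
    fix j assume "j \<in> {..<length ks}"
    then have j: "j < length ks"
      by simp
    have "diff (discs ks) (i - 1) w j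
        = (if i + ks ! j = 1 then (if even (ks ! j) then w j else - w j) else 0)"
      using j by (auto simp: diff_discs[OF w])
    then show "z j = diff (discs ks) (i - 1) w j"
      using z0[OF j] j by (simp add: w_def)
  qed (simp add: diff_discs[OF w])
  with w show "z \<in> boundaries (discs ks) i"
    by (auto simp: boundaries_def)
qed

text \<open>A cocycle \<open>z\<close> equals \<open>\<psi> i (\<phi> i z)\<close>, where
  \<open>\<phi> i z\<close> is a boundary in a sum of discs, and chain maps preserve
  boundaries.\<close>

lemma trivial_homology_projective:
  assumes P: "projective_complex P"
  shows "trivial_group (homology P i)"
proof -
  have bP: "bounded_free_complex P"
    using P by (simp add: projective_complex_def)
  interpret P: cochain_complex P using bP by unfold_locales
  obtain ks where "isomorphic_complexes P (discs ks)"
    using P unfolding projective_complex_def isomorphic_discs by blast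
  from isomorphic_complexes_chain_hom[OF bP bounded_free_discs this]
  obtain \<phi> \<psi> where *: "\<phi> \<in> chain_hom P (discs ks)" "\<psi> \<in> chain_hom (discs ks) P"
    "\<And>i x. x \<in> carrier (Grp P i) \<Longrightarrow> \<psi> i (\<phi> i x) = x"
    by metis
  have "z \<in> boundaries P i" if z: "z \<in> cocycles P i" for z
  proof -
    have "\<phi> i z \<in> boundaries (discs ks) i"
      using chain_hom_cocycles[OF bP bounded_free_discs *(1) z] trivial_homology_discs by blast
    then have "\<psi> i (\<phi> i z) \<in> boundaries P i"
      by (rule chain_hom_boundaries[OF *(2)])
    then show ?thesis
      using z *(3) by (simp add: cocycles_def)
  qed
  then show ?thesis
    by (intro P.trivial_homology) blast
qed

lemma homology_map_factoring:
  fixes X Y :: "'a complex"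
  assumes X: "bounded_free_complex X" and Y: "bounded_free_complex Y"
    and f: "f \<in> factoring_maps Cb projective_complex X Y" and c: "c \<in> carrier (homology X i)"
  shows "homology_map X Y f i c = \<one>\<^bsub>homology Y i\<^esub>"
proof -
  obtain P :: "'a complex" and a b where P: "bounded_free_complex P" "projective_complex P" "a \<in> chain_hom X P"
    "b \<in> chain_hom P Y" "f = (\<lambda>i. compose (carrier (Grp X i)) (b i) (a i))"
    using f by (rule factoring_CbE)
  interpret P: cochain_complex P using P(1) by unfold_locales
  interpret Y: cochain_complex Y using Y by unfold_locales
  have "homology_map X P a i c = \<one>\<^bsub>homology P i\<^esub>"
    using hom_group_closed[OF homology_map_hom_group[OF X P(1,3)] c] trivial_homology_projective[OF P(2), of i]
    by (simp add: trivial_group_def)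
  then show ?thesis
    using c hom_group_one[OF homology_map_hom_group[OF P(1) Y P(4)] P.group_homology Y.group_homology]
    unfolding P(5) homology_map_compose[OF X P(1) Y P(3,4)] by (simp add: compose_def)
qed

text \<open>Equal cosets yield \<open>f = n + f'\<close> with \<open>n\<close> factoring through a
  projective complex. As the induced maps are additive and that of \<open>n\<close> is zero, the two
  maps agree on homology.\<close>

lemma homology_map_coset_eq:
  assumes inf: "infinite (UNIV :: 'a set)"
    and X: "bounded_free_complex (X :: 'a complex)" and Y: "bounded_free_complex Y"
    and f: "f \<in> chain_hom X Y" and f': "f' \<in> chain_hom X Y"
    and eq: "FMor P_C X Y f' = FMor P_C X Y f"
  shows "homology_map X Y f' i = homology_map X Y f i"
proof (rule hom_group_eqI)
  interpret ideal_quotient "Cb :: ('a complex, _) category" projective_complex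
    by (rule ideal_quotient_Cb[OF inf])
  interpret Y: cochain_complex Y using Y by unfold_locales
  have XY: "X \<in> Obj Cb" "Y \<in> Obj Cb"
    using X Y by simp_all
  have "coset X Y f' = coset X Y f"
    using eq by (simp add: P_C_def)
  moreover have "f \<in> carrier (Hom Cb X Y)" "f' \<in> carrier (Hom Cb X Y)"
    using f f' by simp_all
  ultimately obtain n where n: "n \<in> factoring_maps Cb projective_complex X Y"
    "f = n \<otimes>\<^bsub>Hom Cb X Y\<^esub> f'"
    unfolding coset_eq_iff[OF XY \<open>f' \<in> carrier (Hom Cb X Y)\<close> \<open>f \<in> carrier (Hom Cb X Y)\<close>] by blast
  have nc: "n \<in> chain_hom X Y"
    using factoring_closed[OF XY n(1)] by simp
  show "homology_map X Y f' i c = homology_map X Y f i c" if c: "c \<in> carrier (homology X i)" for c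
    using hom_group_closed[OF homology_map_hom_group[OF X Y f'] c]
    unfolding n(2) Cb_simps
    by (simp add: homology_map_mult[OF X Y nc f' c] homology_map_factoring[OF X Y n(1) c]
        group.is_monoid[OF Y.group_homology])
qed (rule homology_map_hom_group[OF X Y f] homology_map_hom_group[OF X Y f'])+

section \<open>Homology as a functor to families of groups\<close>

lemma H_C_simps [simp]:
  "FObj H_C = homology"
  "FMor H_C X Y f = homology_map X Y f"
  by (simp_all add: H_C_def)

lemma is_functor_H_C: "is_functor (Cb :: ('a complex, _) category) modZ_fam H_C"
proof (rule is_functorI)
  show "FObj H_C X \<in> Obj modZ_fam" if "X \<in> Obj Cb" for X :: "'a complex"
  proof -
    interpret cochain_complex X using that by unfold_locales simp
    show ?thesis
      by (simp add: modZ_fam_Obj_iff comm_group_homology finitely_generated_homology finite_homology_support)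
  qed
  show "FMor H_C X Y f \<in> carrier (Hom modZ_fam (FObj H_C X) (FObj H_C Y))"
    if "X \<in> Obj Cb" "Y \<in> Obj Cb" "f \<in> carrier (Hom Cb X Y)" for X Y :: "'a complex" and f
    unfolding modZ_fam_simps(1) using that by (simp add: homology_map_hom_group)
  show "FMor H_C X X (Idt Cb X) = Idt modZ_fam (FObj H_C X)" if "X \<in> Obj Cb" for X :: "'a complex"
    using that homology_map_ident[of X] by (intro ext) (simp only: H_C_simps modZ_fam_simps(3) Cb_simps)
  show "FMor H_C X Z (Comp Cb X Y Z g f)
      = Comp modZ_fam (FObj H_C X) (FObj H_C Y) (FObj H_C Z) (FMor H_C Y Z g) (FMor H_C X Y f)"
    if "X \<in> Obj Cb" "Y \<in> Obj Cb" "Z \<in> Obj Cb" "f \<in> carrier (Hom Cb X Y)" "g \<in> carrier (Hom Cb Y Z)"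
    for X Y Z :: "'a complex" and f g
    using that homology_map_compose[of X Y Z f g]
    by (intro ext) (simp only: H_C_simps modZ_fam_simps(4) Cb_simps)
qed (rule preadditive_Cb preadditive_modZ_fam)+


section \<open>The homology functor on the orbit category\<close>

text \<open>An odd shift composes the differential with inversion, which permutes the carrier of its
  source; the image is therefore unchanged.\<close>

lemma boundaries_shift_complex:
  assumes X: "bounded_free_complex X"
  shows "boundaries (shift_complex k X) i = boundaries X (i + k)"
proof -
  note gX = bounded_free_complexD(3)[OF X]
  have idx: "i - 1 + k = i + k - 1" "i + k - 1 + 1 = i + k"
    by simp_all
  have d: "diff (shift_complex k X) (i - 1) x
      = (if even k then diff X (i + k - 1) x else diff X (i + k - 1) (inv\<^bsub>Grp X (i + k - 1)\<^esub> x))"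
    if "x \<in> carrier (Grp X (i + k - 1))" for x
    using diff_shift_complex[of x X "i - 1" k] hom_group_inv[OF bounded_free_complexD(5)[OF X] gX gX that] that
    by (simp only: idx)
  have inv: "inv\<^bsub>Grp X (i + k - 1)\<^esub> x \<in> carrier (Grp X (i + k - 1))"
    "inv\<^bsub>Grp X (i + k - 1)\<^esub> (inv\<^bsub>Grp X (i + k - 1)\<^esub> x) = x"
    if "x \<in> carrier (Grp X (i + k - 1))" for x
    using that gX by (simp_all add: group.inv_inv)
  show ?thesis
  proof (cases "even k")
    case True
    then show ?thesis
      using d unfolding boundaries_def Grp_shift_complex idx by (intro image_cong) simp_all
  next
    case False
    have "diff (shift_complex k X) (i - 1) ` carrier (Grp X (i + k - 1))
       = (\<lambda>x. diff X (i + k - 1) (inv\<^bsub>Grp X (i + k - 1)\<^esub> x)) ` carrier (Grp X (i + k - 1))"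
      using False d by (intro image_cong) simp_all
    also have "\<dots> = diff X (i + k - 1) ` (\<lambda>x. inv\<^bsub>Grp X (i + k - 1)\<^esub> x) ` carrier (Grp X (i + k - 1))"
      by (simp only: image_image)
    also have "(\<lambda>x. inv\<^bsub>Grp X (i + k - 1)\<^esub> x) ` carrier (Grp X (i + k - 1)) = carrier (Grp X (i + k - 1))"
    proof
      show "carrier (Grp X (i + k - 1)) \<subseteq> (\<lambda>x. inv\<^bsub>Grp X (i + k - 1)\<^esub> x) ` carrier (Grp X (i + k - 1))"
        by (metis image_eqI inv subsetI)
    qed (use inv(1) in blast)
    finally show ?thesis
      unfolding boundaries_def Grp_shift_complex idx .
  qed
qed

lemma cocycles_shift_complex:
  assumes X: "bounded_free_complex X"
  shows "cocycles (shift_complex k X) i = cocycles X (i + k)"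
proof -
  have idx: "i + 1 + k = i + k + 1"
    by simp
  have "inv\<^bsub>Grp X (i + k + 1)\<^esub> diff X (i + k) x = \<one>\<^bsub>Grp X (i + k + 1)\<^esub> \<longleftrightarrow> diff X (i + k) x = \<one>\<^bsub>Grp X (i + k + 1)\<^esub>"
    if "x \<in> carrier (Grp X (i + k))" for x
    using group.inv_eq_1_iff[OF bounded_free_complexD(3)[OF X] bounded_free_complexD(6)[OF X that]] .
  then show ?thesis
    by (cases "even k") (simp_all add: cocycles_def diff_shift_complex idx cong: conj_cong)
qed

text \<open>The sets of cocycles and of boundaries coincide, so the groups are equal on the nose.
  For this reason the maps induced by components \<open>X \<rightarrow> Y[n - j]\<close> land in
  \<open>homology Y n\<close> itself and can be added up in \<open>H_1\<close>.\<close>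

lemma homology_shift_complex:
  assumes X: "bounded_free_complex X"
  shows "homology (shift_complex k X) i = homology X (i + k)"
proof -
  have "homology Z j = (Grp Z j)\<lparr>carrier := cocycles Z j\<rparr> Mod boundaries Z j" for Z :: "'a complex" and j
    by (simp add: homology_def kernel_def cocycles_def)
  then show ?thesis
    by (simp add: boundaries_shift_complex[OF X] cocycles_shift_complex[OF X])
qed

lemma homology_map_shift:
  assumes X: "bounded_free_complex X" and Y: "bounded_free_complex Y"
  shows "homology_map (shift_complex k X) (shift_complex k Y) (\<lambda>i. f (i + k)) i = homology_map X Y f (i + k)"
  by (simp add: homology_map_def homology_shift_complex[OF X] boundaries_shift_complex[OF Y])

section \<open>Total homology and the action of graded maps on it\<close>

abbreviation total_homology :: "'a complex \<Rightarrow> (int \<Rightarrow> 'a set) monoid" where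
  "total_homology X \<equiv> sum_group UNIV (homology X)"

lemma (in cochain_complex) total_homology_iff:
  "x \<in> carrier (total_homology X) \<longleftrightarrow> (\<forall>i. x i \<in> carrier (homology X i)) \<and>
    finite {i. x i \<noteq> \<one>\<^bsub>homology X i\<^esub>}"
  by (rule carrier_sum_group_UNIV[OF group_homology])

text \<open>The action of \<open>H_1\<close> before its restriction to the carrier. In this form,
  additivity in the graded map and additivity in the homology class can be treated alike.\<close>

definition total_map :: "'a complex \<Rightarrow> 'a complex \<Rightarrow> (int \<Rightarrow> int \<Rightarrow> 'a \<Rightarrow> 'a) \<Rightarrow> (int \<Rightarrow> 'a set) \<Rightarrow> int \<Rightarrow> 'a set"
where
  "total_map X Y f x n = gfinprod (homology Y n)
     (\<lambda>j. homology_map X (shift_complex (n - j) Y) (f (n - j)) j (x j)) UNIV"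

abbreviation graded_maps :: "'a complex \<Rightarrow> 'a complex \<Rightarrow> (int \<Rightarrow> int \<Rightarrow> 'a \<Rightarrow> 'a) monoid" where
  "graded_maps X Y \<equiv> sum_group UNIV (\<lambda>i. Hom Cb X (shift_complex i Y))"

lemma H_1_simps:
  "FObj H_1 X = total_homology X"
  "FMor H_1 X Y f = restrict (total_map X Y f) (carrier (total_homology X))"
  by (simp_all add: H_1_def total_map_def[abs_def])

context
  fixes X Y :: "'a complex"
  assumes X: "bounded_free_complex X" and Y: "bounded_free_complex Y"
begin

interpretation X: cochain_complex X using X by unfold_locales
interpretation Y: cochain_complex Y using Y by unfold_locales

lemma graded_maps_iff:
  "f \<in> carrier (graded_maps X Y) \<longleftrightarrow> (\<forall>i. f i \<in> chain_hom X (shift_complex i Y)) \<and>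
    finite {i. f i \<noteq> \<one>\<^bsub>Hom Cb X (shift_complex i Y)\<^esub>}"
proof -
  have "group (Hom Cb X (shift_complex i Y))" for i
    using preadditive_category.hom_is_group[OF preadditive_Cb, of X "shift_complex i Y"] X
      bounded_free_shift_complex[OF Y] by simp
  then show ?thesis
    by (simp only: carrier_sum_group_UNIV Cb_simps(2))
qed

lemma homology_map_to_shift:
  assumes "a \<in> chain_hom X (shift_complex k Y)"
  shows "homology_map X (shift_complex k Y) a j \<in> carrier (hom_group (homology X j) (homology Y (j + k)))"
  using homology_map_hom_group[OF X bounded_free_shift_complex[OF Y] assms]
  by (simp add: homology_shift_complex[OF Y])

lemma homology_map_to_shift':
  assumes "f \<in> carrier (graded_maps X Y)"
  shows "homology_map X (shift_complex (n - j) Y) (f (n - j)) j \<in> carrier (hom_group (homology X j) (homology Y n))"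
proof -
  have "f (n - j) \<in> chain_hom X (shift_complex (n - j) Y)"
    using assms by (simp add: graded_maps_iff)
  from homology_map_to_shift[OF this, of j] show ?thesis
    by simp
qed

lemma homology_map_one_shift:
  assumes "c \<in> carrier (homology X j)"
  shows "homology_map X (shift_complex (n - j) Y) \<one>\<^bsub>Hom Cb X (shift_complex (n - j) Y)\<^esub> j c = \<one>\<^bsub>homology Y n\<^esub>"
  using homology_map_one[OF X bounded_free_shift_complex[OF Y] assms, of "n - j"]
  unfolding Cb_simps(4) homology_shift_complex[OF Y] by simp

lemma homology_map_one_class:
  assumes "f \<in> carrier (graded_maps X Y)"
  shows "homology_map X (shift_complex (n - j) Y) (f (n - j)) j \<one>\<^bsub>homology X j\<^esub> = \<one>\<^bsub>homology Y n\<^esub>"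
  by (rule hom_group_one[OF homology_map_to_shift'[OF assms] X.group_homology Y.group_homology])

lemma finite_total_summands:
  assumes "f \<in> carrier (graded_maps X Y)" "x \<in> carrier (total_homology X)"
  shows "finite {j. homology_map X (shift_complex (n - j) Y) (f (n - j)) j (x j) \<noteq> \<one>\<^bsub>homology Y n\<^esub>}"
proof (rule finite_subset)
  show "{j. homology_map X (shift_complex (n - j) Y) (f (n - j)) j (x j) \<noteq> \<one>\<^bsub>homology Y n\<^esub>}
      \<subseteq> {j. x j \<noteq> \<one>\<^bsub>homology X j\<^esub>}"
    using homology_map_one_class[OF assms(1)] by auto
  show "finite {j. x j \<noteq> \<one>\<^bsub>homology X j\<^esub>}"
    using assms(2) by (simp add: X.total_homology_iff)
qed

lemma total_summand_closed:
  assumes "f \<in> carrier (graded_maps X Y)" "x \<in> carrier (total_homology X)"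
  shows "homology_map X (shift_complex (n - j) Y) (f (n - j)) j (x j) \<in> carrier (homology Y n)"
  using hom_group_closed[OF homology_map_to_shift'[OF assms(1)]] assms(2)
  by (simp add: X.total_homology_iff)

lemma total_map_closed:
  assumes f: "f \<in> carrier (graded_maps X Y)" and x: "x \<in> carrier (total_homology X)"
  shows "total_map X Y f x \<in> carrier (total_homology Y)"
proof -
  let ?F = "{i. f i \<noteq> \<one>\<^bsub>Hom Cb X (shift_complex i Y)\<^esub>}" and ?X = "{j. x j \<noteq> \<one>\<^bsub>homology X j\<^esub>}"
  have xc: "x j \<in> carrier (homology X j)" for j
    using x by (simp add: X.total_homology_iff)
  \<comment> \<open>Degrees add: a nonzero contribution to degree \<open>n\<close> comes from a
    nonzero \<open>f i\<close> and a nonzero \<open>x j\<close> with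
    \<open>i + j = n\<close>.\<close>
  have "{n. total_map X Y f x n \<noteq> \<one>\<^bsub>homology Y n\<^esub>} \<subseteq> (\<lambda>(i, j). i + j) ` (?F \<times> ?X)"
  proof (rule ccontr)
    assume "\<not> ?thesis"
    then obtain n where n: "total_map X Y f x n \<noteq> \<one>\<^bsub>homology Y n\<^esub>" "n \<notin> (\<lambda>(i, j). i + j) ` (?F \<times> ?X)"
      by blast
    have "homology_map X (shift_complex (n - j) Y) (f (n - j)) j (x j) = \<one>\<^bsub>homology Y n\<^esub>" for j
    proof -
      have "f (n - j) = \<one>\<^bsub>Hom Cb X (shift_complex (n - j) Y)\<^esub> \<or> x j = \<one>\<^bsub>homology X j\<^esub>"
      proof (rule ccontr)
        assume "\<not> ?thesis"
        then have "(n - j, j) \<in> ?F \<times> ?X"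
          by blast
        then have "n \<in> (\<lambda>(i, j). i + j) ` (?F \<times> ?X)"
          by (rule rev_image_eqI) simp
        with n(2) show False ..
      qed
      then show ?thesis
        using homology_map_one_shift[OF xc] homology_map_one_class[OF f] by metis
    qed
    then have "total_map X Y f x n = \<one>\<^bsub>homology Y n\<^esub>"
      unfolding total_map_def by (intro comm_group.gfinprod_one[OF Y.comm_group_homology])
    with n(1) show False ..
  qed
  moreover have "finite ?F" "finite ?X"
    using f x unfolding graded_maps_iff X.total_homology_iff by blast+
  ultimately have "finite {n. total_map X Y f x n \<noteq> \<one>\<^bsub>homology Y n\<^esub>}"
    by (meson finite_SigmaI finite_imageI finite_subset)
  moreover have "total_map X Y f x n \<in> carrier (homology Y n)" for n
    unfolding total_map_def
    by (intro comm_monoid.gfinprod_closed comm_group.axioms(1) Y.comm_group_homology funcsetI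
        total_summand_closed[OF f x])
  ultimately show ?thesis
    by (simp add: carrier_sum_group_UNIV[OF Y.group_homology])
qed

lemma total_map_hom:
  assumes f: "f \<in> carrier (graded_maps X Y)"
  shows "total_map X Y f \<in> hom (total_homology X) (total_homology Y)"
proof (rule homI)
  fix x y assume x: "x \<in> carrier (total_homology X)" and y: "y \<in> carrier (total_homology X)"
  have "total_map X Y f (x \<otimes>\<^bsub>total_homology X\<^esub> y) n
      = total_map X Y f x n \<otimes>\<^bsub>homology Y n\<^esub> total_map X Y f y n" for n
  proof -
    interpret N: comm_group "homology Y n" by (rule Y.comm_group_homology)
    \<comment> \<open>Homomorphisms from all summands into one abelian group induce a homomorphism
      on the direct sum.\<close>
    have "(\<lambda>x. gfinprod (homology Y n) (\<lambda>j. homology_map X (shift_complex (n - j) Y) (f (n - j)) j (x j)) UNIV)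
        \<in> hom (total_homology X) (homology Y n)"
      using homology_map_to_shift'[OF f] X.group_homology
      by (intro N.hom_group_sum) (simp_all add: hom_group_simps)
    from hom_mult[OF this x y] show ?thesis
      by (simp only: total_map_def)
  qed
  then show "total_map X Y f (x \<otimes>\<^bsub>total_homology X\<^esub> y)
      = total_map X Y f x \<otimes>\<^bsub>total_homology Y\<^esub> total_map X Y f y"
    unfolding mult_sum_group[of UNIV "homology Y"] restrict_UNIV by (rule ext)
qed (rule total_map_closed[OF f])

lemma total_map_hom_left:
  assumes x: "x \<in> carrier (total_homology X)"
  shows "(\<lambda>f. total_map X Y f x) \<in> hom (graded_maps X Y) (total_homology Y)"
proof (rule homI)
  fix f g assume f: "f \<in> carrier (graded_maps X Y)" and g: "g \<in> carrier (graded_maps X Y)"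
  have xc: "x j \<in> carrier (homology X j)" for j
    using x by (simp add: X.total_homology_iff)
  have "total_map X Y (f \<otimes>\<^bsub>graded_maps X Y\<^esub> g) x n
      = total_map X Y f x n \<otimes>\<^bsub>homology Y n\<^esub> total_map X Y g x n" for n
  proof -
    interpret N: comm_group "homology Y n" by (rule Y.comm_group_homology)
    have "homology_map X (shift_complex (n - j) Y) ((f \<otimes>\<^bsub>graded_maps X Y\<^esub> g) (n - j)) j (x j)
       = homology_map X (shift_complex (n - j) Y) (f (n - j)) j (x j) \<otimes>\<^bsub>homology Y n\<^esub>
         homology_map X (shift_complex (n - j) Y) (g (n - j)) j (x j)" for j
    proof -
      have "f (n - j) \<in> chain_hom X (shift_complex (n - j) Y)" "g (n - j) \<in> chain_hom X (shift_complex (n - j) Y)"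
        using f g unfolding graded_maps_iff by blast+
      from homology_map_mult[OF X bounded_free_shift_complex[OF Y] this xc] show ?thesis
        by (simp add: homology_shift_complex[OF Y])
    qed
    then show ?thesis
      using N.gfinprod_distrib[OF _ _ funcsetI funcsetI, of UNIV
          "\<lambda>j. homology_map X (shift_complex (n - j) Y) (f (n - j)) j (x j)"
          "\<lambda>j. homology_map X (shift_complex (n - j) Y) (g (n - j)) j (x j)"]
        finite_total_summands[OF f x] finite_total_summands[OF g x]
        total_summand_closed[OF f x] total_summand_closed[OF g x]
      by (simp add: total_map_def del: mult_sum_group)
  qed
  then show "total_map X Y (f \<otimes>\<^bsub>graded_maps X Y\<^esub> g) x
      = total_map X Y f x \<otimes>\<^bsub>total_homology Y\<^esub> total_map X Y g x"
    unfolding mult_sum_group[of UNIV "homology Y"] restrict_UNIV by (rule ext)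
qed (rule total_map_closed[OF _ x])

text \<open>Only the component of the class in degree \<open>m\<close> can be nonzero. Its
  contribution to degree \<open>n\<close> comes from the component of the map with index
  \<open>n - m\<close>, which vanishes unless \<open>n = m + k\<close>.\<close>

lemma total_map_homogeneous:
  assumes a: "a \<in> chain_hom X (shift_complex k Y)" and c: "c \<in> carrier (homology X m)"
  shows "total_map X Y (homogeneous (\<lambda>i. Hom Cb X (shift_complex i Y)) k a) (homogeneous (homology X) m c)
    = homogeneous (homology Y) (m + k) (homology_map X (shift_complex k Y) a m c)"
proof
  fix n
  interpret N: comm_group "homology Y n" by (rule Y.comm_group_homology)
  let ?f = "homogeneous (\<lambda>i. Hom Cb X (shift_complex i Y)) k a"
  let ?x = "homogeneous (homology X) m c"
  let ?s = "\<lambda>j. homology_map X (shift_complex (n - j) Y) (?f (n - j)) j (?x j)"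
  have "group (Hom Cb X (shift_complex i Y))" for i
    using preadditive_category.hom_is_group[OF preadditive_Cb, of X "shift_complex i Y"] X
      bounded_free_shift_complex[OF Y] by simp
  then have f: "?f \<in> carrier (graded_maps X Y)"
    using a by (intro homogeneous_closed) simp_all
  have x: "?x \<in> carrier (total_homology X)"
    using c X.group_homology by (intro homogeneous_closed)
  have "?s j = \<one>\<^bsub>homology Y n\<^esub>" if "j \<noteq> m" for j
    using that homology_map_one_class[OF f, of n j] by (simp add: homogeneous_def)
  then have "total_map X Y ?f ?x n = ?s m"
    unfolding total_map_def using total_summand_closed[OF f x] by (intro N.gfinprod_eq_single)
  also have "\<dots> = homogeneous (homology Y) (m + k) (homology_map X (shift_complex k Y) a m c) n"
    using homology_map_one_shift[OF c, of n] by (auto simp: homogeneous_def)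
  finally show "total_map X Y ?f ?x n
      = homogeneous (homology Y) (m + k) (homology_map X (shift_complex k Y) a m c) n" .
qed

end

text \<open>The identity of the orbit category is homogeneous of degree zero, and
  \<open>X[0] = X\<close>, so on homogeneous classes it acts as an ordinary identity map does on
  homology.\<close>

lemma total_map_ident:
  assumes X: "bounded_free_complex X" and x: "x \<in> carrier (total_homology X)"
  shows "total_map X X (Idt (orbit_category Cb shift) X) x = x"
proof -
  interpret C: strict_shift Cb shift by (rule strict_shift_Cb)
  interpret X: cochain_complex X using X by unfold_locales
  have idt: "Idt (orbit_category Cb shift) X = homogeneous (\<lambda>i. Hom Cb X (shift_complex i X)) 0 (Idt Cb X)"
    using C.orbit_category_simps(3)[of X] unfolding shift_simps(1) .
  have idc: "Idt Cb X \<in> chain_hom X (shift_complex 0 X)"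
    using C.id_closed[of X] X by (simp add: shift_complex_0)
  have idf: "Idt (orbit_category Cb shift) X \<in> carrier (graded_maps X X)"
    using preadditive_category.id_closed[OF C.preadditive_orbit, of X] X
    unfolding C.orbit_category_simps(1,2) shift_simps(1) by simp
  show ?thesis
  proof (rule hom_eq_if_homogeneous_eq[OF X.group_homology x, where \<psi> = "\<lambda>x. x" and H = "total_homology X"])
    show "total_map X X (Idt (orbit_category Cb shift) X) \<in> hom (total_homology X) (total_homology X)"
      by (rule total_map_hom[OF X X idf])
    show "total_map X X (Idt (orbit_category Cb shift) X) (homogeneous (homology X) i a) = homogeneous (homology X) i a"
      if "a \<in> carrier (homology X i)" for i a
      unfolding idt total_map_homogeneous[OF X X idc that]
      using that homology_map_ident[OF X, of i] by (simp add: shift_complex_0[OF X])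
  qed (rule ident_hom)
qed


text \<open>The composite is homogeneous of degree \<open>i + j\<close>, represented by
  \<open>b[i] \<circ> a\<close>. The claim is functoriality of homology for this composite, together
  with the fact that \<open>b[i]\<close> acts in degree \<open>m\<close> as \<open>b\<close> does in
  degree \<open>m + i\<close>.\<close>

lemma total_map_comp_homogeneous:
  assumes X: "bounded_free_complex X" and Y: "bounded_free_complex Y" and Z: "bounded_free_complex Z"
    and a: "a \<in> chain_hom X (shift_complex i Y)" and b: "b \<in> chain_hom Y (shift_complex j Z)"
    and c: "c \<in> carrier (homology X m)"
  shows "total_map X Z (Comp (orbit_category Cb shift) X Y Z
      (homogeneous (\<lambda>i. Hom Cb Y (shift_complex i Z)) j b) (homogeneous (\<lambda>i. Hom Cb X (shift_complex i Y)) i a))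
      (homogeneous (homology X) m c)
    = total_map Y Z (homogeneous (\<lambda>i. Hom Cb Y (shift_complex i Z)) j b)
       (total_map X Y (homogeneous (\<lambda>i. Hom Cb X (shift_complex i Y)) i a) (homogeneous (homology X) m c))"
proof -
  interpret C: strict_shift Cb shift by (rule strict_shift_Cb)
  have b': "(\<lambda>n. b (n + i)) \<in> chain_hom (shift_complex i Y) (shift_complex (i + j) Z)"
    using chain_hom_shift[OF Y bounded_free_shift_complex[OF Z] b, of i]
    by (simp add: shift_complex_shift_complex[OF Z])
  note sY = bounded_free_shift_complex[OF Y] and sZ = bounded_free_shift_complex[OF Z]
  let ?s = "\<lambda>n. compose (carrier (Grp X n)) (b (n + i)) (a n)"
  have s: "?s \<in> chain_hom X (shift_complex (i + j) Z)"
    by (rule chain_hom_compose[OF X a b'])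
  have comp: "Comp (orbit_category Cb shift) X Y Z
      (homogeneous (\<lambda>i. Hom Cb Y (shift_complex i Z)) j b) (homogeneous (\<lambda>i. Hom Cb X (shift_complex i Y)) i a)
      = homogeneous (\<lambda>i. Hom Cb X (shift_complex i Z)) (i + j) ?s"
    using C.comp_orbit_homogeneous[of X Y Z a i b j] X Y Z a b by (simp add: C.summand_def)
  have hm: "homology_map X (shift_complex i Y) a m c \<in> carrier (homology Y (m + i))"
    by (rule hom_group_closed[OF homology_map_to_shift[OF X Y a] c])
  have "homology_map X (shift_complex (i + j) Z) ?s m c
      = homology_map (shift_complex i Y) (shift_complex (i + j) Z) (\<lambda>n. b (n + i)) m
          (homology_map X (shift_complex i Y) a m c)"
    unfolding homology_map_compose[OF X sY sZ a b'] using c by (simp add: compose_def)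
  also have "\<dots> = homology_map Y (shift_complex j Z) b (m + i) (homology_map X (shift_complex i Y) a m c)"
    using homology_map_shift[OF Y sZ[of j], of i b m] by (simp add: shift_complex_shift_complex[OF Z])
  finally show ?thesis
    unfolding comp total_map_homogeneous[OF X Z s c] total_map_homogeneous[OF X Y a c]
      total_map_homogeneous[OF Y Z b hm]
    by (simp add: add.assoc)
qed

text \<open>Both sides are additive in the class and in each of the two maps. Starting from
  homogeneous arguments in all three places, \<open>1\<close> frees \<open>x\<close>,
  \<open>2\<close> frees \<open>f\<close>, and the conclusion frees \<open>g\<close>.\<close>

lemma total_map_comp:
  assumes X: "bounded_free_complex X" and Y: "bounded_free_complex Y" and Z: "bounded_free_complex Z"
    and f: "f \<in> carrier (graded_maps X Y)" and g: "g \<in> carrier (graded_maps Y Z)"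
    and x: "x \<in> carrier (total_homology X)"
  shows "total_map X Z (Comp (orbit_category Cb shift) X Y Z g f) x = total_map Y Z g (total_map X Y f x)"
proof -
  interpret C: strict_shift Cb shift by (rule strict_shift_Cb)
  interpret X: cochain_complex X using X by unfold_locales
  let ?c = "Comp (orbit_category Cb shift) X Y Z"
  let ?hf = "homogeneous (\<lambda>i. Hom Cb X (shift_complex i Y))"
  let ?hg = "homogeneous (\<lambda>i. Hom Cb Y (shift_complex i Z))"
  let ?hx = "homogeneous (homology X)"
  have O: "X \<in> Obj Cb" "Y \<in> Obj Cb" "Z \<in> Obj Cb"
    using X Y Z by simp_all
  have cleft: "(\<lambda>g. ?c g f) \<in> hom (graded_maps Y Z) (graded_maps X Z)" if "f \<in> carrier (graded_maps X Y)" for f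
    using C.comp_orbit_hom_left[OF O, of f] that by simp
  have cright: "?c g \<in> hom (graded_maps X Y) (graded_maps X Z)" if "g \<in> carrier (graded_maps Y Z)" for g
    using C.comp_orbit_hom_right[OF O, of g] that by simp
  have grpf: "group (Hom Cb X (shift_complex i Y))" and grpg: "group (Hom Cb Y (shift_complex i Z))" for i
    using C.G_group[OF O(1,2), of i] C.G_group[OF O(2,3), of i] by simp_all
  have hfc: "?hf i a \<in> carrier (graded_maps X Y)" if "a \<in> carrier (Hom Cb X (shift_complex i Y))" for i a
    by (rule homogeneous_closed[of "\<lambda>i. Hom Cb X (shift_complex i Y)", OF grpf that])
  have hgc: "?hg i a \<in> carrier (graded_maps Y Z)" if "a \<in> carrier (Hom Cb Y (shift_complex i Z))" for i a
    by (rule homogeneous_closed[of "\<lambda>i. Hom Cb Y (shift_complex i Z)", OF grpg that])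
  have cc: "?c g f \<in> carrier (graded_maps X Z)"
    if "g \<in> carrier (graded_maps Y Z)" "f \<in> carrier (graded_maps X Y)" for g f
    by (rule hom_in_carrier[OF cright[OF that(1)] that(2)])
  have hom_x: "total_map X Z (?c g f) \<in> hom (total_homology X) (total_homology Z)"
    "(\<lambda>x. total_map Y Z g (total_map X Y f x)) \<in> hom (total_homology X) (total_homology Z)"
    if g: "g \<in> carrier (graded_maps Y Z)" and f: "f \<in> carrier (graded_maps X Y)" for f g
  proof -
    show "total_map X Z (?c g f) \<in> hom (total_homology X) (total_homology Z)"
      by (rule total_map_hom[OF X Z cc[OF g f]])
    have "total_map Y Z g \<circ> total_map X Y f \<in> hom (total_homology X) (total_homology Z)"
      by (rule hom_compose[OF total_map_hom[OF X Y f] total_map_hom[OF Y Z g]])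
    then show "(\<lambda>x. total_map Y Z g (total_map X Y f x)) \<in> hom (total_homology X) (total_homology Z)"
      by (simp only: comp_def)
  qed
  have 1: "total_map X Z (?c (?hg j b) (?hf i a)) x = total_map Y Z (?hg j b) (total_map X Y (?hf i a) x)"
    if a: "a \<in> carrier (Hom Cb X (shift_complex i Y))" and b: "b \<in> carrier (Hom Cb Y (shift_complex j Z))"
    for i a j b
    by (rule hom_eq_if_homogeneous_eq[OF X.group_homology x hom_x[OF hgc[OF b] hfc[OF a]]])
      (rule total_map_comp_homogeneous[OF X Y Z a[unfolded Cb_simps] b[unfolded Cb_simps]])
  have 2: "total_map X Z (?c (?hg j b) f) x = total_map Y Z (?hg j b) (total_map X Y f x)"
    if b: "b \<in> carrier (Hom Cb Y (shift_complex j Z))" for j b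
  proof (rule hom_eq_if_homogeneous_eq[OF grpf f, where H = "total_homology Z"])
    have "(\<lambda>f. total_map X Z f x) \<circ> ?c (?hg j b) \<in> hom (graded_maps X Y) (total_homology Z)"
      by (rule hom_compose[OF cright[OF hgc[OF b]] total_map_hom_left[OF X Z x]])
    then show "(\<lambda>f. total_map X Z (?c (?hg j b) f) x) \<in> hom (graded_maps X Y) (total_homology Z)"
      by (simp only: comp_def)
    have "total_map Y Z (?hg j b) \<circ> (\<lambda>f. total_map X Y f x) \<in> hom (graded_maps X Y) (total_homology Z)"
      by (rule hom_compose[OF total_map_hom_left[OF X Y x] total_map_hom[OF Y Z hgc[OF b]]])
    then show "(\<lambda>f. total_map Y Z (?hg j b) (total_map X Y f x)) \<in> hom (graded_maps X Y) (total_homology Z)"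
      by (simp only: comp_def)
  qed (rule 1[OF _ b])
  show ?thesis
  proof (rule hom_eq_if_homogeneous_eq[OF grpg g, where H = "total_homology Z"])
    have "(\<lambda>g. total_map X Z g x) \<circ> (\<lambda>g. ?c g f) \<in> hom (graded_maps Y Z) (total_homology Z)"
      by (rule hom_compose[OF cleft[OF f] total_map_hom_left[OF X Z x]])
    then show "(\<lambda>g. total_map X Z (?c g f) x) \<in> hom (graded_maps Y Z) (total_homology Z)"
      by (simp only: comp_def)
    show "(\<lambda>g. total_map Y Z g (total_map X Y f x)) \<in> hom (graded_maps Y Z) (total_homology Z)"
      by (rule total_map_hom_left[OF Y Z total_map_closed[OF X Y f x]])
  qed (rule 2)
qed

section \<open>Functoriality of total homology on the orbit category\<close>

lemma Cb_1_simps: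
  fixes X Y :: "'a complex"
  shows "X \<in> Obj Cb_1 \<longleftrightarrow> bounded_free_complex X"
  "Hom Cb_1 X Y = graded_maps X Y"
  using strict_shift.orbit_category_simps(1,2)[OF strict_shift_Cb[where 'a = 'a]] by (simp_all add: Cb_1_def)

lemma preadditive_Cb_1: "preadditive_category Cb_1"
  unfolding Cb_1_def by (rule strict_shift.preadditive_orbit[OF strict_shift_Cb])

lemma is_functor_H_1: "is_functor (Cb_1 :: ('a complex, _) category) modZ H_1"
proof (rule is_functorI)
  fix X Y Z :: "'a complex" and f g
  assume "X \<in> Obj Cb_1"
  then have X: "bounded_free_complex X"
    by (simp add: Cb_1_simps)
  interpret X: cochain_complex X using X by unfold_locales
  have gX: "group (total_homology X)"
    by (rule sum_group) (rule X.group_homology)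
  show "FObj H_1 X \<in> Obj modZ"
    unfolding H_1_simps(1) modZ_simps
    by (intro conjI comm_group_sum_group finitely_generated_sum_group X.comm_group_homology
        X.group_homology X.finitely_generated_homology X.finite_homology_support)
  show "FMor H_1 X X (Idt Cb_1 X) = Idt modZ (FObj H_1 X)"
    unfolding H_1_simps modZ_simps Cb_1_def by (rule restrict_ext) (rule total_map_ident[OF X])
  assume "Y \<in> Obj Cb_1" "f \<in> carrier (Hom Cb_1 X Y)"
  then have Y: "bounded_free_complex Y" and f: "f \<in> carrier (graded_maps X Y)"
    by (simp_all only: Cb_1_simps)
  show "FMor H_1 X Y f \<in> carrier (Hom modZ (FObj H_1 X) (FObj H_1 Y))"
    unfolding H_1_simps modZ_simps by (rule restrict_hom_group[OF gX total_map_hom[OF X Y f]])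
  assume "Z \<in> Obj Cb_1" "g \<in> carrier (Hom Cb_1 Y Z)"
  then have Z: "bounded_free_complex Z" and g: "g \<in> carrier (graded_maps Y Z)"
    by (simp_all only: Cb_1_simps)
  show "FMor H_1 X Z (Comp Cb_1 X Y Z g f)
      = Comp modZ (FObj H_1 X) (FObj H_1 Y) (FObj H_1 Z) (FMor H_1 Y Z g) (FMor H_1 X Y f)"
    unfolding H_1_simps modZ_simps Cb_1_def compose_def
    using total_map_comp[OF X Y Z f g] total_map_closed[OF X Y f] by (intro restrict_ext) simp
qed (rule preadditive_Cb_1 preadditive_modZ)+

text \<open>\<open>P_1\<close> applies \<open>P_C\<close> to each component, so the hypothesis is an
  equality of cosets in every degree, to which the result on single chain maps applies.\<close>

lemma total_map_coset_eq:
  assumes inf: "infinite (UNIV :: 'a set)"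
    and X: "bounded_free_complex (X :: 'a complex)" and Y: "bounded_free_complex Y"
    and f: "f \<in> carrier (graded_maps X Y)" and f': "f' \<in> carrier (graded_maps X Y)"
    and eq: "FMor P_1 X Y f' = FMor P_1 X Y f"
  shows "total_map X Y f' = total_map X Y f"
proof -
  have "homology_map X (shift_complex i Y) (f' i) j = homology_map X (shift_complex i Y) (f i) j" for i j
  proof (rule homology_map_coset_eq[OF inf X bounded_free_shift_complex[OF Y]])
    show "FMor P_C X (shift_complex i Y) (f' i) = FMor P_C X (shift_complex i Y) (f i)"
      using fun_cong[OF eq, of i] by (simp add: P_1_def)
    show "f i \<in> chain_hom X (shift_complex i Y)" "f' i \<in> chain_hom X (shift_complex i Y)"
      using f f' unfolding graded_maps_iff[OF X Y] by blast+
  qed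
  then show ?thesis
    by (intro ext) (simp only: total_map_def)
qed

text \<open>For a map of degree zero only \<open>j = n\<close> contributes to degree
  \<open>n\<close>, so the sum over \<open>j\<close> collapses to the componentwise map used by
  \<open>S_H\<close>.\<close>

lemma homology_map_direct_sum:
  assumes X: "bounded_free_complex X" and Y: "bounded_free_complex Y" and f: "f \<in> chain_hom X Y"
    and x: "x \<in> carrier (total_homology X)"
  shows "total_map X Y (homogeneous (\<lambda>i. Hom Cb X (shift_complex i Y)) 0 f) x = (\<lambda>n. homology_map X Y f n (x n))"
proof
  fix n
  interpret C: strict_shift Cb shift by (rule strict_shift_Cb)
  interpret X: cochain_complex X using X by unfold_locales
  interpret Y: cochain_complex Y using Y by unfold_locales
  interpret N: comm_group "homology Y n" by (rule Y.comm_group_homology)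
  let ?f = "homogeneous (\<lambda>i. Hom Cb X (shift_complex i Y)) 0 f"
  let ?s = "\<lambda>j. homology_map X (shift_complex (n - j) Y) (?f (n - j)) j (x j)"
  have f': "?f \<in> carrier (graded_maps X Y)"
    using C.G_group[of X Y] X Y f by (intro homogeneous_closed) (simp_all add: shift_complex_0)
  have xc: "x j \<in> carrier (homology X j)" for j
    using x by (simp add: X.total_homology_iff)
  have "?s j = \<one>\<^bsub>homology Y n\<^esub>" if "j \<noteq> n" for j
    using that homology_map_one_shift[OF X Y xc, of n j] by (simp add: homogeneous_def)
  then have "total_map X Y ?f x n = ?s n"
    unfolding total_map_def using total_summand_closed[OF X Y f' x] by (intro N.gfinprod_eq_single)
  then show "total_map X Y ?f x n = homology_map X Y f n (x n)"
    by (simp add: homogeneous_def shift_complex_0[OF Y])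
qed

section \<open>Edges and faces of the cube\<close>

lemma Cb_P_simps: "Obj Cb_P = Obj Cb" "Obj Cb_P1 = Obj Cb" "Obj Cb_1 = Obj Cb"
  by (simp_all add: Cb_P_def Cb_P1_def Cb_1_def orbit_category_def)

lemma FObj_P_simps: "FObj P_C X = X" "FObj P_1 X = X" "FObj S_C X = X" "FObj S_P X = X"
  by (simp_all add: P_C_def P_1_def S_C_def S_P_def orbit_projection_def)

context
  assumes inf: "infinite (UNIV :: 'a set)"
begin

interpretation S: shift_ideal "Cb :: ('a complex, _) category" shift projective_complex
  by (rule shift_ideal_Cb[OF inf])

text \<open>Identifies the shift of \<open>Cb_P\<close> with the one constructed for an arbitrary
  shift-stable ideal, so that the general results apply to \<open>Cb_P\<close> and
  \<open>Cb_P1\<close>.\<close>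

lemma shift_P_eq: "(shift_P :: int \<Rightarrow> ('a complex, _, _, _) functor_data) = S.shift_quotient"
  by (rule ext) (simp add: shift_P_def S.shift_quotient_def P_C_def)

lemma strict_shift_Cb_P: "strict_shift (Cb_P :: ('a complex, _) category) shift_P"
  using S.strict_shift_quotient by (simp add: Cb_P_def shift_P_eq)

lemma is_functor_S_C: "is_functor (Cb :: ('a complex, _) category) Cb_1 S_C"
  unfolding Cb_1_def S_C_def by (rule S.is_functor_orbit_projection)

lemma is_functor_S_P: "is_functor (Cb_P :: ('a complex, _) category) Cb_P1 S_P"
  unfolding Cb_P1_def S_P_def by (rule strict_shift.is_functor_orbit_projection[OF strict_shift_Cb_P])

lemma is_functor_P_C: "is_functor (Cb :: ('a complex, _) category) Cb_P P_C"
  unfolding Cb_P_def P_C_def by (rule additive_functorD(1)[OF S.additive_quotient_functor])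

lemma is_functor_P_1: "is_functor (Cb_1 :: ('a complex, _) category) Cb_P1 P_1"
  unfolding Cb_1_def Cb_P1_def P_1_def shift_P_eq
  using S.is_functor_orbit_quotient by (simp only: P_C_def Cb_P_def)

lemma P_C_full:
  fixes X Y :: "'a complex"
  assumes "g \<in> carrier (Hom Cb_P X Y)"
  shows "\<exists>f\<in>carrier (Hom Cb X Y). FMor P_C X Y f = g"
  using assms S.coset_carrierE unfolding Cb_P_def P_C_def quotient_category_simps quotient_functor_simps
  by metis

lemma is_functor_descend_H_C: "is_functor (Cb_P :: ('a complex, _) category) modZ_fam (descend Cb P_C H_C)"
proof (rule is_functor_descend[OF is_functor_H_C is_functor_P_C Cb_P_simps(1) FObj_P_simps(1) P_C_full])
  show "FMor H_C X Y f' = FMor H_C X Y f"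
    if "X \<in> Obj Cb" "Y \<in> Obj Cb" "f \<in> carrier (Hom Cb X Y)" "f' \<in> carrier (Hom Cb X Y)"
      "FMor P_C X Y f' = FMor P_C X Y f" for X Y :: "'a complex" and f f'
    using homology_map_coset_eq[OF inf, of X Y f f'] that by (simp add: fun_eq_iff)
qed

lemma FMor_descend_H_C:
  fixes X Y :: "'a complex"
  assumes "X \<in> Obj Cb" "Y \<in> Obj Cb" "f \<in> carrier (Hom Cb X Y)"
  shows "FMor (descend Cb P_C H_C) X Y (FMor P_C X Y f) = FMor H_C X Y f"
proof (rule FMor_descend[OF assms(3)])
  show "FMor H_C X Y f' = FMor H_C X Y f"
    if "f' \<in> carrier (Hom Cb X Y)" "FMor P_C X Y f' = FMor P_C X Y f" for f'
    using homology_map_coset_eq[OF inf, of X Y f f'] assms that by (simp add: fun_eq_iff)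
qed

lemma H_1_const:
  fixes X Y :: "'a complex"
  assumes "X \<in> Obj Cb_1" "Y \<in> Obj Cb_1" "f \<in> carrier (Hom Cb_1 X Y)" "f' \<in> carrier (Hom Cb_1 X Y)"
    "FMor P_1 X Y f' = FMor P_1 X Y f"
  shows "FMor H_1 X Y f' = FMor H_1 X Y f"
  unfolding H_1_simps(2)
  using total_map_coset_eq[OF inf _ _ _ _ assms(5)] assms(1-4) unfolding Cb_1_simps by simp

lemma is_functor_descend_H_1: "is_functor (Cb_P1 :: ('a complex, _) category) modZ (descend Cb_1 P_1 H_1)"
proof (rule is_functor_descend[OF is_functor_H_1 is_functor_P_1])
  show "Obj Cb_P1 = Obj Cb_1"
    by (simp add: Cb_P_simps)
  show "\<exists>f\<in>carrier (Hom Cb_1 X Y). FMor P_1 X Y f = g"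
    if "X \<in> Obj Cb_1" "Y \<in> Obj Cb_1" "g \<in> carrier (Hom Cb_P1 X Y)" for X Y :: "'a complex" and g
    using S.orbit_functor_full[of X Y g] that
    unfolding Cb_P1_def Cb_1_def P_1_def shift_P_eq Cb_P_def P_C_def S.orbit_category_simps(1,2) .
  show "FMor H_1 X Y f' = FMor H_1 X Y f"
    if "X \<in> Obj Cb_1" "Y \<in> Obj Cb_1" "f \<in> carrier (Hom Cb_1 X Y)" "f' \<in> carrier (Hom Cb_1 X Y)"
      "FMor P_1 X Y f' = FMor P_1 X Y f" for X Y :: "'a complex" and f f'
    by (rule H_1_const[OF that])
qed (rule FObj_P_simps)

lemma FMor_descend_H_1:
  fixes X Y :: "'a complex"
  assumes "X \<in> Obj Cb_1" "Y \<in> Obj Cb_1" "f \<in> carrier (Hom Cb_1 X Y)"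
  shows "FMor (descend Cb_1 P_1 H_1) X Y (FMor P_1 X Y f) = FMor H_1 X Y f"
  by (rule FMor_descend[OF assms(3)]) (rule H_1_const[OF assms])

text \<open>\<open>P_H\<close> is applied to homology groups, whose elements have type
  \<open>'a set\<close>, and \<open>P_H1\<close> to their direct sums, with elements of type
  \<open>int \<Rightarrow> 'a set\<close>. The torsion-free covers behind both have to fit into
  these types.\<close>

lemma infinite_types: "infinite (UNIV :: 'a set set)" "infinite (UNIV :: (int \<Rightarrow> 'a set) set)"
proof -
  have "inj (\<lambda>x :: 'a. {x})" "inj (\<lambda>x :: 'a. \<lambda>_ :: int. {x})"
    by (auto simp: inj_def fun_eq_iff)
  then have "infinite (range (\<lambda>x :: 'a. {x}))" "infinite (range (\<lambda>x :: 'a. \<lambda>_ :: int. {x}))"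
    using inf finite_imageD by blast+
  then show "infinite (UNIV :: 'a set set)" "infinite (UNIV :: (int \<Rightarrow> 'a set) set)"
    by (metis infinite_super subset_UNIV)+
qed

lemma is_functor_H_P: "is_functor (Cb_P :: ('a complex, _) category) Ab_fin_fam H_P"
  unfolding H_P_def by (rule is_functor_comp[OF is_functor_descend_H_C is_functor_P_H[OF infinite_types(1)]])

lemma is_functor_H_P1: "is_functor (Cb_P1 :: ('a complex, _) category) Ab_fin H_P1"
  unfolding H_P1_def by (rule is_functor_comp[OF is_functor_descend_H_1 is_functor_P_H1[OF infinite_types(2)]])

text \<open>In degree zero both sides are the coset of \<open>f\<close>, by \<open>Y[0] = Y\<close>;
  in every other degree the zero of the quotient hom-group is the coset of the zero map.\<close>

lemma FMor_S_P_P_C: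
  fixes X Y :: "'a complex"
  assumes "X \<in> Obj Cb" "Y \<in> Obj Cb"
  shows "FMor S_P X Y (FMor P_C X Y f) = FMor P_1 X Y (FMor S_C X Y f)"
proof
  fix i
  have Y: "bounded_free_complex Y"
    using assms by simp
  have "\<one>\<^bsub>Hom Cb_P X (shift_complex i Y)\<^esub> = FMor P_C X (shift_complex i Y) \<one>\<^bsub>Hom Cb X (shift_complex i Y)\<^esub>"
    using additive_functor_one[OF S.additive_quotient_functor, of X "shift_complex i Y"] assms
      bounded_free_shift_complex[OF Y] by (simp add: Cb_P_def P_C_def)
  then show "FMor S_P X Y (FMor P_C X Y f) i = FMor P_1 X Y (FMor S_C X Y f) i"
    by (simp add: S_P_def S_C_def P_1_def orbit_projection_def shift_P_eq shift_complex_0[OF Y])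
qed

lemma FMor_H_1_S_C:
  fixes X Y :: "'a complex"
  assumes "X \<in> Obj Cb" "Y \<in> Obj Cb" "f \<in> carrier (Hom Cb X Y)"
  shows "FMor H_1 X Y (FMor S_C X Y f) = FMor S_H (homology X) (homology Y) (homology_map X Y f)"
  unfolding H_1_simps(2) S_H_def direct_sum_functor_simps(2)
  using homology_map_direct_sum[of X Y f] assms
  by (intro restrict_ext) (simp add: S_C_def orbit_projection_def homogeneous_def cong: if_cong)

text \<open>By \<open>torsion_sum_group\<close> both sides are functions on the same carrier. One
  restricts each \<open>f i\<close> to torsion before the sum is formed, the other restricts the
  summed map afterwards.\<close>

lemma FMor_S_HP_P_H:
  fixes G H :: "int \<Rightarrow> 'a set monoid"
  assumes G: "G \<in> Obj modZ_fam" and H: "H \<in> Obj modZ_fam" and f: "f \<in> carrier (Hom modZ_fam G H)"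
  shows "FMor S_HP (FObj P_H G) (FObj P_H H) (FMor P_H G H f)
    = FMor P_H1 (FObj S_H G) (FObj S_H H) (FMor S_H G H f)"
proof -
  have cG: "comm_group (G i)" "group (G i)" for i
    using G by (auto simp: modZ_fam_Obj_iff comm_group.axioms(2))
  have T: "torsion (sum_group UNIV G) = sum_group UNIV (\<lambda>i. torsion (G i))"
    by (rule torsion_sum_group[OF cG(1)])
  have sub: "carrier (sum_group UNIV (\<lambda>i. torsion (G i))) \<subseteq> carrier (sum_group UNIV G)"
    by (simp only: T[symmetric] torsion_simps) blast
  have tc: "x i \<in> carrier (torsion (G i))" if "x \<in> carrier (sum_group UNIV (\<lambda>i. torsion (G i)))" for x i
    using that comm_group.axioms(2)[OF comm_group_torsion[OF cG(1)]]
    by (simp only: carrier_sum_group_UNIV)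
  have "FMor P_H1 (FObj S_H G) (FObj S_H H) (FMor S_H G H f)
      = restrict (\<lambda>x\<in>carrier (sum_group UNIV G). (\<lambda>i. f i (x i))) (carrier (torsion (sum_group UNIV G)))"
    using FMor_P_H1[OF infinite_types(2), of "FObj S_H G" "FObj S_H H" "FMor S_H G H f"]
      is_functorD(3)[OF is_functor_S_H G] is_functorD(3)[OF is_functor_S_H H]
      is_functorD(4)[OF is_functor_S_H G H f]
    unfolding torsion_functor_simps modZ_simps(2) S_H_def direct_sum_functor_simps by blast
  moreover have "FMor S_HP (FObj P_H G) (FObj P_H H) (FMor P_H G H f)
      = (\<lambda>x\<in>carrier (sum_group UNIV (\<lambda>i. torsion (G i))). (\<lambda>i. restrict (f i) (carrier (torsion (G i))) (x i)))"
    unfolding FMor_P_H[OF infinite_types(1) G H f] FObj_P_H S_HP_def direct_sum_functor_simps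
      family_functor_simps torsion_functor_simps ..
  ultimately show ?thesis
    unfolding T using tc by (auto simp: Int_absorb1[OF sub] simp del: torsion_simps intro!: restrict_ext)
qed

end

theorem proposition5p3p1:
  assumes "infinite (UNIV :: 'a set)"
  shows
    "is_functor (Cb :: ('a complex, _) category) Cb_1 S_C \<and>
     is_functor (Cb_P :: ('a complex, _) category) Cb_P1 S_P \<and>
     is_functor (modZ_fam :: (int \<Rightarrow> 'a set monoid, _) category) modZ S_H \<and>
     is_functor (Ab_fin_fam :: (int \<Rightarrow> 'a set monoid, _) category) Ab_fin S_HP \<and>
     is_functor (Cb :: ('a complex, _) category) Cb_P P_C \<and>
     is_functor (Cb_1 :: ('a complex, _) category) Cb_P1 P_1 \<and>
     is_functor (modZ_fam :: (int \<Rightarrow> 'a set monoid, _) category) Ab_fin_fam P_H \<and>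
     is_functor (modZ :: ((int \<Rightarrow> 'a set) monoid, _) category) Ab_fin P_H1 \<and>
     is_functor (Cb :: ('a complex, _) category) modZ_fam H_C \<and>
     is_functor (Cb_1 :: ('a complex, _) category) modZ H_1 \<and>
     is_functor (Cb_P :: ('a complex, _) category) Ab_fin_fam H_P \<and>
     is_functor (Cb_P1 :: ('a complex, _) category) Ab_fin H_P1 \<and>
     naturally_isomorphic (Cb :: ('a complex, _) category) Cb_P1
        (S_P \<circ>\<^sub>F P_C) (P_1 \<circ>\<^sub>F S_C) \<and>
     naturally_isomorphic (modZ_fam :: (int \<Rightarrow> 'a set monoid, _) category) Ab_fin
        (S_HP \<circ>\<^sub>F P_H) (P_H1 \<circ>\<^sub>F S_H) \<and>
     naturally_isomorphic (Cb :: ('a complex, _) category) Ab_fin_fam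
        (H_P \<circ>\<^sub>F P_C) (P_H \<circ>\<^sub>F H_C) \<and>
     naturally_isomorphic (Cb_1 :: ('a complex, _) category) Ab_fin
        (H_P1 \<circ>\<^sub>F P_1) (P_H1 \<circ>\<^sub>F H_1) \<and>
     naturally_isomorphic (Cb :: ('a complex, _) category) modZ
        (H_1 \<circ>\<^sub>F S_C) (S_H \<circ>\<^sub>F H_C) \<and>
     naturally_isomorphic (Cb_P :: ('a complex, _) category) Ab_fin
        (H_P1 \<circ>\<^sub>F S_P) (S_HP \<circ>\<^sub>F H_P)"
proof -
  note inf = assms and inf1 = infinite_types(1)[OF assms] and inf2 = infinite_types(2)[OF assms]
  note SC = is_functor_S_C[OF inf] and SP = is_functor_S_P[OF inf] and PC = is_functor_P_C[OF inf]
    and P1 = is_functor_P_1[OF inf] and PH = is_functor_P_H[OF inf1] and PH1 = is_functor_P_H1[OF inf2]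
    and HP = is_functor_H_P[OF inf] and HP1 = is_functor_H_P1[OF inf]
  note SH = is_functor_S_H[where 'b = "'a set"] and SHP = is_functor_S_HP[where 'b = "'a set"]
    and HC = is_functor_H_C[where 'a = 'a] and H1 = is_functor_H_1[where 'a = 'a]
  have sum_obj: "FObj (S_HP \<circ>\<^sub>F P_H) G = FObj (P_H1 \<circ>\<^sub>F S_H) G"
    if "G \<in> Obj modZ_fam" for G :: "int \<Rightarrow> 'a set monoid"
    using that by (simp add: S_HP_def S_H_def torsion_sum_group modZ_fam_Obj_iff)
  have mor_H_P: "FMor H_P X Y (FMor P_C X Y f) = FMor P_H (homology X) (homology Y) (FMor H_C X Y f)"
    if "X \<in> Obj Cb" "Y \<in> Obj Cb" "f \<in> carrier (Hom Cb X Y)" for X Y :: "'a complex" and f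
    using FMor_descend_H_C[OF inf that] by (simp add: H_P_def)
  have mor_H_P1: "FMor H_P1 X Y (FMor P_1 X Y f) = FMor P_H1 (total_homology X) (total_homology Y) (FMor H_1 X Y f)"
    if "X \<in> Obj Cb_1" "Y \<in> Obj Cb_1" "f \<in> carrier (Hom Cb_1 X Y)" for X Y :: "'a complex" and f
    using FMor_descend_H_1[OF inf that] by (simp add: H_P1_def H_1_simps(1))
  have obj_H_P: "FObj H_P X = FObj P_H (homology X)" "FObj H_P1 X = FObj P_H1 (total_homology X)"
    for X :: "'a complex"
    by (simp_all add: H_P_def H_P1_def H_1_simps(1))
  have "naturally_isomorphic (Cb :: ('a complex, _) category) Cb_P1 (S_P \<circ>\<^sub>F P_C) (P_1 \<circ>\<^sub>F S_C)"
    by (rule naturally_isomorphic_if_eq[OF is_functor_comp[OF PC SP] is_functor_comp[OF SC P1]])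
      (simp_all only: FObj_comp FMor_comp FObj_P_simps FMor_S_P_P_C[OF inf])
  moreover have "naturally_isomorphic (modZ_fam :: (int \<Rightarrow> 'a set monoid, _) category) Ab_fin
        (S_HP \<circ>\<^sub>F P_H) (P_H1 \<circ>\<^sub>F S_H)"
    by (rule naturally_isomorphic_if_eq[OF is_functor_comp[OF PH SHP] is_functor_comp[OF SH PH1] sum_obj])
      (simp_all only: FMor_comp FMor_S_HP_P_H[OF inf])
  moreover have "naturally_isomorphic (Cb :: ('a complex, _) category) Ab_fin_fam (H_P \<circ>\<^sub>F P_C) (P_H \<circ>\<^sub>F H_C)"
    by (rule naturally_isomorphic_if_eq[OF is_functor_comp[OF PC HP] is_functor_comp[OF HC PH]])
      (simp_all only: FObj_comp FMor_comp FObj_P_simps mor_H_P obj_H_P H_C_simps(1))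
  moreover have "naturally_isomorphic (Cb_1 :: ('a complex, _) category) Ab_fin (H_P1 \<circ>\<^sub>F P_1) (P_H1 \<circ>\<^sub>F H_1)"
    by (rule naturally_isomorphic_if_eq[OF is_functor_comp[OF P1 HP1] is_functor_comp[OF H1 PH1]])
      (simp_all only: FObj_comp FMor_comp FObj_P_simps mor_H_P1 obj_H_P H_1_simps(1))
  moreover have "naturally_isomorphic (Cb :: ('a complex, _) category) modZ (H_1 \<circ>\<^sub>F S_C) (S_H \<circ>\<^sub>F H_C)"
    by (rule naturally_isomorphic_if_eq[OF is_functor_comp[OF SC H1] is_functor_comp[OF HC SH]])
      (simp_all only: FObj_comp FMor_comp FObj_P_simps FMor_H_1_S_C[OF inf] H_C_simps H_1_simps(1)
        S_H_def direct_sum_functor_simps(1))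
  moreover have "naturally_isomorphic (Cb_P :: ('a complex, _) category) Ab_fin (H_P1 \<circ>\<^sub>F S_P) (S_HP \<circ>\<^sub>F H_P)"
  proof (rule naturally_isomorphic_if_eq[OF is_functor_comp[OF SP HP1] is_functor_comp[OF HP SHP]])
    fix X Y :: "'a complex" and g
    assume "X \<in> Obj Cb_P"
    then have X: "X \<in> Obj Cb"
      by (simp only: Cb_P_simps)
    note HX = is_functorD(3)[OF HC X, unfolded H_C_simps(1)]
    show "FObj (H_P1 \<circ>\<^sub>F S_P) X = FObj (S_HP \<circ>\<^sub>F H_P) X"
      using sum_obj[OF HX] by (simp add: H_P1_def H_P_def FObj_P_simps H_1_simps(1) S_H_def)
    assume "Y \<in> Obj Cb_P" and "g \<in> carrier (Hom Cb_P X Y)"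
    \<comment> \<open>Fullness of \<open>P_C\<close> makes every \<open>g\<close> the coset of some
      \<open>f\<close>, so this face may be checked after composition with \<open>P_C\<close>. There
      it follows from the other five faces by going round the cube.\<close>
    then obtain f where Y: "Y \<in> Obj Cb" and f: "f \<in> carrier (Hom Cb X Y)" "g = FMor P_C X Y f"
      using P_C_full[OF inf] by (metis Cb_P_simps(1))
    note HY = is_functorD(3)[OF HC Y, unfolded H_C_simps(1)]
    have Sf: "FMor S_C X Y f \<in> carrier (Hom Cb_1 X Y)"
      using is_functorD(4)[OF SC X Y f(1)] by (simp only: FObj_P_simps)
    have "FMor H_P1 X Y (FMor S_P X Y g) = FMor H_P1 X Y (FMor P_1 X Y (FMor S_C X Y f))"
      by (simp only: f(2) FMor_S_P_P_C[OF inf X Y])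
    also have "\<dots> = FMor P_H1 (total_homology X) (total_homology Y) (FMor H_1 X Y (FMor S_C X Y f))"
      using X Y by (intro mor_H_P1[OF _ _ Sf]) (simp_all only: Cb_P_simps)
    also have "\<dots> = FMor P_H1 (FObj S_H (homology X)) (FObj S_H (homology Y))
        (FMor S_H (homology X) (homology Y) (homology_map X Y f))"
      by (simp only: FMor_H_1_S_C[OF inf X Y f(1)] S_H_def direct_sum_functor_simps(1))
    also have "\<dots> = FMor S_HP (FObj P_H (homology X)) (FObj P_H (homology Y))
        (FMor P_H (homology X) (homology Y) (homology_map X Y f))"
      using is_functorD(4)[OF HC X Y f(1)] unfolding H_C_simps
      by (intro FMor_S_HP_P_H[OF inf HX HY, symmetric])
    also have "\<dots> = FMor S_HP (FObj H_P X) (FObj H_P Y) (FMor H_P X Y g)"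
      by (simp only: f(2) mor_H_P[OF X Y f(1)] H_C_simps obj_H_P)
    finally show "FMor (H_P1 \<circ>\<^sub>F S_P) X Y g = FMor (S_HP \<circ>\<^sub>F H_P) X Y g"
      by (simp only: FMor_comp FObj_P_simps)
  qed
  ultimately show ?thesis
    using SC SP SH SHP PC P1 PH PH1 HC H1 HP HP1 by blast
qed

end
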